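(* Let $n\ge 1$, let $\Omega\subset\mathbb{R}^n$ be a bounded open set, let $1<p<\infty$, and let $\sigma$ be a nonnegative locally finite measure in $\Omega$. Consider the problem $$-\Delta_p u=|\nabla u|^p+\sigma \ \text{ in }\Omega,\qquad u=0\ \text{ on }\partial\Omega, \tag{P}$$ and, for a constant $\lambda>0$, the inequality $$\int_\Omega|\varphi|^p\,d\sigma\le\lambda\int_\Omega|\nabla\varphi|^p\,dx\qquad\text{for all }\varphi\in C_c^\infty(\Omega). \tag{I$_\lambda$}$$ (1) If (P) has a solution $u\in W^{1,p}_0(\Omega)$, then $\sigma\in(W^{1,p}_0(\Omega))^*$ and (I$_\lambda$) holds with $\lambda=(p-1)^{p-1}$. (2) Conversely, if $\sigma\ge 0$, $\sigma\in(W^{1,p}_0(\Omega))^*$, and (I$_\lambda$) holds for some $0<\lambda<(p-1)^{p-1}$, then (P) has a nonnegative solution $u\in W^{1,p}_0(\Omega)$ such that $e^{\frac{\delta u}{p-1}}-1\in W^{1,p}_0(\Omega)$ for all $\delta\in[0,\delta_0)$, where $\delta_0=(p-1)\lambda^{\frac{-1}{p-1}}$.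
   Context: $\Delta_p u=\operatorname{div}(|\nabla u|^{p-2}\nabla u)$ is the $p$-Laplacian. $W^{1,p}_0(\Omega)$ is the completion of $C_c^\infty(\Omega)$ under $\|\nabla(\cdot)\|_{L^p(\Omega)}$, and $(W^{1,p}_0(\Omega))^*$ is its dual; a distribution (in particular a locally finite measure) $\sigma$ in $\Omega$ belongs to $(W_0^{1,p}(\Omega))^*$ if $|\langle\sigma,\varphi\rangle|\le C\|\nabla\varphi\|_{L^p(\Omega)}$ for all $\varphi\in C_c^\infty(\Omega)$, for some constant $C$. A solution of (P) is a function $u\in W^{1,p}_0(\Omega)$ such that $$\int_\Omega|\nabla u|^{p-2}\nabla u\cdot\nabla\varphi\,dx=\int_\Omega|\nabla u|^p\varphi\,dx+\langle\sigma,\varphi\rangle\qquad\text{for all }\varphi\in C_c^\infty(\Omega).$$ *)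

theory Defs
  imports "HOL-Analysis.Analysis"
begin

text \<open>
  Throughout, \<open>\<real>\<^sup>n\<close> is a type \<open>'a::euclidean_space\<close> with \<open>n = DIM('a) \<ge> 1\<close>.
\<close>

fun C_k :: "nat \<Rightarrow> ('a::euclidean_space \<Rightarrow> real) \<Rightarrow> bool" where
  "C_k 0 f \<longleftrightarrow> continuous_on UNIV f"
| "C_k (Suc k) f \<longleftrightarrow> (\<forall>x. f differentiable at x) \<and>
     (\<forall>b\<in>Basis. C_k k (\<lambda>x. frechet_derivative f (at x) b))"

text \<open>
  The space \<open>C\<^sub>c\<^sup>\<infinity>(\<Omega>)\<close>; a test function is extended by \<open>0\<close> to the whole space.
\<close>

definition test_functions :: "'a::euclidean_space set \<Rightarrow> ('a \<Rightarrow> real) set" where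
  "test_functions \<Omega> = {\<phi>. (\<forall>k. C_k k \<phi>) \<and>
     compact (closure {x. \<phi> x \<noteq> 0}) \<and> closure {x. \<phi> x \<noteq> 0} \<subseteq> \<Omega>}"

definition grad :: "('a::euclidean_space \<Rightarrow> real) \<Rightarrow> 'a \<Rightarrow> 'a" where
  "grad f x = (\<Sum>b\<in>Basis. frechet_derivative f (at x) b *\<^sub>R b)"

text \<open>
  \<open>W01p_grad p \<Omega> u g\<close>: the function \<open>u\<close> belongs to \<open>W\<^sub>0\<^sup>1\<^sup>,\<^sup>p(\<Omega>)\<close> and \<open>\<nabla>u = g\<close> almost everywhere in \<open>\<Omega>\<close>.
  A point of the completion of \<open>C\<^sub>c\<^sup>\<infinity>(\<Omega>)\<close> under \<open>\<parallel>\<nabla>\<cdot>\<parallel>\<close> in \<open>L\<^sup>p\<close> is given by test functions whose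
  gradients converge in \<open>L\<^sup>p(\<Omega>)\<close>. For bounded \<open>\<Omega>\<close> these test functions then converge in \<open>L\<^sup>p(\<Omega>)\<close>
  as well (Poincare inequality), and their limit \<open>u\<close> is the function that the point stands for;
  the limit \<open>g\<close> of the gradients is the extension of \<open>\<nabla>\<close> to the completion, and it is
  the distributional gradient of \<open>u\<close>. Only the values on \<open>\<Omega>\<close>, up to null sets, matter.
\<close>

definition W01p_grad ::
    "real \<Rightarrow> 'a::euclidean_space set \<Rightarrow> ('a \<Rightarrow> real) \<Rightarrow> ('a \<Rightarrow> 'a) \<Rightarrow> bool" where
  "W01p_grad p \<Omega> u g \<longleftrightarrow>
     u \<in> borel_measurable (lebesgue_on \<Omega>) \<and>
     g \<in> borel_measurable (lebesgue_on \<Omega>) \<and>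
     (\<exists>\<phi>. (\<forall>k::nat. \<phi> k \<in> test_functions \<Omega>) \<and>
        (\<lambda>k. \<integral>\<^sup>+x. ennreal (norm (grad (\<phi> k) x - g x) powr p) \<partial>lebesgue_on \<Omega>) \<longlonglongrightarrow> 0 \<and>
        (\<lambda>k. \<integral>\<^sup>+x. ennreal (\<bar>\<phi> k x - u x\<bar> powr p) \<partial>lebesgue_on \<Omega>) \<longlonglongrightarrow> 0)"

definition W01p :: "real \<Rightarrow> 'a::euclidean_space set \<Rightarrow> ('a \<Rightarrow> real) set" where
  "W01p p \<Omega> = {u. \<exists>g. W01p_grad p \<Omega> u g}"

text \<open>
  Nonnegative locally finite Borel measures in \<open>\<Omega>\<close>, that is, with space \<open>\<Omega>\<close>; such a measure acts
  on a test function by integration. It need not be finite near the boundary of \<open>\<Omega>\<close>.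
\<close>

definition locally_finite_measure_in ::
    "'a::euclidean_space set \<Rightarrow> 'a measure \<Rightarrow> bool" where
  "locally_finite_measure_in \<Omega> \<sigma> \<longleftrightarrow>
     sets \<sigma> = sets (restrict_space borel \<Omega>) \<and>
     (\<forall>K. compact K \<and> K \<subseteq> \<Omega> \<longrightarrow> emeasure \<sigma> K < \<infinity>)"

definition in_dual_W01p ::
    "real \<Rightarrow> 'a::euclidean_space set \<Rightarrow> 'a measure \<Rightarrow> bool" where
  "in_dual_W01p p \<Omega> \<sigma> \<longleftrightarrow>
     (\<exists>C. \<forall>\<phi>\<in>test_functions \<Omega>.
        \<bar>\<integral>x. \<phi> x \<partial>\<sigma>\<bar> \<le> C * (\<integral>x. norm (grad \<phi> x) powr p \<partial>lebesgue_on \<Omega>) powr (1 / p))"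

definition solves_P ::
    "real \<Rightarrow> 'a::euclidean_space set \<Rightarrow> 'a measure \<Rightarrow> ('a \<Rightarrow> real) \<Rightarrow> bool" where
  "solves_P p \<Omega> \<sigma> u \<longleftrightarrow>
     (\<exists>g. W01p_grad p \<Omega> u g \<and>
        (\<forall>\<phi>\<in>test_functions \<Omega>.
           (\<integral>x. norm (g x) powr (p - 2) * (g x \<bullet> grad \<phi> x) \<partial>lebesgue_on \<Omega>) =
           (\<integral>x. norm (g x) powr p * \<phi> x \<partial>lebesgue_on \<Omega>) + (\<integral>x. \<phi> x \<partial>\<sigma>)))"

definition ineq_I ::
    "real \<Rightarrow> 'a::euclidean_space set \<Rightarrow> 'a measure \<Rightarrow> real \<Rightarrow> bool" where
  "ineq_I p \<Omega> \<sigma> c \<longleftrightarrow>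
     (\<forall>\<phi>\<in>test_functions \<Omega>.
        (\<integral>x. \<bar>\<phi> x\<bar> powr p \<partial>\<sigma>) \<le> c * (\<integral>x. norm (grad \<phi> x) powr p \<partial>lebesgue_on \<Omega>))"

end

theory Submission
  imports Defs
begin

text \<open>
  Part (1): testing the equation with smooth approximations of \<open>\<bar>\<phi>\<bar>\<close> and \<open>\<bar>\<phi>\<bar>\<^sup>p\<close> and using Young's
  inequality pointwise bounds \<open>\<integral> \<bar>\<phi>\<bar> d\<sigma>\<close> and \<open>\<integral> \<bar>\<phi>\<bar>\<^sup>p d\<sigma>\<close>.

  Part (2): put \<open>u = (p - 1) z\<close>, \<open>\<rho> = e\<^sup>p\<^sup>z\<close> and \<open>c = (p - 1)\<^sup>1\<^sup>-\<^sup>p\<close>. The functional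
  \<open>J(z) = \<integral> \<bar>\<nabla>z\<bar>\<^sup>p e\<^sup>p\<^sup>z dx - c \<integral> (e\<^sup>p\<^sup>z - 1) d\<sigma>\<close> on \<open>C\<^sub>c\<^sup>\<infinity>(\<Omega>)\<close> is convex as a function of \<open>\<rho>\<close>, and its
  Euler-Lagrange equation for perturbations \<open>\<rho> + t \<phi>\<close> is exactly the problem (P) for \<open>u\<close>. By
  (I) with \<open>l < (p - 1)\<^sup>p\<^sup>-\<^sup>1\<close> it is coercive in \<open>e\<^sup>z - 1\<close>. Along a minimizing sequence with
  \<open>z \<ge> -1\<close> the uniform strict convexity makes the gradients Cauchy in \<open>L\<^sup>p\<close>. Lower semicontinuity of
  \<open>J\<close> (problematic, because the term with \<open>\<sigma>\<close> is critical) is not needed: an almost minimizer satisfies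
  the Euler-Lagrange equation up to a small error, in which \<open>\<sigma>\<close> enters only through the fixed
  number \<open>\<integral> \<phi> d\<sigma>\<close>, so one can pass to the limit. Perturbing an almost minimizer by a multiple of a
  truncated \<open>e\<^sup>p\<^sup>\<delta>\<^sup>z\<close> gives the exponential integrability.
\<close>

section \<open>Smooth functions and test functions\<close>

text \<open>With \<open>v = exp z\<close>, the substitution \<open>u = (p - 1) z\<close> turns (P)
  into the homogeneous equation \<open>-\<Delta>_p v = c \<sigma> v^(p-1)\<close> with
  \<open>v = 1\<close> on the boundary: the gradient term disappears, because \<open>-\<Delta>_p v =
  exp ((p - 1) z) (-\<Delta>_p z - (p - 1) |\<nabla>z|^p)\<close>, and \<open>c\<close> is the
  factor left at \<open>\<sigma>\<close> after division by \<open>(p - 1)^(p-1)\<close>.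
  \<open>J\<close> is the energy of this equation. By (I) its \<open>\<sigma>\<close> term is at
  most \<open>c l\<close> times its gradient term up to lower order, so \<open>c l = 1\<close> is
  critical; the exponents are governed by the same product, since
  \<open>c l \<delta>^(p-1) < 1\<close> means \<open>\<delta> < \<delta>_0\<close>. In
  \<open>v\<close> the \<open>\<sigma>\<close> term has the wrong curvature. In
  \<open>\<rho> = v^p\<close> it is affine, while the gradient term becomes
  \<open>p^(-p) \<rho>^(1-p) |\<nabla>\<rho>|^p\<close>, which is jointly convex in
  \<open>\<rho>\<close> and \<open>\<nabla>\<rho>\<close>. All competitors stay in
  \<open>C_c^\<infinity>\<close>, so that \<open>\<sigma>\<close> never has to act on a limit
  function; the price is that every truncation has to be smooth.\<close>

lemma C_k_SucI:
  assumes "\<And>x. (f has_derivative f' x) (at x)" and "\<And>b. b \<in> Basis \<Longrightarrow> C_k k (\<lambda>x. f' x b)"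
  shows "C_k (Suc k) f"
proof -
  have "frechet_derivative f (at x) = f' x" for x
    using frechet_derivative_at[OF assms(1)[of x]] by simp
  then show ?thesis using assms by (auto simp: differentiable_def)
qed

lemma C_k_SucD:
  assumes "C_k (Suc k) f"
  shows "(f has_derivative frechet_derivative f (at x)) (at x)"
    and "b \<in> Basis \<Longrightarrow> C_k k (\<lambda>x. frechet_derivative f (at x) b)"
  using assms by (auto simp: frechet_derivative_works)

lemma C_k_Suc_imp_C_k: "C_k (Suc k) f \<Longrightarrow> C_k k f"
proof (induction k arbitrary: f)
  case 0
  then show ?case
    by (auto intro!: continuous_at_imp_continuous_on differentiable_imp_continuous_within)
next
  case (Suc k)
  then show ?case by (metis C_k.simps(2))
qed

lemma C_k_const: "C_k k (\<lambda>x. c)"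
proof (induction k arbitrary: c)
  case (Suc k)
  show ?case by (rule C_k_SucI[where f' = "\<lambda>x h. 0"]) (use Suc in auto)
qed simp

lemma C_k_add: "C_k k f \<Longrightarrow> C_k k g \<Longrightarrow> C_k k (\<lambda>x. f x + g x)"
proof (induction k arbitrary: f g)
  case (Suc k)
  note f = C_k_SucD[OF Suc.prems(1)] and g = C_k_SucD[OF Suc.prems(2)]
  show ?case
    by (rule C_k_SucI[OF has_derivative_add[OF f(1) g(1)]]) (use f(2) g(2) Suc.IH in auto)
qed (auto intro: continuous_on_add)

lemma C_k_mult: "C_k k f \<Longrightarrow> C_k k g \<Longrightarrow> C_k k (\<lambda>x. f x * g x)"
proof (induction k arbitrary: f g)
  case (Suc k)
  note f = C_k_SucD[OF Suc.prems(1)] and g = C_k_SucD[OF Suc.prems(2)]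
  show ?case
    by (rule C_k_SucI[OF has_derivative_mult[OF f(1) g(1)]])
      (use f(2) g(2) Suc.IH Suc.prems[THEN C_k_Suc_imp_C_k] in \<open>auto intro!: C_k_add\<close>)
qed (auto intro: continuous_on_mult)

text \<open>Differentiating \<open>D n\<close> composed with \<open>f\<close> gives
  \<open>D (Suc n)\<close> composed with \<open>f\<close> times a first derivative of
  \<open>f\<close>. Hence a whole tower of derivatives is carried and the induction over
  \<open>k\<close> runs for all \<open>n\<close> at once. The set \<open>S\<close> admits outer
  functions that are smooth only on part of the line, such as real powers.\<close>

lemma C_k_compose:
  fixes D :: "nat \<Rightarrow> real \<Rightarrow> real"
  assumes D: "\<And>n y. y \<in> S \<Longrightarrow> (D n has_real_derivative D (Suc n) y) (at y)"
    and S: "\<And>x. f x \<in> S"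
  shows "C_k k f \<Longrightarrow> C_k k (\<lambda>x. D n (f x))"
proof (induction k arbitrary: n)
  case 0
  have "isCont (\<lambda>x. D n (f x)) x" for x
    using 0 DERIV_isCont[OF D[OF S]]
    by (intro isCont_o2[of x f "D n"]) (auto simp: continuous_on_eq_continuous_at)
  then show ?case by (simp add: continuous_at_imp_continuous_on)
next
  case (Suc k)
  note f = C_k_SucD[OF Suc.prems]
  have "((\<lambda>x. D n (f x)) has_derivative (\<lambda>h. D (Suc n) (f x) * frechet_derivative f (at x) h)) (at x)"
    for x
    using has_derivative_compose[OF f(1) D[OF S, unfolded has_field_derivative_def]] by simp
  then show ?case
    by (rule C_k_SucI) (use f(2) Suc.IH C_k_Suc_imp_C_k[OF Suc.prems] in \<open>auto intro: C_k_mult\<close>)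
qed

definition smooth :: "('a::euclidean_space \<Rightarrow> real) \<Rightarrow> bool" where
  "smooth f \<longleftrightarrow> (\<forall>k. C_k k f)"

lemma smooth_const [simp, intro]: "smooth (\<lambda>x. c)"
  by (simp add: smooth_def C_k_const)

lemma smooth_add [intro]: "smooth f \<Longrightarrow> smooth g \<Longrightarrow> smooth (\<lambda>x. f x + g x)"
  by (simp add: smooth_def C_k_add)

lemma smooth_mult [intro]: "smooth f \<Longrightarrow> smooth g \<Longrightarrow> smooth (\<lambda>x. f x * g x)"
  by (simp add: smooth_def C_k_mult)

lemma smooth_diff [intro]: "smooth f \<Longrightarrow> smooth g \<Longrightarrow> smooth (\<lambda>x. f x - g x)"
  using smooth_add[of f "\<lambda>x. (-1) * g x"] smooth_mult[of "\<lambda>x. -1" g] by simp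

lemma smooth_exp [intro]: "smooth f \<Longrightarrow> smooth (\<lambda>x. exp (f x))"
  unfolding smooth_def
  using C_k_compose[of UNIV "\<lambda>n. exp" f] by (auto intro: DERIV_exp)

lemma smooth_powr [intro]:
  assumes "smooth f" "\<And>x. f x > 0"
  shows "smooth (\<lambda>x. f x powr a)"
proof -
  define D where "D n y = (\<Prod>i<n. a - real i) * y powr (a - real n)" for n y
  have "(D n has_real_derivative D (Suc n) y) (at y)" if "y \<in> {0<..}" for n y
    unfolding D_def using that
    by (auto intro!: derivative_eq_intros simp: algebra_simps)
  from C_k_compose[of "{0<..}" D f _ 0, OF this] assms show ?thesis
    by (auto simp: smooth_def D_def)
qed

lemma smooth_divide [intro]:
  assumes "smooth f" "smooth g" "\<And>x. g x > 0"
  shows "smooth (\<lambda>x. f x / g x)"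
proof -
  have "smooth (\<lambda>x. f x * g x powr (-1))" using assms by (intro smooth_mult smooth_powr)
  moreover have "f x * g x powr (-1) = f x / g x" for x
    using assms(3)[of x] by (simp add: powr_minus_divide abs_of_pos)
  ultimately show ?thesis by (simp only:)
qed

text \<open>One differentiation leaves the logarithms: the derivative has the factor
  \<open>1 / f\<close>, which is smooth by \<open>smooth_divide\<close>, so a case split on the
  order suffices.\<close>

lemma smooth_ln [intro]:
  assumes "smooth f" "\<And>x. f x > 0"
  shows "smooth (\<lambda>x. ln (f x))"
  unfolding smooth_def
proof
  fix k
  show "C_k k (\<lambda>x. ln (f x))"
  proof (cases k)
    case 0
    have "C_k 0 f" using assms unfolding smooth_def by blast
    then show ?thesis using 0 assms(2) by (auto intro!: continuous_on_ln simp: less_imp_neq[THEN not_sym])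
  next
    case (Suc j)
    have "C_k (Suc j) f" using assms unfolding smooth_def by blast
    note f = C_k_SucD[OF this]
    have inv: "C_k j (\<lambda>x. 1 / f x)"
      using smooth_divide[OF smooth_const assms] unfolding smooth_def by blast
    have "C_k (Suc j) (\<lambda>x. ln (f x))"
    proof (rule C_k_SucI)
      fix x
      show "((\<lambda>x. ln (f x)) has_derivative (\<lambda>h. 1 / f x * frechet_derivative f (at x) h)) (at x)"
        using f(1)[of x] assms(2)[of x] by (auto intro!: derivative_eq_intros simp: field_simps)
    next
      fix b :: 'a assume "b \<in> Basis"
      then show "C_k j (\<lambda>x. 1 / f x * frechet_derivative f (at x) b)"
        using f(2) inv by (intro C_k_mult) auto
    qed
    then show ?thesis using Suc by simp
  qed
qed

lemma smooth_imp_continuous: "smooth f \<Longrightarrow> continuous_on UNIV f"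
  unfolding smooth_def by (metis C_k.simps(1))

lemma smooth_imp_differentiable: "smooth f \<Longrightarrow> f differentiable at x"
  unfolding smooth_def by (metis C_k.simps(2))

section \<open>Gradients and the chain rule\<close>

lemma GDERIV_grad:
  assumes "f differentiable at x"
  shows "GDERIV f x :> grad f x"
proof -
  let ?F = "frechet_derivative f (at x)"
  have F: "(f has_derivative ?F) (at x)" using assms frechet_derivative_works by blast
  then interpret F: linear ?F by (rule has_derivative_linear)
  have "?F h = h \<bullet> grad f x" for h
  proof -
    have "?F h = ?F (\<Sum>b\<in>Basis. (h \<bullet> b) *\<^sub>R b)" by (simp add: euclidean_representation)
    also have "\<dots> = (\<Sum>b\<in>Basis. (h \<bullet> b) * ?F b)" by (simp add: F.sum F.scaleR)
    also have "\<dots> = h \<bullet> grad f x" by (simp add: grad_def inner_sum_right mult.commute)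
    finally show ?thesis .
  qed
  then have "?F = (\<lambda>h. h \<bullet> grad f x)" by auto
  with F show ?thesis by (simp add: gderiv_def)
qed

lemma grad_eqI:
  assumes "GDERIV f x :> D"
  shows "grad f x = D"
proof -
  have "frechet_derivative f (at x) = (\<lambda>h. h \<bullet> D)"
    using assms frechet_derivative_at unfolding gderiv_def by metis
  then show ?thesis by (simp add: grad_def euclidean_representation inner_commute[of _ D])
qed

lemma smooth_GDERIV: "smooth f \<Longrightarrow> GDERIV f x :> grad f x"
  by (rule GDERIV_grad[OF smooth_imp_differentiable])

lemma grad_compose:
  assumes "smooth f" "(F has_real_derivative F') (at (f x))"
  shows "grad (\<lambda>x. F (f x)) x = F' *\<^sub>R grad f x"
  by (rule grad_eqI[OF GDERIV_DERIV_compose[OF smooth_GDERIV[OF assms(1)] assms(2)]])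

lemma continuous_on_grad:
  assumes "smooth f"
  shows "continuous_on UNIV (grad f)"
proof -
  have "C_k (Suc 0) f" using assms unfolding smooth_def by blast
  then have "continuous_on UNIV (\<lambda>x. frechet_derivative f (at x) b)" if "b \<in> Basis" for b
    using that by simp
  then show ?thesis unfolding grad_def[abs_def] by (intro continuous_intros)
qed

section \<open>Stability of test functions under smooth operations\<close>

lemma test_functions_smooth: "\<phi> \<in> test_functions \<Omega> \<Longrightarrow> smooth \<phi>"
  by (simp add: test_functions_def smooth_def)

text \<open>Two controlling functions, because later competitors such as
  \<open>ln (exp (p * z x) + \<phi> x) / p\<close> are known to vanish only where both
  \<open>z\<close> and \<open>\<phi>\<close> do.\<close>

lemma test_functionsI2:
  assumes "\<phi> \<in> test_functions \<Omega>" "\<psi> \<in> test_functions \<Omega>" "smooth f"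
    and "\<And>x. \<phi> x = 0 \<Longrightarrow> \<psi> x = 0 \<Longrightarrow> f x = 0"
  shows "f \<in> test_functions \<Omega>"
proof -
  let ?K = "closure {x. \<phi> x \<noteq> 0} \<union> closure {x. \<psi> x \<noteq> 0}"
  have K: "compact ?K" "?K \<subseteq> \<Omega>" using assms by (auto simp: test_functions_def)
  have "{x. f x \<noteq> 0} \<subseteq> {x. \<phi> x \<noteq> 0} \<union> {x. \<psi> x \<noteq> 0}"
    using assms(4) by auto
  also have "\<dots> \<subseteq> ?K" by (intro Un_mono closure_subset)
  finally have sub: "closure {x. f x \<noteq> 0} \<subseteq> ?K" using K(1) by (intro closure_minimal compact_imp_closed)
  then have "closure {x. f x \<noteq> 0} \<subseteq> \<Omega>" using K by blast
  moreover have "compact (closure {x. f x \<noteq> 0})"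
    using sub K(1) by (metis closed_closure compact_Int_closed inf.absorb_iff2)
  ultimately show ?thesis using assms(3) by (simp add: test_functions_def smooth_def)
qed

lemma test_functionsI:
  assumes "\<phi> \<in> test_functions \<Omega>" "smooth f" and "\<And>x. \<phi> x = 0 \<Longrightarrow> f x = 0"
  shows "f \<in> test_functions \<Omega>"
  by (rule test_functionsI2[OF assms(1) assms(1) assms(2)]) (rule assms(3))

lemma test_functions_add:
  "\<phi> \<in> test_functions \<Omega> \<Longrightarrow> \<psi> \<in> test_functions \<Omega> \<Longrightarrow> (\<lambda>x. \<phi> x + \<psi> x) \<in> test_functions \<Omega>"
  by (rule test_functionsI2[of \<phi> _ \<psi>]) (auto dest: test_functions_smooth)

lemma test_functions_diff:
  "\<phi> \<in> test_functions \<Omega> \<Longrightarrow> \<psi> \<in> test_functions \<Omega> \<Longrightarrow> (\<lambda>x. \<phi> x - \<psi> x) \<in> test_functions \<Omega>"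
  by (rule test_functionsI2[of \<phi> _ \<psi>]) (auto dest: test_functions_smooth)

lemma test_functions_cmult:
  "\<phi> \<in> test_functions \<Omega> \<Longrightarrow> (\<lambda>x. c * \<phi> x) \<in> test_functions \<Omega>"
  by (rule test_functionsI[of \<phi>]) (auto dest: test_functions_smooth)

lemma test_functions_zero: "(\<lambda>x. 0) \<in> test_functions \<Omega>"
  by (simp add: test_functions_def C_k_const)

lemma grad_diff:
  "smooth f \<Longrightarrow> smooth g \<Longrightarrow> grad (\<lambda>x. f x - g x) x = grad f x - grad g x"
  by (intro grad_eqI GDERIV_diff smooth_GDERIV)

lemma grad_cmult: "smooth f \<Longrightarrow> grad (\<lambda>x. c * f x) x = c *\<^sub>R grad f x"
  using grad_compose[of f "\<lambda>y. c * y" c x] by (auto intro!: derivative_eq_intros)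

lemma grad_eq_0:
  assumes "x \<notin> closure {x. \<phi> x \<noteq> 0}"
  shows "grad \<phi> x = 0"
proof -
  let ?U = "- closure {x. \<phi> x \<noteq> 0}"
  have "\<phi> y = 0" if "y \<in> ?U" for y using that closure_subset[of "{x. \<phi> x \<noteq> 0}"] by auto
  then have "(\<phi> has_derivative (\<lambda>h. 0)) (at x)"
    using has_derivative_transform_within_open[of "\<lambda>x. 0" "\<lambda>h. 0" x UNIV ?U \<phi>] assms
    by (metis Compl_iff closed_closure has_derivative_const open_Compl)
  then have "GDERIV \<phi> x :> 0" by (simp add: gderiv_def)
  then show ?thesis by (rule grad_eqI)
qed

section \<open>Inequalities for powers of norms\<close>

text \<open>This is the tangent line inequality of the convex function \<open>s powr p\<close> at
  \<open>s = a\<close>, evaluated at \<open>b\<close>: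
  \<open>b powr p \<ge> a powr p + p * a powr (p - 1) * (b - a)\<close>. Most convexity arguments
  below reduce to it.\<close>

lemma Young_powr:
  fixes a b p :: real
  assumes "1 < p" "0 \<le> a" "0 \<le> b"
  shows "p * a powr (p - 1) * b \<le> (p - 1) * a powr p + b powr p"
proof -
  have q: "1 / p + (p - 1) / p = 1" "p / (p - 1) > 1" using assms by (auto simp: field_simps)
  have "b * a powr (p - 1) \<le> b powr p / p + (a powr (p - 1)) powr (p / (p - 1)) / (p / (p - 1))"
    by (rule Youngs_inequality) (use assms q in auto)
  also have "(a powr (p - 1)) powr (p / (p - 1)) = a powr p"
    using assms by (simp add: powr_powr)
  finally show ?thesis using assms by (simp add: field_simps)
qed

lemma powr_add_le:
  fixes a b p :: real
  assumes "0 \<le> a" "0 \<le> b" "0 \<le> p"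
  shows "(a + b) powr p \<le> 2 powr p * (a powr p + b powr p)"
proof -
  have "(a + b) powr p \<le> (2 * max a b) powr p" using assms by (intro powr_mono2) auto
  also have "\<dots> = 2 powr p * (max a b) powr p" using assms by (intro powr_mult)
  also have "(max a b) powr p \<le> a powr p + b powr p" by (auto simp: max_def)
  finally show ?thesis by simp
qed

lemma powr_norm_diff_le:
  fixes a b :: "'b::real_normed_vector"
  assumes "0 \<le> p"
  shows "norm (a - b) powr p \<le> 2 powr p * (norm a powr p + norm b powr p)"
proof -
  have "norm (a - b) powr p \<le> (norm a + norm b) powr p"
    using assms by (intro powr_mono2) (auto intro: norm_triangle_ineq4)
  also have "\<dots> \<le> 2 powr p * (norm a powr p + norm b powr p)"
    using assms by (intro powr_add_le) auto
  finally show ?thesis .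
qed

lemma powr_pred_le:
  fixes a p :: real
  assumes "1 < p" "0 \<le> a"
  shows "a powr (p - 1) \<le> 1 + a powr p"
proof (cases "a \<le> 1")
  case True
  then have "a powr (p - 1) \<le> 1" using assms by (intro powr_le1) auto
  then show ?thesis by (simp add: add_increasing2)
next
  case False
  then have "a powr (p - 1) \<le> a powr p" using assms by (intro powr_mono) auto
  then show ?thesis by simp
qed

text \<open>The coefficient of \<open>\<bar>x\<bar> powr p\<close> must be arbitrarily close to 1,
  since this term is going to be estimated by (I), where only the margin between \<open>l\<close>
  and the critical constant may be spent. The linear remainder is left to the dual bound on
  \<open>\<sigma>\<close>.\<close>

lemma powr_shift_le:
  fixes p \<eta> :: real
  assumes "1 < p" "0 < \<eta>"
  obtains B where "B > 0" and
    "\<And>a x. 0 \<le> a \<Longrightarrow> a \<le> 1 \<Longrightarrow> 0 \<le> a + x \<Longrightarrow>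
       (a + x) powr p - a powr p \<le> (1 + \<eta>) * \<bar>x\<bar> powr p + B * \<bar>x\<bar>"
proof -
  define q where "q = (1 + \<eta>) powr (1 / p)"
  have q: "q > 1" "q powr p = 1 + \<eta>"
    using assms by (auto simp: q_def powr_powr gr_one_powr)
  \<comment> \<open>From \<open>x \<ge> K\<close> on, the shift by \<open>a \<le> 1\<close> costs at
    most the factor \<open>q\<close>, as \<open>1 \<le> (q - 1) * x\<close>. Below \<open>K\<close>
    the tangent bound is linear in \<open>x\<close> with slope at most \<open>B\<close>.\<close>
  define K where "K = 1 / (q - 1)"
  have K: "K > 0" using q by (simp add: K_def)
  define B where "B = p * (1 + K) powr (p - 1)"
  have "(a + x) powr p - a powr p \<le> (1 + \<eta>) * \<bar>x\<bar> powr p + B * \<bar>x\<bar>"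
    if a: "0 \<le> a" "a \<le> 1" "0 \<le> a + x" for a x :: real
  proof (cases "x \<le> 0")
    case True
    then have "(a + x) powr p \<le> a powr p" using a assms by (intro powr_mono2) auto
    moreover have "0 \<le> (1 + \<eta>) * \<bar>x\<bar> powr p + B * \<bar>x\<bar>" using assms by (simp add: B_def)
    ultimately show ?thesis by linarith
  next
    case False
    show ?thesis
    proof (cases "x \<ge> K")
      case True
      have "1 \<le> (q - 1) * x" using True q by (simp add: K_def field_simps)
      then have "a + x \<le> q * x" using a by (simp add: algebra_simps)
      then have "(a + x) powr p \<le> (q * x) powr p" using a assms by (intro powr_mono2) auto
      also have "\<dots> = (1 + \<eta>) * x powr p" using False q by (simp add: powr_mult)
      finally have "(a + x) powr p \<le> (1 + \<eta>) * \<bar>x\<bar> powr p" using False by simp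
      moreover have "0 \<le> B * \<bar>x\<bar>" using assms by (simp add: B_def)
      moreover have "0 \<le> a powr p" by simp
      ultimately show ?thesis by linarith
    next
      case xK: False
      have "p * (a + x) powr (p - 1) * a \<le> (p - 1) * (a + x) powr p + a powr p"
        using a assms by (intro Young_powr) auto
      moreover have "(a + x) powr p = (a + x) powr (p - 1) * (a + x)"
        using a False powr_add[of "a + x" "p - 1" 1] by simp
      ultimately have "(a + x) powr p - a powr p \<le> p * (a + x) powr (p - 1) * x"
        by (simp add: algebra_simps)
      also have "\<dots> \<le> p * (1 + K) powr (p - 1) * x"
        using a assms xK False by (intro mult_right_mono mult_left_mono powr_mono2) auto
      also have "\<dots> = B * \<bar>x\<bar>" using False by (simp add: B_def)
      also have "\<dots> \<le> (1 + \<eta>) * \<bar>x\<bar> powr p + B * \<bar>x\<bar>" using assms by simp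
      finally show ?thesis .
    qed
  qed
  moreover have "B > 0" using assms K by (simp add: B_def)
  ultimately show ?thesis using that by blast
qed

text \<open>Both \<open>norm a\<close> and \<open>norm b\<close> are compared with the tangent line
  at their weighted mean \<open>m\<close>; in the average of the two inequalities the linear parts
  collapse to \<open>p * m powr p\<close>.\<close>

lemma norm_powr_convex:
  fixes a b :: "'b::real_normed_vector"
  assumes "1 < p" "0 \<le> t" "t \<le> 1"
  shows "norm ((1 - t) *\<^sub>R a + t *\<^sub>R b) powr p \<le> (1 - t) * norm a powr p + t * norm b powr p"
proof -
  define m where "m = (1 - t) * norm a + t * norm b"
  define N where "N = m powr (p - 1)"
  have m: "0 \<le> m" using assms by (simp add: m_def)
  have "norm ((1 - t) *\<^sub>R a + t *\<^sub>R b) \<le> m"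
    using assms norm_triangle_ineq[of "(1 - t) *\<^sub>R a" "t *\<^sub>R b"] by (simp add: m_def)
  then have le: "norm ((1 - t) *\<^sub>R a + t *\<^sub>R b) powr p \<le> m powr p"
    using assms by (intro powr_mono2) auto
  have "(1 - t) * (p * N * norm a) + t * (p * N * norm b)
      \<le> (1 - t) * ((p - 1) * m powr p + norm a powr p) + t * ((p - 1) * m powr p + norm b powr p)"
    unfolding N_def using assms m by (intro add_mono mult_left_mono Young_powr) auto
  moreover have "(1 - t) * (p * N * norm a) + t * (p * N * norm b) = p * (N * m)"
    by (simp add: m_def algebra_simps)
  moreover have "N * m = m powr p"
    using m powr_add[of m "p - 1" 1] by (cases "m = 0") (auto simp: N_def)
  moreover have "(1 - t) * ((p - 1) * m powr p + norm a powr p) + t * ((p - 1) * m powr p + norm b powr p)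
      = (p - 1) * m powr p + ((1 - t) * norm a powr p + t * norm b powr p)"
    by (simp add: algebra_simps)
  ultimately have "m powr p \<le> (1 - t) * norm a powr p + t * norm b powr p"
    by (simp add: left_diff_distrib)
  with le show ?thesis by linarith
qed

section \<open>Uniform convexity of the p-th power of the norm\<close>

definition powr_defect :: "real \<Rightarrow> 'b::real_normed_vector \<Rightarrow> 'b \<Rightarrow> real" where
  "powr_defect p a b = (norm a powr p + norm b powr p) / 2 - norm ((1/2) *\<^sub>R (a + b)) powr p"

lemma powr_defect_nonneg: "1 < p \<Longrightarrow> 0 \<le> powr_defect p a b"
  using norm_powr_convex[of p "1/2" a b] by (simp add: powr_defect_def algebra_simps)

lemma Bernoulli_powr:
  fixes y p :: real
  assumes "1 < p" and y: "0 < y" "y \<noteq> 1"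
  shows "1 + p * (y - 1) < y powr p"
proof -
  let ?f = "\<lambda>y. y powr p - p * y"
  have d: "(?f has_real_derivative p * z powr (p - 1) - p) (at z)" if "z > 0" for z
    using that by (auto intro!: derivative_eq_intros)
  show ?thesis
  proof (cases "y > 1")
    case True
    have "?f 1 < ?f y"
    proof (rule DERIV_pos_imp_increasing_open[OF True])
      fix z :: real assume z: "1 < z" "z < y"
      have "1 < z powr (p - 1)" using z assms by (intro gr_one_powr) auto
      then show "\<exists>l. (?f has_real_derivative l) (at z) \<and> 0 < l"
        using d[of z] z assms by (intro exI[of _ "p * z powr (p - 1) - p"]) auto
    qed (use y in \<open>auto intro!: continuous_intros\<close>)
    then show ?thesis by (simp add: algebra_simps)
  next
    case False
    then have y1: "y < 1" using y by simp
    have "?f y > ?f 1"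
    proof (rule DERIV_neg_imp_decreasing_open[OF y1])
      fix z :: real assume z: "y < z" "z < 1"
      have "z powr (p - 1) < 1" using z y assms powr_less_mono2[of "p - 1" z 1] by simp
      then show "\<exists>l. (?f has_real_derivative l) (at z) \<and> l < 0"
        using d[of z] z y assms by (intro exI[of _ "p * z powr (p - 1) - p"]) auto
    qed (use y in \<open>auto intro!: continuous_intros\<close>)
    then show ?thesis by (simp add: algebra_simps)
  qed
qed

text \<open>Strictness has two sources. Strict Bernoulli for the scalar power forces
  \<open>norm a = norm b\<close>; then the midpoint has at least this norm, and the parallelogram
  law leaves no room for \<open>a - b\<close>.\<close>

lemma powr_defect_eq_0:
  fixes a b :: "'b::real_inner"
  assumes "1 < p" "powr_defect p a b \<le> 0"
  shows "a = b"
proof -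
  define m where "m = (1/2) *\<^sub>R (a + b)"
  have par: "norm (a - b) ^ 2 = 2 * norm a ^ 2 + 2 * norm b ^ 2 - 4 * norm m ^ 2"
    by (simp add: m_def power2_norm_eq_inner algebra_simps inner_commute)
  let ?M = "(norm a + norm b) / 2"
  have "norm m \<le> ?M" using norm_triangle_ineq[of a b] by (simp add: m_def)
  then have mM: "norm m powr p \<le> ?M powr p" using assms by (intro powr_mono2) auto
  show ?thesis
  proof (cases "?M = 0")
    case True
    then show ?thesis
      using norm_ge_zero[of a] norm_ge_zero[of b]
      by (metis add_nonneg_eq_0_iff divide_eq_0_iff norm_eq_zero zero_neq_numeral)
  next
    case False
    have M0: "?M > 0" using False by (smt (verit) norm_ge_zero divide_nonneg_pos)
    have strict: "p * ?M powr (p - 1) * s < (p - 1) * ?M powr p + s powr p"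
      if s: "s \<ge> 0" "s \<noteq> ?M" for s
    proof (cases "s = 0")
      case True
      then show ?thesis using M0 assms by simp
    next
      case False
      define x where "x = s / ?M"
      have x: "x > 0" "x \<noteq> 1" "s = x * ?M" using s M0 False by (auto simp: x_def)
      have "1 + p * (x - 1) < x powr p" by (rule Bernoulli_powr[OF assms(1) x(1,2)])
      then have "(1 + p * (x - 1)) * ?M powr p < x powr p * ?M powr p"
        using M0 by (intro mult_strict_right_mono) auto
      moreover have "x powr p * ?M powr p = s powr p" using x M0 by (simp only: powr_mult)
      moreover have "p * ?M powr (p - 1) * s = p * x * ?M powr p"
      proof -
        have "?M powr (p - 1) * ?M = ?M powr p" using M0 powr_add[of ?M "p - 1" 1] by simp
        then show ?thesis unfolding x(3) by (metis mult.assoc mult.commute)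
      qed
      moreover have "(1 + p * (x - 1)) * ?M powr p = ?M powr p + p * x * ?M powr p - p * ?M powr p"
        by (simp only: algebra_simps)
      moreover have "(p - 1) * ?M powr p = p * ?M powr p - ?M powr p"
        by (simp only: algebra_simps)
      ultimately show ?thesis by linarith
    qed
    have eqM: "norm a = ?M"
    proof (rule ccontr)
      assume ne: "norm a \<noteq> ?M"
      then have neb: "norm b \<noteq> ?M" by (auto simp: field_simps)
      have "p * ?M powr (p - 1) * norm a + p * ?M powr (p - 1) * norm b
        < ((p - 1) * ?M powr p + norm a powr p) + ((p - 1) * ?M powr p + norm b powr p)"
        using strict[of "norm a"] strict[of "norm b"] ne neb by (intro add_strict_mono) auto
      moreover have "p * ?M powr (p - 1) * norm a + p * ?M powr (p - 1) * norm b = 2 * p * ?M powr p"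
        using M0 powr_add[of ?M "p - 1" 1] by (simp add: field_simps)
      ultimately have "?M powr p < (norm a powr p + norm b powr p) / 2" by (simp add: algebra_simps)
      with mM assms(2) show False by (simp add: powr_defect_def m_def)
    qed
    then have ab: "norm a = norm b" by (simp add: field_simps)
    then have "norm a powr p \<le> norm m powr p" using assms(2) by (simp add: powr_defect_def m_def)
    then have "norm a \<le> norm m" using assms by (meson norm_ge_zero not_le powr_less_mono2 less_trans zero_less_one)
    then have "norm a ^ 2 \<le> norm m ^ 2" by (intro power_mono) auto
    then have "norm (a - b) ^ 2 \<le> 0" using par ab by simp
    then show ?thesis by simp
  qed
qed

text \<open>By homogeneity it is enough to find the constant on the compact sphere
  \<open>\<bar>a\<bar>\<^sup>p + \<bar>b\<bar>\<^sup>p = 1\<close>, where strict convexity gives a positive lower bound of the defect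
  away from the diagonal.\<close>

lemma powr_defect_uniform:
  fixes p e :: real
  assumes p: "1 < p" and e: "0 < e"
  obtains C where "C > 0" and
    "\<And>a b :: 'b::euclidean_space.
       norm (a - b) powr p \<le> e * (norm a powr p + norm b powr p) + C * powr_defect p a b"
proof -
  define S where "S = {x :: 'b \<times> 'b. norm (fst x) powr p + norm (snd x) powr p = 1}"
  define T where "T = S \<inter> {x. norm (fst x - snd x) powr p \<ge> e}"
  have cont: "continuous_on UNIV (\<lambda>x :: 'b \<times> 'b. norm (fst x) powr p + norm (snd x) powr p)"
    "continuous_on UNIV (\<lambda>x :: 'b \<times> 'b. norm (fst x - snd x) powr p)"
    "continuous_on UNIV (\<lambda>x :: 'b \<times> 'b. powr_defect p (fst x) (snd x))"
    unfolding powr_defect_def using p by (auto intro!: continuous_intros continuous_on_powr')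
  have "closed S" unfolding S_def using cont(1)
    by (intro closed_Collect_eq) (auto intro: continuous_intros)
  then have "closed T" unfolding T_def using cont(2)
    by (intro closed_Int closed_Collect_le) (auto intro: continuous_intros)
  moreover have "bounded S"
  proof -
    have "norm x \<le> 2" if "x \<in> S" for x
    proof -
      have "norm (fst x) powr p \<le> 1" "norm (snd x) powr p \<le> 1"
        using that unfolding S_def by (smt (verit) mem_Collect_eq powr_ge_zero)+
      then have "norm (fst x) \<le> 1" "norm (snd x) \<le> 1"
        using p by (smt (verit) norm_ge_zero gr_one_powr)+
      moreover have "norm x \<le> norm (fst x) + norm (snd x)"
        using norm_Pair_le[of "fst x" "snd x"] by simp
      ultimately show ?thesis by simp
    qed
    then show ?thesis unfolding bounded_iff by blast
  qed
  ultimately have comp: "compact T"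
    unfolding compact_eq_bounded_closed T_def by (auto intro: bounded_Int)
  obtain m where m: "m > 0" "\<And>x. x \<in> T \<Longrightarrow> m \<le> powr_defect p (fst x) (snd x)"
  proof (cases "T = {}")
    case True
    then show ?thesis using that[of 1] by auto
  next
    case False
    obtain x where x: "x \<in> T" "\<And>y. y \<in> T \<Longrightarrow> powr_defect p (fst x) (snd x) \<le> powr_defect p (fst y) (snd y)"
      using continuous_attains_inf[OF comp False continuous_on_subset[OF cont(3)]] by blast
    have "fst x \<noteq> snd x" using x(1) e p unfolding T_def by auto
    then have "powr_defect p (fst x) (snd x) > 0" using powr_defect_eq_0[OF p] by force
    then show ?thesis using that x(2) by blast
  qed
  \<comment> \<open>On \<open>T\<close> the defect is at least \<open>m\<close>, while the left-hand
    side is at most \<open>2 powr p\<close> by \<open>powr_norm_diff_le\<close>; this constant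
    covers it with a factor 2 to spare. Off \<open>T\<close> the term \<open>e\<close> alone
    suffices.\<close>
  define C where "C = 2 * 2 powr p / m"
  have C: "C > 0" using m by (simp add: C_def)
  have "norm (a - b) powr p \<le> e * (norm a powr p + norm b powr p) + C * powr_defect p a b" for a b :: 'b
  proof -
    define s where "s = (norm a powr p + norm b powr p) powr (1 / p)"
    have sp: "s powr p = norm a powr p + norm b powr p" using p by (simp add: s_def powr_powr)
    show ?thesis
    proof (cases "s = 0")
      case True
      then have "norm a powr p + norm b powr p = 0" using sp by simp
      then have "a = 0" "b = 0"
        by (auto simp: add_nonneg_eq_0_iff)
      then show ?thesis by (simp add: powr_defect_def)
    next
      case False
      then have s: "s > 0" unfolding s_def by simp
      define a' b' where "a' = a /\<^sub>R s" and "b' = b /\<^sub>R s"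
      have ab: "a = s *\<^sub>R a'" "b = s *\<^sub>R b'" using s by (auto simp: a'_def b'_def)
      have h: "norm (s *\<^sub>R v) powr p = s powr p * norm v powr p" for v :: 'b
        using s by (simp add: powr_mult)
      have defect: "powr_defect p a b = s powr p * powr_defect p a' b'"
      proof -
        have "(1/2) *\<^sub>R (s *\<^sub>R a' + s *\<^sub>R b') = s *\<^sub>R ((1/2) *\<^sub>R (a' + b'))" by (simp add: algebra_simps)
        then have "powr_defect p a b = (s powr p * norm a' powr p + s powr p * norm b' powr p) / 2
            - s powr p * norm ((1/2) *\<^sub>R (a' + b')) powr p"
          by (simp only: powr_defect_def ab h)
        then show ?thesis by (simp only: powr_defect_def right_diff_distrib distrib_left times_divide_eq_right)
      qed
      have "s powr p * (norm a' powr p + norm b' powr p) = s powr p * 1"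
        using sp unfolding ab h by (simp add: algebra_simps)
      then have one: "norm a' powr p + norm b' powr p = 1" using s by simp
      have d: "norm (a - b) powr p = s powr p * norm (a' - b') powr p"
        using h[of "a' - b'"] unfolding ab by (simp add: algebra_simps)
      have nn: "0 \<le> powr_defect p a' b'" using powr_defect_nonneg[OF p] .
      have "norm (a' - b') powr p \<le> e + C * powr_defect p a' b'"
      proof (cases "norm (a' - b') powr p \<ge> e")
        case True
        then have "m \<le> powr_defect p a' b'" using m(2)[of "(a', b')"] one by (simp add: T_def S_def)
        then have "2 * 2 powr p \<le> C * powr_defect p a' b'" using m(1) by (simp add: C_def field_simps)
        moreover have "norm (a' - b') powr p \<le> 2 powr p * 1"
          using powr_norm_diff_le[of p a' b'] p one by simp
        moreover have "(0::real) < 2 powr p" by simp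
        ultimately show ?thesis using e by linarith
      next
        case False
        then show ?thesis using C nn by (smt (verit) mult_nonneg_nonneg)
      qed
      then have "s powr p * norm (a' - b') powr p \<le> s powr p * (e + C * powr_defect p a' b')"
        by (intro mult_left_mono) auto
      then show ?thesis unfolding d defect sp[symmetric] by (simp add: algebra_simps)
    qed
  qed
  with C that show ?thesis by blast
qed

text \<open>For \<open>p < 2\<close> the factor \<open>norm x powr (p - 2)\<close> blows up at the
  origin, but the product has norm \<open>norm x powr (p - 1)\<close>, which tends to 0
  there.\<close>

lemma isCont_norm_powr_scaleR:
  fixes a :: "'b::real_normed_vector"
  assumes "1 < p"
  shows "isCont (\<lambda>x. norm x powr (p - 2) *\<^sub>R x) a"
proof (cases "a = 0")
  case True
  have n: "norm (norm x powr (p - 2) *\<^sub>R x) = norm x powr (p - 1)" for x :: 'b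
    using powr_add[of "norm x" "p - 2" 1] by (cases "x = 0") auto
  have "((\<lambda>x::'b. norm x powr (p - 1)) \<longlongrightarrow> norm (0::'b) powr (p - 1)) (at 0)"
    using assms by (intro tendsto_powr' tendsto_intros) auto
  then have "((\<lambda>x::'b. norm (norm x powr (p - 2) *\<^sub>R x)) \<longlongrightarrow> 0) (at 0)"
    unfolding n using assms by simp
  then have "((\<lambda>x::'b. norm x powr (p - 2) *\<^sub>R x) \<longlongrightarrow> 0) (at 0)"
    by (rule tendsto_norm_zero_cancel)
  then show ?thesis using True by (simp add: isCont_def)
next
  case False
  then show ?thesis by (intro continuous_intros) auto
qed

lemma norm_norm_powr_scaleR:
  "norm (norm x powr (p - 2) *\<^sub>R x) = norm x powr (p - 1)"
  using powr_add[of "norm x" "p - 2" 1] by (cases "x = 0") auto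

section \<open>Convergence in \<open>L\<^sup>p\<close> and Poincare's inequality\<close>

text \<open>Riesz-Fischer, together with an integrable majorant common to the whole subsequence. The
  increments are controlled through the weighted sum of \<open>2 ^ j * d j x powr p\<close>: it is
  integrable, and its finiteness at \<open>x\<close> forces geometric decay of \<open>d j x\<close>,
  hence convergence and a bound.\<close>

lemma Lp_Cauchy_subsequence:
  fixes f :: "nat \<Rightarrow> 'a \<Rightarrow> 'b::euclidean_space"
  assumes p: "1 < p"
    and meas [measurable]: "\<And>k. f k \<in> borel_measurable M"
    and int: "\<And>k. integrable M (\<lambda>x. norm (f k x) powr p)"
    and Cauchy: "\<And>e. 0 < e \<Longrightarrow>
      \<exists>N. \<forall>k\<ge>N. \<forall>l\<ge>N. (\<integral>x. norm (f k x - f l x) powr p \<partial>M) \<le> e"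
  obtains r g G where "strict_mono (r :: nat \<Rightarrow> nat)" "g \<in> borel_measurable M" "integrable M G"
    "AE x in M. (\<lambda>j. f (r j) x) \<longlonglongrightarrow> g x"
    "AE x in M. \<forall>j. norm (f (r j) x) powr p \<le> G x"
proof -
  have "\<forall>j. \<exists>N. \<forall>k\<ge>N. \<forall>l\<ge>N. (\<integral>x. norm (f k x - f l x) powr p \<partial>M) \<le> (1/4) ^ j"
    by (intro allI Cauchy) simp
  then obtain N where N:
    "\<And>j k l. k \<ge> N j \<Longrightarrow> l \<ge> N j \<Longrightarrow> (\<integral>x. norm (f k x - f l x) powr p \<partial>M) \<le> (1/4) ^ j"
    by metis
  define r where "r j = (\<Sum>i\<le>j. Suc (N i))" for j
  have r: "strict_mono r" unfolding r_def by (rule strict_monoI_Suc) simp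
  have rN: "r j \<ge> N j" for j
  proof -
    have "Suc (N j) \<le> r j" unfolding r_def by (rule member_le_sum) auto
    then show ?thesis by simp
  qed
  have rS: "r (Suc j) \<ge> N j" for j using rN[of j] strict_monoD[OF r, of j "Suc j"] by simp
  have int_diff: "integrable M (\<lambda>x. norm (f k x - f l x) powr p)" for k l
  proof (rule Bochner_Integration.integrable_bound)
    show "integrable M (\<lambda>x. 2 powr p * (norm (f k x) powr p + norm (f l x) powr p))"
      using int by auto
    show "AE x in M. norm (norm (f k x - f l x) powr p)
      \<le> norm (2 powr p * (norm (f k x) powr p + norm (f l x) powr p))"
      using powr_norm_diff_le[of p] p by (intro AE_I2) (auto simp: abs_of_nonneg)
  qed measurable
  define d where "d j x = norm (f (r (Suc j)) x - f (r j) x)" for j x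
  have [measurable]: "d j \<in> borel_measurable M" for j unfolding d_def by measurable
  have d_le: "(\<integral>x. d j x powr p \<partial>M) \<le> (1/4) ^ j" for j
    unfolding d_def by (rule N[OF rS rN])
  define T where "T x = (\<Sum>j. ennreal (2 ^ j * d j x powr p))" for x
  have [measurable]: "T \<in> borel_measurable M" unfolding T_def by measurable
  have "(\<integral>\<^sup>+x. T x \<partial>M) = (\<Sum>j. \<integral>\<^sup>+x. ennreal (2 ^ j * d j x powr p) \<partial>M)"
    unfolding T_def by (rule nn_integral_suminf) measurable
  also have "\<dots> \<le> (\<Sum>j. ennreal ((1/2) ^ j))"
  proof (rule suminf_le)
    fix j
    have "(\<integral>\<^sup>+x. ennreal (2 ^ j * d j x powr p) \<partial>M) = ennreal (2 ^ j * (\<integral>x. d j x powr p \<partial>M))"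
      using int_diff by (subst nn_integral_eq_integral) (auto simp: d_def)
    also have "\<dots> \<le> ennreal (2 ^ j * (1/4) ^ j)"
      using d_le by (intro ennreal_leI mult_left_mono) auto
    also have "2 ^ j * (1/4) ^ j = (1/2 :: real) ^ j"
      by (simp add: power_mult_distrib[symmetric])
    finally show "(\<integral>\<^sup>+x. ennreal (2 ^ j * d j x powr p) \<partial>M) \<le> ennreal ((1/2) ^ j)" .
  qed auto
  also have "\<dots> = ennreal (\<Sum>j. (1/2) ^ j)"
    by (rule suminf_ennreal2) (auto intro: summable_geometric)
  finally have T_fin: "(\<integral>\<^sup>+x. T x \<partial>M) < \<infinity>" by (metis ennreal_less_top infinity_ennreal_def order_le_less_trans)
  define S where "S x = enn2real (T x)" for x
  have [measurable]: "S \<in> borel_measurable M" unfolding S_def by measurable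
  have AE_T: "AE x in M. T x = ennreal (S x)"
    using nn_integral_noteq_infinite[of T M] T_fin unfolding S_def
    by (auto elim!: eventually_mono simp: less_top)
  have int_S: "integrable M S"
  proof (rule integrableI_nonneg)
    show "AE x in M. 0 \<le> S x" by (simp add: S_def)
    have "(\<integral>\<^sup>+x. ennreal (S x) \<partial>M) = (\<integral>\<^sup>+x. T x \<partial>M)"
      using AE_T by (intro nn_integral_cong_AE) (auto elim: eventually_mono)
    then show "(\<integral>\<^sup>+x. ennreal (S x) \<partial>M) < \<infinity>" using T_fin by simp
  qed measurable
  \<comment> \<open>The p-th root of 1/2: taking roots in
    \<open>2 ^ j * d j x powr p \<le> S x\<close> gives
    \<open>d j x \<le> S x powr (1 / p) * q ^ j\<close>.\<close>
  define q where "q = (1/2 :: real) powr (1 / p)"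
  have q: "0 < q" "q < 1" using p powr_less_mono2[of "1/p" "1/2" 1] by (auto simp: q_def)
  define C where "C = (\<Sum>j. q ^ j)"
  define G where "G x = 2 powr p * (norm (f (r 0) x) powr p + C powr p * S x)" for x
  have ptw: "summable (\<lambda>j. d j x) \<and> (\<Sum>j. d j x) \<le> C * S x powr (1 / p)" if x: "T x = ennreal (S x)" for x
  proof -
    have S0: "0 \<le> S x" by (simp add: S_def)
    have dj: "d j x \<le> S x powr (1 / p) * q ^ j" for j
    proof -
      have "ennreal (2 ^ j * d j x powr p) \<le> T x"
      proof -
        have "(\<Sum>i\<in>{j}. ennreal (2 ^ i * d i x powr p)) \<le> T x"
          unfolding T_def by (intro sum_le_suminf summableI) auto
        then show ?thesis by simp
      qed
      then have "2 ^ j * d j x powr p \<le> S x" unfolding x using S0 by simp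
      then have "d j x powr p \<le> S x * (1/2) ^ j" by (simp add: field_simps)
      then have "(d j x powr p) powr (1/p) \<le> (S x * (1/2) ^ j) powr (1/p)"
        using p by (intro powr_mono2) auto
      also have "(S x * (1/2) ^ j) powr (1/p) = S x powr (1/p) * ((1/2) ^ j) powr (1/p)"
        using S0 by (intro powr_mult)
      also have "((1/2::real) ^ j) powr (1/p) = q ^ j"
        by (simp add: q_def powr_realpow[symmetric] powr_powr mult.commute)
      finally show ?thesis using p by (simp add: powr_powr d_def)
    qed
    have sq: "summable (\<lambda>j. q ^ j)" using q by (intro summable_geometric) auto
    have sd: "summable (\<lambda>j. d j x)"
      by (rule summable_comparison_test'[where N = 0 and g = "\<lambda>j. S x powr (1 / p) * q ^ j"])
        (use dj sq in \<open>auto intro: summable_mult simp: d_def\<close>)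
    have "(\<Sum>j. d j x) \<le> (\<Sum>j. S x powr (1 / p) * q ^ j)"
      by (intro suminf_le sd summable_mult sq dj)
    also have "\<dots> = C * S x powr (1 / p)" using suminf_mult[OF sq, of "S x powr (1 / p)"] by (simp add: C_def mult.commute)
    finally show ?thesis using sd by simp
  qed
  have C0: "0 \<le> C" unfolding C_def using q by (intro suminf_nonneg summable_geometric) auto
  have tele: "f (r n) x = f (r 0) x + (\<Sum>j<n. f (r (Suc j)) x - f (r j) x)" for n x
    by (induction n) auto
  have conv: "convergent (\<lambda>n. f (r n) x)" if x: "T x = ennreal (S x)" for x
  proof -
    have "summable (\<lambda>j. f (r (Suc j)) x - f (r j) x)"
      using ptw[OF x] unfolding d_def by (blast intro: summable_norm_cancel)
    then have "(\<lambda>n. f (r 0) x + (\<Sum>j<n. f (r (Suc j)) x - f (r j) x)) \<longlonglongrightarrow>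
        f (r 0) x + (\<Sum>j. f (r (Suc j)) x - f (r j) x)"
      by (intro tendsto_add tendsto_const summable_LIMSEQ)
    then show ?thesis unfolding tele[symmetric] by (auto simp: convergent_def)
  qed
  have bound: "norm (f (r n) x) powr p \<le> G x" if x: "T x = ennreal (S x)" for x n
  proof -
    have "norm (f (r n) x) \<le> norm (f (r 0) x) + (\<Sum>j<n. d j x)"
      unfolding tele[of n x] d_def by (rule order_trans[OF norm_triangle_ineq]) (auto intro: norm_sum)
    also have "(\<Sum>j<n. d j x) \<le> (\<Sum>j. d j x)"
      using ptw[OF x] by (intro sum_le_suminf) (auto simp: d_def)
    also have "\<dots> \<le> C * S x powr (1 / p)" using ptw[OF x] by simp
    finally have "norm (f (r n) x) powr p \<le> (norm (f (r 0) x) + C * S x powr (1 / p)) powr p"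
      using p by (intro powr_mono2) auto
    also have "\<dots> \<le> 2 powr p * (norm (f (r 0) x) powr p + (C * S x powr (1 / p)) powr p)"
      using p C0 by (intro powr_add_le) auto
    also have "(C * S x powr (1 / p)) powr p = C powr p * S x"
      using p C0 by (simp add: powr_mult powr_powr S_def)
    finally show ?thesis by (simp add: G_def)
  qed
  show ?thesis
  proof
    show "strict_mono r" by fact
    show "(\<lambda>x. lim (\<lambda>j. f (r j) x)) \<in> borel_measurable M" by measurable
    show "integrable M G" unfolding G_def using int int_S by auto
    show "AE x in M. (\<lambda>j. f (r j) x) \<longlonglongrightarrow> lim (\<lambda>j. f (r j) x)"
      using AE_T by eventually_elim (use conv in \<open>auto simp: convergent_LIMSEQ_iff\<close>)
    show "AE x in M. \<forall>j. norm (f (r j) x) powr p \<le> G x"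
      using AE_T by eventually_elim (use bound in auto)
  qed
qed

text \<open>The p-th power of the distance in \<open>L\<^sup>p\<close>, valued in
  \<open>ennreal\<close> so that it makes sense before integrability is known;
  \<open>W01p_grad\<close> asks that such quantities tend to 0.\<close>

definition Lp_err :: "real \<Rightarrow> 'a measure \<Rightarrow> ('a \<Rightarrow> 'b::real_normed_vector) \<Rightarrow> ('a \<Rightarrow> 'b) \<Rightarrow> ennreal" where
  "Lp_err p M f g = (\<integral>\<^sup>+x. ennreal (norm (f x - g x) powr p) \<partial>M)"

lemma Lp_dominated_convergence:
  fixes f :: "nat \<Rightarrow> 'a \<Rightarrow> 'b::euclidean_space"
  assumes p: "1 < p"
    and [measurable]: "\<And>j. f j \<in> borel_measurable M" "g \<in> borel_measurable M"
    and G: "integrable M G"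
    and lim: "AE x in M. (\<lambda>j. f j x) \<longlonglongrightarrow> g x"
    and bound: "\<And>j. AE x in M. norm (f j x) powr p \<le> G x"
  shows "integrable M (\<lambda>x. norm (g x) powr p)"
    and "AE x in M. norm (g x) powr p \<le> G x"
    and "(\<lambda>j. Lp_err p M (f j) g) \<longlonglongrightarrow> 0"
proof -
  have AE_b: "AE x in M. \<forall>j. norm (f j x) powr p \<le> G x" using bound by (simp add: AE_all_countable)
  show g: "AE x in M. norm (g x) powr p \<le> G x"
    using AE_b lim
  proof eventually_elim
    case (elim x)
    then have "(\<lambda>j. norm (f j x) powr p) \<longlonglongrightarrow> norm (g x) powr p"
      using p by (intro tendsto_powr' tendsto_norm tendsto_const) auto
    then show ?case using elim by (intro LIMSEQ_le_const2) auto
  qed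
  then show "integrable M (\<lambda>x. norm (g x) powr p)"
    by (intro Bochner_Integration.integrable_bound[OF G]) (auto elim: eventually_mono)
  have "(\<lambda>j. \<integral>\<^sup>+x. ennreal (norm (f j x - g x) powr p) \<partial>M) \<longlonglongrightarrow> (\<integral>\<^sup>+x. 0 \<partial>M)"
  proof (rule nn_integral_dominated_convergence[where w = "\<lambda>x. ennreal (2 powr p * (G x + G x))"])
    have [measurable]: "G \<in> borel_measurable M" using G by auto
    show "(\<lambda>x. ennreal (2 powr p * (G x + G x))) \<in> borel_measurable M" by measurable
    show "AE x in M. ennreal (norm (f j x - g x) powr p) \<le> ennreal (2 powr p * (G x + G x))" for j
      using bound[of j] g
    proof eventually_elim
      case (elim x)
      have "norm (f j x - g x) powr p \<le> 2 powr p * (norm (f j x) powr p + norm (g x) powr p)"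
        using p by (intro powr_norm_diff_le) auto
      also have "\<dots> \<le> 2 powr p * (G x + G x)" using elim by (intro mult_left_mono add_mono) auto
      finally show ?case by (rule ennreal_leI)
    qed
    have "integrable M (\<lambda>x. 2 powr p * (G x + G x))" using G by auto
    then have "(\<integral>\<^sup>+x. ennreal (norm (2 powr p * (G x + G x))) \<partial>M) < \<infinity>"
      unfolding integrable_iff_bounded by blast
    then show "(\<integral>\<^sup>+x. ennreal (2 powr p * (G x + G x)) \<partial>M) < \<infinity>"
      by (rule le_less_trans[rotated]) (intro nn_integral_mono ennreal_leI, simp)
    show "AE x in M. (\<lambda>j. ennreal (norm (f j x - g x) powr p)) \<longlonglongrightarrow> 0"
      using lim
    proof eventually_elim
      case (elim x)
      have "(\<lambda>j. norm (f j x - g x) powr p) \<longlonglongrightarrow> norm (g x - g x) powr p"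
        using p elim by (intro tendsto_powr' tendsto_norm tendsto_diff tendsto_const) auto
      then have "(\<lambda>j. ennreal (norm (f j x - g x) powr p)) \<longlonglongrightarrow> ennreal (norm (g x - g x) powr p)"
        by (rule tendsto_ennrealI)
      then show ?case by simp
    qed
  qed measurable
  then show "(\<lambda>j. Lp_err p M (f j) g) \<longlonglongrightarrow> 0" by (simp add: Lp_err_def)
qed

section \<open>Poincare's inequality by integration along segments\<close>

lemma integral_lebesgue_on_eq_lborel:
  fixes f :: "'a::euclidean_space \<Rightarrow> real"
  assumes "open \<Omega>" "f \<in> borel_measurable borel" "\<And>x. x \<notin> \<Omega> \<Longrightarrow> f x = 0"
  shows "(\<integral>x. f x \<partial>lebesgue_on \<Omega>) = (\<integral>x. f x \<partial>lborel)"
    and "integrable (lebesgue_on \<Omega>) f \<longleftrightarrow> integrable lborel f"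
proof -
  have "\<Omega> \<in> sets lebesgue" using assms(1) by auto
  then have *: "\<Omega> \<inter> space lebesgue \<in> sets lebesgue" by simp
  have f: "(\<lambda>x. indicat_real \<Omega> x *\<^sub>R f x) = f"
    by (rule ext) (use assms(3) in \<open>auto simp: indicator_def\<close>)
  show "(\<integral>x. f x \<partial>lebesgue_on \<Omega>) = (\<integral>x. f x \<partial>lborel)"
    unfolding integral_restrict_space[OF *] f using assms(2) by (simp add: integral_completion)
  show "integrable (lebesgue_on \<Omega>) f \<longleftrightarrow> integrable lborel f"
    unfolding integrable_restrict_space[OF *] f using assms(2) by (simp add: integrable_completion)
qed

text \<open>With \<open>A\<close> the mean slope over an interval of length \<open>L\<close>, the
  tangent line inequality at \<open>A\<close> is integrated over the interval. The outcome is
  Jensen's inequality, with \<open>A powr p * L\<close> bounded by the integral of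
  \<open>h t powr p\<close>; the factor \<open>L powr (p - 1)\<close> arises in passing from
  \<open>A\<close> to the increment.\<close>

lemma FTC_powr_bound:
  fixes F h :: "real \<Rightarrow> real"
  assumes p: "1 < p" and L: "0 < L"
    and der: "\<And>t. (F has_real_derivative F' t) (at t)"
    and F': "continuous_on UNIV F'" and h: "continuous_on UNIV h" "\<And>t. \<bar>F' t\<bar> \<le> h t"
  shows "ennreal (\<bar>F L - F 0\<bar> powr p)
    \<le> ennreal (L powr (p - 1)) * (\<integral>\<^sup>+t. ennreal (h t powr p * indicator {0..L} t) \<partial>lborel)"
proof -
  have h0: "0 \<le> h t" for t using h(2)[of t] by linarith
  have intc: "integrable lborel (\<lambda>t. g t * indicator {0..L} t)" if "continuous_on UNIV g" for g :: "real \<Rightarrow> real"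
    using borel_integrable_compact[of "{0..L}" g] continuous_on_subset[OF that]
    by (auto simp: mult.commute)
  have ip: "integrable lborel (\<lambda>t. h t powr p * indicator {0..L} t)"
    using p h0 by (intro intc continuous_on_powr' h(1) continuous_on_const) auto
  define A where "A = \<bar>F L - F 0\<bar> / L"
  have A0: "0 \<le> A" using L by (simp add: A_def)
  have "F L - F 0 = (\<integral>t. F' t * indicator {0..L} t \<partial>lborel)"
    using L der F' by (intro integral_FTC_Icc_real[symmetric]) (auto simp: continuous_on_eq_continuous_at)
  then have "\<bar>F L - F 0\<bar> \<le> (\<integral>t. \<bar>F' t * indicator {0..L} t\<bar> \<partial>lborel)"
    using integral_abs_bound by metis
  also have "\<dots> \<le> (\<integral>t. h t * indicator {0..L} t \<partial>lborel)"
    using h(2) by (intro integral_mono integrable_abs intc F' h(1)) (auto simp: indicator_def)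
  finally have "A * L \<le> (\<integral>t. h t * indicator {0..L} t \<partial>lborel)" using L by (simp add: A_def)
  then have "p * A powr (p - 1) * (A * L) \<le> p * A powr (p - 1) * (\<integral>t. h t * indicator {0..L} t \<partial>lborel)"
    using p by (intro mult_left_mono) auto
  also have "\<dots> = (\<integral>t. p * A powr (p - 1) * (h t * indicator {0..L} t) \<partial>lborel)" by simp
  also have "\<dots> \<le> (\<integral>t. (p - 1) * A powr p * indicator {0..L} t + h t powr p * indicator {0..L} t \<partial>lborel)"
  proof (rule integral_mono)
    show "integrable lborel (\<lambda>t. p * A powr (p - 1) * (h t * indicator {0..L} t))"
      using intc[OF h(1)] by auto
    show "integrable lborel (\<lambda>t. (p - 1) * A powr p * indicator {0..L} t + h t powr p * indicator {0..L} t)"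
      by (intro Bochner_Integration.integrable_add ip intc continuous_on_const)
    fix t
    show "p * A powr (p - 1) * (h t * indicator {0..L} t)
      \<le> (p - 1) * A powr p * indicator {0..L} t + h t powr p * indicator {0..L} t"
      using Young_powr[OF p A0 h0] by (auto simp: indicator_def)
  qed
  also have "\<dots> = (p - 1) * A powr p * L + (\<integral>t. h t powr p * indicator {0..L} t \<partial>lborel)"
    using ip L by (subst Bochner_Integration.integral_add) auto
  also have "p * A powr (p - 1) * (A * L) = p * A powr p * L"
    using A0 powr_add[of A "p - 1" 1] by (cases "A = 0") auto
  finally have "A powr p * L \<le> (\<integral>t. h t powr p * indicator {0..L} t \<partial>lborel)"
    by (simp add: algebra_simps)
  moreover have "\<bar>F L - F 0\<bar> powr p = L powr (p - 1) * (A powr p * L)"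
  proof -
    have "\<bar>F L - F 0\<bar> powr p = (A * L) powr p" using L by (simp add: A_def)
    also have "\<dots> = A powr p * (L powr (p - 1) * L)"
      using A0 L powr_add[of L "p - 1" 1] by (simp add: powr_mult)
    finally show ?thesis by simp
  qed
  ultimately have "\<bar>F L - F 0\<bar> powr p
      \<le> L powr (p - 1) * (\<integral>t. h t powr p * indicator {0..L} t \<partial>lborel)"
    by (metis mult_left_mono powr_ge_zero)
  then have "ennreal (\<bar>F L - F 0\<bar> powr p)
      \<le> ennreal (L powr (p - 1)) * ennreal (\<integral>t. h t powr p * indicator {0..L} t \<partial>lborel)"
    by (subst ennreal_mult[symmetric]) (auto intro!: ennreal_leI Bochner_Integration.integral_nonneg)
  also have "ennreal (\<integral>t. h t powr p * indicator {0..L} t \<partial>lborel)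
      = (\<integral>\<^sup>+t. ennreal (h t powr p * indicator {0..L} t) \<partial>lborel)"
    by (rule nn_integral_eq_integral[symmetric, OF ip]) auto
  finally show ?thesis .
qed

lemma nn_integral_lborel_translate:
  fixes f :: "'a::euclidean_space \<Rightarrow> ennreal"
  assumes [measurable]: "f \<in> borel_measurable borel"
  shows "(\<integral>\<^sup>+x. f (x + c) \<partial>lborel) = (\<integral>\<^sup>+x. f x \<partial>lborel)"
proof -
  have "(\<integral>\<^sup>+x. f x \<partial>lborel) = (\<integral>\<^sup>+x. f x \<partial>distr lborel borel ((+) c))"
    by (simp add: lborel_distr_plus)
  also have "\<dots> = (\<integral>\<^sup>+x. f (c + x) \<partial>lborel)" by (rule nn_integral_distr) auto
  finally show ?thesis by (simp add: add.commute)
qed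

text \<open>A translate by \<open>L\<close> in a coordinate direction moves \<open>\<Omega>\<close> off itself, so \<open>- \<phi> x\<close> is the
  integral of a directional derivative over a segment of length \<open>L\<close>.\<close>

lemma Poincare:
  fixes \<Omega> :: "'a::euclidean_space set"
  assumes "bounded \<Omega>" and p: "1 < p"
  obtains C where "0 < C" "\<And>\<phi>. \<phi> \<in> test_functions \<Omega> \<Longrightarrow>
    (\<integral>\<^sup>+x. ennreal (\<bar>\<phi> x\<bar> powr p) \<partial>lborel) \<le> ennreal C * (\<integral>\<^sup>+x. ennreal (norm (grad \<phi> x) powr p) \<partial>lborel)"
proof -
  obtain R where R: "0 < R" "\<And>x. x \<in> \<Omega> \<Longrightarrow> norm x < R"
    using assms(1) by (auto simp: bounded_pos_less)
  \<comment> \<open>Two points of \<open>\<Omega>\<close> are less than \<open>2 * R\<close> apart,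
    so \<open>x + L *\<^sub>R b\<close> lies outside \<open>\<Omega>\<close> whenever
    \<open>x\<close> is inside.\<close>
  define L where "L = 2 * R"
  have L: "0 < L" using R by (simp add: L_def)
  obtain b :: 'a where b: "b \<in> Basis" using nonempty_Basis by blast
  have main: "(\<integral>\<^sup>+x. ennreal (\<bar>\<phi> x\<bar> powr p) \<partial>lborel)
      \<le> ennreal (L powr (p - 1) * L) * (\<integral>\<^sup>+x. ennreal (norm (grad \<phi> x) powr p) \<partial>lborel)"
    if \<phi>: "\<phi> \<in> test_functions \<Omega>" for \<phi>
  proof -
    have sm: "smooth \<phi>" using \<phi> by (rule test_functions_smooth)
    have out: "\<phi> x = 0" if "x \<notin> \<Omega>" for x
      using \<phi> that closure_subset[of "{x. \<phi> x \<noteq> 0}"] by (auto simp: test_functions_def)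
    define P where "P x = norm (grad \<phi> x) powr p" for x
    have contP: "continuous_on UNIV P" unfolding P_def
      using p by (intro continuous_on_powr' continuous_on_norm continuous_on_grad sm continuous_on_const) auto
    then have [measurable]: "P \<in> borel_measurable borel" by (rule borel_measurable_continuous_onI)
    have P0: "0 \<le> P x" for x by (simp add: P_def)
    have ptw: "ennreal (\<bar>\<phi> x\<bar> powr p) \<le> ennreal (L powr (p - 1)) *
        (\<integral>\<^sup>+t. ennreal (P (x + t *\<^sub>R b) * indicator {0..L} t) \<partial>lborel)" for x
    proof (cases "x \<in> \<Omega>")
      case False
      then show ?thesis using out by simp
    next
      case True
      have "x + L *\<^sub>R b \<notin> \<Omega>"
      proof
        assume "x + L *\<^sub>R b \<in> \<Omega>"
        then have "norm (x + L *\<^sub>R b) < R" "norm x < R" using R True by auto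
        moreover have "norm (L *\<^sub>R b) \<le> norm (x + L *\<^sub>R b) + norm x"
          using norm_triangle_ineq4[of "x + L *\<^sub>R b" x] by simp
        ultimately show False using b L by (simp add: L_def)
      qed
      then have "\<bar>\<phi> x\<bar> = \<bar>\<phi> (x + L *\<^sub>R b) - \<phi> (x + 0 *\<^sub>R b)\<bar>" using out by simp
      moreover have "ennreal (\<bar>\<phi> (x + L *\<^sub>R b) - \<phi> (x + 0 *\<^sub>R b)\<bar> powr p) \<le> ennreal (L powr (p - 1)) *
        (\<integral>\<^sup>+t. ennreal (norm (grad \<phi> (x + t *\<^sub>R b)) powr p * indicator {0..L} t) \<partial>lborel)"
      proof (rule FTC_powr_bound[OF p L, where F = "\<lambda>t. \<phi> (x + t *\<^sub>R b)"
            and F' = "\<lambda>t. grad \<phi> (x + t *\<^sub>R b) \<bullet> b"])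
        have g: "continuous_on UNIV (\<lambda>t. grad \<phi> (x + t *\<^sub>R b))"
          by (intro continuous_on_compose2[OF continuous_on_grad[OF sm]] continuous_intros) auto
        show "continuous_on UNIV (\<lambda>t. grad \<phi> (x + t *\<^sub>R b) \<bullet> b)"
          "continuous_on UNIV (\<lambda>t. norm (grad \<phi> (x + t *\<^sub>R b)))"
          using g by (auto intro: continuous_intros)
        fix t
        show "\<bar>grad \<phi> (x + t *\<^sub>R b) \<bullet> b\<bar> \<le> norm (grad \<phi> (x + t *\<^sub>R b))"
          using Cauchy_Schwarz_ineq2[of "grad \<phi> (x + t *\<^sub>R b)" b] b by simp
        have "((\<lambda>t. x + t *\<^sub>R b) has_derivative (\<lambda>s. s *\<^sub>R b)) (at t)"
          by (auto intro!: derivative_eq_intros)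
        moreover have "(\<phi> has_derivative (\<lambda>h. h \<bullet> grad \<phi> (x + t *\<^sub>R b))) (at (x + t *\<^sub>R b))"
          using smooth_GDERIV[OF sm] by (simp add: gderiv_def)
        ultimately have "((\<lambda>t. \<phi> (x + t *\<^sub>R b)) has_derivative (\<lambda>s. (s *\<^sub>R b) \<bullet> grad \<phi> (x + t *\<^sub>R b))) (at t)"
          by (rule has_derivative_compose)
        moreover have "(\<lambda>s. (s *\<^sub>R b) \<bullet> grad \<phi> (x + t *\<^sub>R b)) = (*) (grad \<phi> (x + t *\<^sub>R b) \<bullet> b)"
          by (auto simp: inner_commute)
        ultimately show "((\<lambda>t. \<phi> (x + t *\<^sub>R b)) has_real_derivative grad \<phi> (x + t *\<^sub>R b) \<bullet> b) (at t)"
          unfolding has_field_derivative_def by simp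
      qed
      ultimately show ?thesis by (simp add: P_def)
    qed
    have "(\<integral>\<^sup>+x. ennreal (\<bar>\<phi> x\<bar> powr p) \<partial>lborel)
      \<le> (\<integral>\<^sup>+x. ennreal (L powr (p - 1)) * (\<integral>\<^sup>+t. ennreal (P (x + t *\<^sub>R b) * indicator {0..L} t) \<partial>lborel) \<partial>lborel)"
      by (intro nn_integral_mono ptw)
    also have "\<dots> = ennreal (L powr (p - 1)) *
        (\<integral>\<^sup>+x. (\<integral>\<^sup>+t. ennreal (P (x + t *\<^sub>R b) * indicator {0..L} t) \<partial>lborel) \<partial>lborel)"
      by (rule nn_integral_cmult) measurable
    \<comment> \<open>After the exchange the integral over \<open>x\<close> is independent of
      \<open>t\<close> by translation invariance, so the segment contributes just another factor
      \<open>L\<close>.\<close>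
    also have "(\<integral>\<^sup>+x. (\<integral>\<^sup>+t. ennreal (P (x + t *\<^sub>R b) * indicator {0..L} t) \<partial>lborel) \<partial>lborel)
        = (\<integral>\<^sup>+t. (\<integral>\<^sup>+x. ennreal (P (x + t *\<^sub>R b) * indicator {0..L} t) \<partial>lborel) \<partial>lborel)"
      by (rule lborel_pair.Fubini') measurable
    also have "\<dots> = (\<integral>\<^sup>+t. (\<integral>\<^sup>+x. ennreal (P x) \<partial>lborel) * indicator {0..L} t \<partial>lborel)"
    proof (rule nn_integral_cong)
      fix t :: real
      have "(\<integral>\<^sup>+x. ennreal (P (x + t *\<^sub>R b) * indicator {0..L} t) \<partial>lborel)
        = (\<integral>\<^sup>+x. ennreal (P (x + t *\<^sub>R b)) \<partial>lborel) * indicator {0..L} t"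
        by (auto simp: indicator_def)
      also have "(\<integral>\<^sup>+x. ennreal (P (x + t *\<^sub>R b)) \<partial>lborel) = (\<integral>\<^sup>+x. ennreal (P x) \<partial>lborel)"
        by (rule nn_integral_lborel_translate) measurable
      finally show "(\<integral>\<^sup>+x. ennreal (P (x + t *\<^sub>R b) * indicator {0..L} t) \<partial>lborel)
        = (\<integral>\<^sup>+x. ennreal (P x) \<partial>lborel) * indicator {0..L} t" .
    qed
    also have "\<dots> = (\<integral>\<^sup>+x. ennreal (P x) \<partial>lborel) * ennreal L"
      using L by (subst nn_integral_cmult) auto
    finally show ?thesis using L by (simp add: P_def ennreal_mult mult_ac)
  qed
  show ?thesis by (rule that[of "L powr (p - 1) * L"]) (use L main in auto)
qed

section \<open>Necessity\<close>

text \<open>A smooth approximation of \<open>\<bar>s\<bar>\<close> from below, with slope at most 1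
  and error at most \<open>e\<close>. Subtracting \<open>e\<close> makes it vanish at 0, so that it
  maps test functions to test functions.\<close>

definition soft_abs :: "real \<Rightarrow> real \<Rightarrow> real" where
  "soft_abs e s = sqrt (s\<^sup>2 + e\<^sup>2) - e"

lemma soft_abs_bounds:
  assumes "0 < e"
  shows "0 \<le> soft_abs e s" "soft_abs e s \<le> \<bar>s\<bar>" "\<bar>s\<bar> - e \<le> soft_abs e s" "soft_abs e 0 = 0"
proof -
  have "sqrt (e\<^sup>2) \<le> sqrt (s\<^sup>2 + e\<^sup>2)" by (rule real_sqrt_le_mono) simp
  then show "0 \<le> soft_abs e s" using assms by (simp add: soft_abs_def)
  have "sqrt (s\<^sup>2 + e\<^sup>2) \<le> \<bar>s\<bar> + e"
    using assms by (intro real_le_lsqrt) (auto simp: power2_sum)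
  then show "soft_abs e s \<le> \<bar>s\<bar>" by (simp add: soft_abs_def)
  have "sqrt (s\<^sup>2) \<le> sqrt (s\<^sup>2 + e\<^sup>2)" by (rule real_sqrt_le_mono) simp
  then show "\<bar>s\<bar> - e \<le> soft_abs e s" by (simp add: soft_abs_def)
  show "soft_abs e 0 = 0" using assms by (simp add: soft_abs_def)
qed

lemma soft_abs_deriv:
  assumes "0 < e"
  obtains d where "(soft_abs e has_real_derivative d) (at s)" "\<bar>d\<bar> \<le> 1"
proof -
  have pos: "0 < s\<^sup>2 + e\<^sup>2" using assms by (simp add: add_nonneg_pos)
  have "(soft_abs e has_real_derivative s / sqrt (s\<^sup>2 + e\<^sup>2)) (at s)"
    unfolding soft_abs_def using pos
    by (auto intro!: derivative_eq_intros simp: field_simps)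
  moreover have "\<bar>s / sqrt (s\<^sup>2 + e\<^sup>2)\<bar> \<le> 1"
  proof -
    have "sqrt (s\<^sup>2) \<le> sqrt (s\<^sup>2 + e\<^sup>2)" by (rule real_sqrt_le_mono) simp
    then show ?thesis using pos by (simp add: abs_div_pos[symmetric] divide_le_eq_1)
  qed
  ultimately show ?thesis using that by blast
qed

lemma smooth_soft_abs:
  assumes "smooth f" "0 < e"
  shows "smooth (\<lambda>x. soft_abs e (f x))"
proof -
  have pos: "0 < f x * f x + e\<^sup>2" for x using assms by (simp add: add_nonneg_pos)
  have "smooth (\<lambda>x. (f x * f x + e\<^sup>2) powr (1/2) - e)"
    using assms(1) pos by (intro smooth_diff smooth_powr smooth_add smooth_mult smooth_const) auto
  moreover have "(\<lambda>x. (f x * f x + e\<^sup>2) powr (1/2) - e) = (\<lambda>x. soft_abs e (f x))"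
    using pos by (auto simp: soft_abs_def powr_half_sqrt power2_eq_square less_imp_le)
  ultimately show ?thesis by simp
qed

lemma le_if_le_add_small:
  fixes a b c :: real
  assumes "\<And>e. 0 < e \<Longrightarrow> a \<le> b + e * c"
  shows "a \<le> b"
proof (rule field_le_epsilon)
  fix e :: real assume e: "0 < e"
  have "a \<le> b + e / (\<bar>c\<bar> + 1) * c" using e by (intro assms) (auto intro: divide_pos_pos)
  also have "e / (\<bar>c\<bar> + 1) * c \<le> e"
  proof -
    have "e * c \<le> e * (\<bar>c\<bar> + 1)" using e by (intro mult_left_mono) auto
    then show ?thesis using pos_divide_le_eq[of "\<bar>c\<bar> + 1" "e * c" e] by simp
  qed
  finally show "a \<le> b + e" by simp
qed

locale p_laplace_problem =
  fixes \<Omega> :: "'a::euclidean_space set" and p :: real and \<sigma> :: "'a measure"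
  assumes open_\<Omega>: "open \<Omega>" and bounded_\<Omega>: "bounded \<Omega>" and p: "1 < p"
    and \<sigma>: "locally_finite_measure_in \<Omega> \<sigma>"
begin

abbreviation \<mu> :: "'a measure" where "\<mu> \<equiv> lebesgue_on \<Omega>"

sublocale leb: finite_measure \<mu>
  by (intro finite_measure_lebesgue_on bounded_set_imp_lmeasurable bounded_\<Omega>)
    (use open_\<Omega> in auto)

lemma borel_measurable_lebesgue_on [measurable_dest]:
  "f \<in> borel_measurable borel \<Longrightarrow> f \<in> borel_measurable \<mu>"
  by (intro measurable_restrict_space1 measurable_completion) simp

lemma borel_measurable_\<sigma>: "f \<in> borel_measurable borel \<Longrightarrow> f \<in> borel_measurable \<sigma>"
  using measurable_restrict_space1[of f borel borel \<Omega>] \<sigma> measurable_cong_sets[of \<sigma> "restrict_space borel \<Omega>"]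
  unfolding locally_finite_measure_in_def by blast

lemma compact_sets_\<sigma>:
  assumes "compact K" "K \<subseteq> \<Omega>"
  shows "K \<in> sets \<sigma>" "emeasure \<sigma> K < \<infinity>"
proof -
  have "K \<in> sets (restrict_space borel \<Omega>)"
    using assms open_\<Omega> by (subst sets_restrict_space_iff) (auto intro: borel_compact)
  then show "K \<in> sets \<sigma>" "emeasure \<sigma> K < \<infinity>"
    using \<sigma> assms by (auto simp: locally_finite_measure_in_def)
qed

section \<open>Integrals of compactly supported functions and the gradient energy\<close>

lemma test_integrable:
  fixes f :: "'a \<Rightarrow> real"
  assumes \<phi>: "\<phi> \<in> test_functions \<Omega>" and f: "continuous_on UNIV f"
    and 0: "\<And>x. x \<notin> closure {x. \<phi> x \<noteq> 0} \<Longrightarrow> f x = 0"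
  shows "integrable \<sigma> f" "integrable \<mu> f"
proof -
  let ?K = "closure {x. \<phi> x \<noteq> 0}"
  have K: "compact ?K" "?K \<subseteq> \<Omega>" using \<phi> by (auto simp: test_functions_def)
  have "bounded (f ` ?K)"
    using K f by (intro compact_imp_bounded compact_continuous_image) (auto intro: continuous_on_subset)
  then obtain B where B: "\<And>x. x \<in> ?K \<Longrightarrow> \<bar>f x\<bar> \<le> B" by (auto simp: bounded_iff)
  have m: "f \<in> borel_measurable borel" using f by (rule borel_measurable_continuous_onI)
  show "integrable \<sigma> f"
    by (rule integrableI_bounded_set[where A = ?K and B = B])
      (use compact_sets_\<sigma>[OF K] borel_measurable_\<sigma>[OF m] B 0 in auto)
  have "?K \<in> sets \<mu>"
    using K open_\<Omega> by (subst sets_restrict_space_iff) (auto intro: borel_compact)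
  then show "integrable \<mu> f"
    by (rule integrableI_bounded_set[where A = ?K and B = B])
      (use borel_measurable_lebesgue_on[OF m] B 0 in \<open>auto simp: less_top[symmetric]\<close>)
qed

lemma test_zero_off_support:
  assumes "x \<notin> closure {x. \<phi> x \<noteq> 0}"
  shows "\<phi> x = 0" "grad \<phi> x = 0"
  using assms closure_subset[of "{x. \<phi> x \<noteq> 0}"] grad_eq_0[OF assms] by auto

lemma test_bounded:
  assumes \<phi>: "\<phi> \<in> test_functions \<Omega>"
  shows "\<exists>B>0. \<forall>x. \<bar>\<phi> x\<bar> \<le> B \<and> norm (grad \<phi> x) \<le> B"
proof -
  let ?K = "closure {x. \<phi> x \<noteq> 0}"
  have K: "compact ?K" using \<phi> by (auto simp: test_functions_def)
  have sm: "smooth \<phi>" using \<phi> by (rule test_functions_smooth)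
  have "bounded (\<phi> ` ?K)" "bounded (grad \<phi> ` ?K)"
    using K smooth_imp_continuous[OF sm] continuous_on_grad[OF sm]
    by (auto intro!: compact_imp_bounded compact_continuous_image intro: continuous_on_subset)
  then obtain B1 B2 where B: "\<And>x. x \<in> ?K \<Longrightarrow> \<bar>\<phi> x\<bar> \<le> B1" "\<And>x. x \<in> ?K \<Longrightarrow> norm (grad \<phi> x) \<le> B2"
    by (auto simp: bounded_iff)
  show ?thesis
  proof (intro exI conjI allI)
    fix x
    show "\<bar>\<phi> x\<bar> \<le> \<bar>B1\<bar> + \<bar>B2\<bar> + 1" "norm (grad \<phi> x) \<le> \<bar>B1\<bar> + \<bar>B2\<bar> + 1"
      using B[of x] test_zero_off_support[of x \<phi>] by (cases "x \<in> ?K"; force)+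
  qed simp
qed

lemma grad_measurable [measurable]:
  "\<phi> \<in> test_functions \<Omega> \<Longrightarrow> grad \<phi> \<in> borel_measurable \<mu>"
  by (intro borel_measurable_lebesgue_on borel_measurable_continuous_onI continuous_on_grad
      test_functions_smooth)

lemma test_measurable [measurable]:
  "\<phi> \<in> test_functions \<Omega> \<Longrightarrow> \<phi> \<in> borel_measurable \<mu>"
  by (intro borel_measurable_lebesgue_on borel_measurable_continuous_onI smooth_imp_continuous
      test_functions_smooth)

definition energy :: "('a \<Rightarrow> real) \<Rightarrow> real" where
  "energy \<phi> = (\<integral>x. norm (grad \<phi> x) powr p \<partial>\<mu>)"

lemma energy_nonneg: "0 \<le> energy \<phi>"
  unfolding energy_def by (intro Bochner_Integration.integral_nonneg) simp

lemma integrable_energy: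
  assumes \<phi>: "\<phi> \<in> test_functions \<Omega>"
  shows "integrable \<mu> (\<lambda>x. norm (grad \<phi> x) powr p)"
proof (rule test_integrable(2)[OF \<phi>])
  show "continuous_on UNIV (\<lambda>x. norm (grad \<phi> x) powr p)"
    using p by (intro continuous_on_powr' continuous_on_norm continuous_on_grad
      test_functions_smooth[OF \<phi>] continuous_on_const) auto
  show "norm (grad \<phi> x) powr p = 0" if "x \<notin> closure {x. \<phi> x \<noteq> 0}" for x
    unfolding test_zero_off_support(2)[OF that] by simp
qed

lemma energy_mono:
  assumes "\<phi> \<in> test_functions \<Omega>" "\<psi> \<in> test_functions \<Omega>"
    and "\<And>x. norm (grad \<phi> x) \<le> norm (grad \<psi> x)"
  shows "energy \<phi> \<le> energy \<psi>"
  unfolding energy_def using assms p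
  by (intro integral_mono integrable_energy powr_mono2) auto

text \<open>A uniform error \<open>e\<close> between functions living on the support of
  \<open>\<phi>\<close> costs only \<open>e\<close> times the mass of this compact set, which is
  finite by local finiteness. Smooth approximations may thus replace
  \<open>\<bar>\<phi>\<bar>\<close> and its powers under \<open>\<sigma>\<close>.\<close>

lemma integral_\<sigma>_le_add:
  assumes \<phi>: "\<phi> \<in> test_functions \<Omega>" and f: "continuous_on UNIV f" and g: "continuous_on UNIV g"
    and 0: "\<And>x. \<phi> x = 0 \<Longrightarrow> f x = 0" "\<And>x. \<phi> x = 0 \<Longrightarrow> g x = 0"
    and le: "\<And>x. f x \<le> g x + e"
  shows "(\<integral>x. f x \<partial>\<sigma>) \<le> (\<integral>x. g x \<partial>\<sigma>) + e * measure \<sigma> (closure {x. \<phi> x \<noteq> 0})"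
proof -
  let ?K = "closure {x. \<phi> x \<noteq> 0}"
  have K: "compact ?K" "?K \<subseteq> \<Omega>" using \<phi> by (auto simp: test_functions_def)
  note Ks = compact_sets_\<sigma>[OF K]
  have if': "integrable \<sigma> f" and ig: "integrable \<sigma> g"
    by (intro test_integrable(1)[OF \<phi>] f g 0 test_zero_off_support(1); assumption)+
  have ind: "integrable \<sigma> (\<lambda>x. e * indicat_real ?K x)" using Ks by auto
  have "(\<integral>x. f x \<partial>\<sigma>) \<le> (\<integral>x. g x + e * indicat_real ?K x \<partial>\<sigma>)"
  proof (rule integral_mono[OF if' Bochner_Integration.integrable_add[OF ig ind]])
    fix x
    show "f x \<le> g x + e * indicat_real ?K x"
      using le[of x] 0[of x] test_zero_off_support(1)[of x \<phi>] by (cases "x \<in> ?K") auto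
  qed
  also have "\<dots> = (\<integral>x. g x \<partial>\<sigma>) + e * measure \<sigma> ?K"
    using Ks ig ind by (subst Bochner_Integration.integral_add)
      (auto simp: Int_absorb2 sets.sets_into_space)
  finally show ?thesis .
qed

text \<open>Since \<open>\<bar>\<phi>\<bar>\<close> need not be smooth, the hypothesis is applied to
  \<open>soft_abs e\<close> of \<open>\<phi>\<close>, which is nonnegative and, having slope at most
  1, has no more energy than \<open>\<phi>\<close>; then \<open>e\<close> tends to 0.\<close>

lemma dual_bound_abs:
  assumes bound: "\<And>\<psi>. \<psi> \<in> test_functions \<Omega> \<Longrightarrow> (\<And>x. 0 \<le> \<psi> x) \<Longrightarrow>
      (\<integral>x. \<psi> x \<partial>\<sigma>) \<le> C * energy \<psi> powr (1 / p)"
    and C: "0 \<le> C" and \<phi>: "\<phi> \<in> test_functions \<Omega>"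
  shows "(\<integral>x. \<bar>\<phi> x\<bar> \<partial>\<sigma>) \<le> C * energy \<phi> powr (1 / p)"
proof (rule le_if_le_add_small)
  fix e :: real assume e: "0 < e"
  have sm: "smooth \<phi>" using \<phi> by (rule test_functions_smooth)
  let ?\<psi> = "\<lambda>x. soft_abs e (\<phi> x)"
  have \<psi>: "?\<psi> \<in> test_functions \<Omega>"
    by (rule test_functionsI[OF \<phi> smooth_soft_abs[OF sm e]]) (simp add: soft_abs_bounds e)
  have "norm (grad ?\<psi> x) \<le> norm (grad \<phi> x)" for x
  proof -
    obtain d where d: "(soft_abs e has_real_derivative d) (at (\<phi> x))" "\<bar>d\<bar> \<le> 1"
      using soft_abs_deriv[OF e] by blast
    show ?thesis using grad_compose[OF sm d(1)] d(2) by (simp add: mult_left_le_one_le)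
  qed
  then have E: "energy ?\<psi> \<le> energy \<phi>" by (rule energy_mono[OF \<psi> \<phi>])
  have "(\<integral>x. \<bar>\<phi> x\<bar> \<partial>\<sigma>) \<le> (\<integral>x. ?\<psi> x \<partial>\<sigma>) + e * measure \<sigma> (closure {x. \<phi> x \<noteq> 0})"
  proof (rule integral_\<sigma>_le_add[OF \<phi>])
    show "\<bar>\<phi> x\<bar> \<le> ?\<psi> x + e" for x using soft_abs_bounds(3)[OF e, of "\<phi> x"] by linarith
  qed (use smooth_imp_continuous[OF sm] smooth_imp_continuous[OF smooth_soft_abs[OF sm e]] e
      in \<open>auto intro: continuous_intros simp: soft_abs_bounds\<close>)
  also have "(\<integral>x. ?\<psi> x \<partial>\<sigma>) \<le> C * energy ?\<psi> powr (1 / p)"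
    by (rule bound[OF \<psi>]) (use soft_abs_bounds e in auto)
  also have "\<dots> \<le> C * energy \<phi> powr (1 / p)"
    using C E p energy_nonneg by (intro mult_left_mono powr_mono2) auto
  finally show "(\<integral>x. \<bar>\<phi> x\<bar> \<partial>\<sigma>) \<le> C * energy \<phi> powr (1 / p) + e * measure \<sigma> (closure {x. \<phi> x \<noteq> 0})"
    by simp
qed

section \<open>Testing the equation of a given solution\<close>

lemma W01p_grad_integrable:
  assumes "W01p_grad p \<Omega> u g"
  shows "g \<in> borel_measurable \<mu>" "integrable \<mu> (\<lambda>x. norm (g x) powr p)"
proof -
  show [measurable]: "g \<in> borel_measurable \<mu>" using assms by (simp add: W01p_grad_def)
  obtain \<phi> where \<phi>: "\<And>k::nat. \<phi> k \<in> test_functions \<Omega>"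
    and lim: "(\<lambda>k. \<integral>\<^sup>+x. ennreal (norm (grad (\<phi> k) x - g x) powr p) \<partial>\<mu>) \<longlonglongrightarrow> 0"
    using assms unfolding W01p_grad_def by blast
  note [measurable] = grad_measurable[OF \<phi>]
  have "eventually (\<lambda>k. (\<integral>\<^sup>+x. ennreal (norm (grad (\<phi> k) x - g x) powr p) \<partial>\<mu>) < 1) sequentially"
    by (rule order_tendstoD[OF lim]) simp
  then obtain k where k: "(\<integral>\<^sup>+x. ennreal (norm (grad (\<phi> k) x - g x) powr p) \<partial>\<mu>) < 1"
    by (auto simp: eventually_sequentially)
  have i: "integrable \<mu> (\<lambda>x. norm (grad (\<phi> k) x - g x) powr p)"
    using order.strict_trans[OF k ennreal_one_less_top] by (intro integrableI_nonneg) auto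
  show "integrable \<mu> (\<lambda>x. norm (g x) powr p)"
  proof (rule Bochner_Integration.integrable_bound)
    show "integrable \<mu>
      (\<lambda>x. 2 powr p * (norm (grad (\<phi> k) x) powr p + norm (grad (\<phi> k) x - g x) powr p))"
      using i integrable_energy[OF \<phi>] by auto
    show "AE x in \<mu>. norm (norm (g x) powr p)
      \<le> norm (2 powr p * (norm (grad (\<phi> k) x) powr p + norm (grad (\<phi> k) x - g x) powr p))"
      using powr_norm_diff_le[of p "grad (\<phi> k) x" "grad (\<phi> k) x - g x" for x] p
      by (intro AE_I2) (auto simp: abs_of_nonneg)
  qed measurable
qed

text \<open>Cauchy-Schwarz, then \<open>Young_powr\<close> for \<open>norm v\<close> and
  \<open>norm w / s\<close>. The weight \<open>s\<close> is free: 1 for mere integrability and for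
  tangent lines, about the gradient norm for the dual bound, \<open>1 / (p - 1)\<close> for the
  sharp constant.\<close>

lemma flux_bound:
  assumes "0 < s"
  shows "p * (norm v powr (p - 2) * \<bar>v \<bullet> w\<bar>) \<le> (p - 1) * s * norm v powr p + s powr (1 - p) * norm w powr p"
proof -
  have "norm v powr (p - 2) * \<bar>v \<bullet> w\<bar> \<le> norm v powr (p - 2) * (norm v * norm w)"
    by (intro mult_left_mono Cauchy_Schwarz_ineq2) auto
  also have "\<dots> = norm v powr (p - 1) * norm w"
    using powr_add[of "norm v" "p - 2" 1] by (cases "v = 0") auto
  finally have "p * (norm v powr (p - 2) * \<bar>v \<bullet> w\<bar>) \<le> p * (norm v powr (p - 1) * norm w)"
    using p by (intro mult_left_mono) auto
  also have "\<dots> = s * (p * norm v powr (p - 1) * (norm w / s))" using assms by simp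
  also have "\<dots> \<le> s * ((p - 1) * norm v powr p + (norm w / s) powr p)"
    using assms p by (intro mult_left_mono Young_powr) auto
  also have "s * ((p - 1) * norm v powr p + (norm w / s) powr p)
      = (p - 1) * s * norm v powr p + s powr (1 - p) * norm w powr p"
  proof -
    have "s * (norm w / s) powr p = s powr (1 - p) * norm w powr p"
      using assms by (simp add: powr_divide powr_diff)
    then show ?thesis by (simp add: distrib_left mult_ac)
  qed
  finally show ?thesis .
qed

lemma flux_integrable:
  assumes [measurable]: "g \<in> borel_measurable \<mu>"
    and g: "integrable \<mu> (\<lambda>x. norm (g x) powr p)" and \<phi>: "\<phi> \<in> test_functions \<Omega>"
  shows "integrable \<mu> (\<lambda>x. norm (g x) powr (p - 2) * (g x \<bullet> grad \<phi> x))"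
    and "integrable \<mu> (\<lambda>x. norm (g x) powr p * \<phi> x)"
proof -
  note [measurable] = grad_measurable[OF \<phi>] test_measurable[OF \<phi>]
  show "integrable \<mu> (\<lambda>x. norm (g x) powr (p - 2) * (g x \<bullet> grad \<phi> x))"
  proof (rule Bochner_Integration.integrable_bound)
    show "integrable \<mu> (\<lambda>x. ((p - 1) * norm (g x) powr p + norm (grad \<phi> x) powr p) / p)"
      using g integrable_energy[OF \<phi>] by auto
    show "AE x in \<mu>. norm (norm (g x) powr (p - 2) * (g x \<bullet> grad \<phi> x))
        \<le> norm (((p - 1) * norm (g x) powr p + norm (grad \<phi> x) powr p) / p)"
    proof (rule AE_I2)
      fix x
      have "p * (norm (g x) powr (p - 2) * \<bar>g x \<bullet> grad \<phi> x\<bar>) \<le> (p - 1) * norm (g x) powr p + norm (grad \<phi> x) powr p"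
        using flux_bound[of 1 "g x" "grad \<phi> x"] by simp
      moreover have "0 \<le> (p - 1) * norm (g x) powr p + norm (grad \<phi> x) powr p" using p by simp
      ultimately show "norm (norm (g x) powr (p - 2) * (g x \<bullet> grad \<phi> x))
        \<le> norm (((p - 1) * norm (g x) powr p + norm (grad \<phi> x) powr p) / p)"
        using p by (simp add: abs_mult field_simps)
    qed
  qed measurable
  obtain B where B: "0 < B" "\<And>x. \<bar>\<phi> x\<bar> \<le> B"
    using test_bounded[OF \<phi>] by blast
  show "integrable \<mu> (\<lambda>x. norm (g x) powr p * \<phi> x)"
  proof (rule Bochner_Integration.integrable_bound)
    show "integrable \<mu> (\<lambda>x. norm (g x) powr p * B)" using g by auto
    show "AE x in \<mu>. norm (norm (g x) powr p * \<phi> x) \<le> norm (norm (g x) powr p * B)"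
      using B by (intro AE_I2) (auto simp: abs_mult intro!: mult_left_mono)
  qed measurable
qed

text \<open>For a nonnegative test function the term with \<open>norm (g x) powr p\<close> may be
  dropped, so \<open>\<sigma>\<close> is dominated by the flux, which \<open>flux_bound\<close>
  estimates. The sign condition is removed by \<open>dual_bound_abs\<close>.\<close>

lemma necessary_dual:
  assumes "solves_P p \<Omega> \<sigma> u"
  shows "in_dual_W01p p \<Omega> \<sigma>"
proof -
  obtain g where W: "W01p_grad p \<Omega> u g" and eq: "\<And>\<phi>. \<phi> \<in> test_functions \<Omega> \<Longrightarrow>
      (\<integral>x. norm (g x) powr (p - 2) * (g x \<bullet> grad \<phi> x) \<partial>\<mu>) =
      (\<integral>x. norm (g x) powr p * \<phi> x \<partial>\<mu>) + (\<integral>x. \<phi> x \<partial>\<sigma>)"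
    using assms unfolding solves_P_def by blast
  note g = W01p_grad_integrable[OF W]
  define I where "I = (\<integral>x. norm (g x) powr p \<partial>\<mu>)"
  have I0: "0 \<le> I" unfolding I_def by (intro Bochner_Integration.integral_nonneg) simp
  define C where "C = ((p - 1) * I + 1) / p"
  have C: "0 \<le> C" using p I0 by (simp add: C_def)
  have pos: "(\<integral>x. \<psi> x \<partial>\<sigma>) \<le> C * energy \<psi> powr (1 / p)"
    if \<psi>: "\<psi> \<in> test_functions \<Omega>" "\<And>x. 0 \<le> \<psi> x" for \<psi>
  proof (rule le_if_le_add_small)
    fix e :: real assume e: "0 < e"
    \<comment> \<open>With this weight both terms of \<open>flux_bound\<close> integrate to at most
      constant multiples of \<open>s\<close>; the summand \<open>e\<close> keeps \<open>s\<close>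
      positive when the energy vanishes.\<close>
    define s where "s = energy \<psi> powr (1 / p) + e"
    have s: "0 < s" using e by (simp add: s_def add_nonneg_pos)
    have Es: "energy \<psi> \<le> s powr p"
    proof -
      have "(energy \<psi> powr (1 / p)) powr p \<le> s powr p" using e p by (intro powr_mono2) (auto simp: s_def)
      then show ?thesis using p energy_nonneg by (simp add: powr_powr)
    qed
    have "p * (\<integral>x. \<psi> x \<partial>\<sigma>) \<le> p * (\<integral>x. norm (g x) powr (p - 2) * (g x \<bullet> grad \<psi> x) \<partial>\<mu>)"
      using eq[OF \<psi>(1)] \<psi>(2) p
      by (intro mult_left_mono) (auto intro!: Bochner_Integration.integral_nonneg)
    also have "\<dots> = (\<integral>x. p * (norm (g x) powr (p - 2) * (g x \<bullet> grad \<psi> x)) \<partial>\<mu>)" by simp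
    also have "\<dots> \<le> (\<integral>x. (p - 1) * s * norm (g x) powr p + s powr (1 - p) * norm (grad \<psi> x) powr p \<partial>\<mu>)"
    proof (rule integral_mono)
      fix x
      have "p * (norm (g x) powr (p - 2) * (g x \<bullet> grad \<psi> x)) \<le> p * (norm (g x) powr (p - 2) * \<bar>g x \<bullet> grad \<psi> x\<bar>)"
        using p by (intro mult_left_mono) auto
      then show "p * (norm (g x) powr (p - 2) * (g x \<bullet> grad \<psi> x))
        \<le> (p - 1) * s * norm (g x) powr p + s powr (1 - p) * norm (grad \<psi> x) powr p"
        using flux_bound[OF s, of "g x" "grad \<psi> x"] by linarith
    qed (use flux_integrable(1)[OF g \<psi>(1)] g(2) integrable_energy[OF \<psi>(1)] in auto)
    also have "\<dots> = (p - 1) * s * I + s powr (1 - p) * energy \<psi>"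
      using g(2) integrable_energy[OF \<psi>(1)] unfolding I_def energy_def
      by (subst Bochner_Integration.integral_add) auto
    also have "s powr (1 - p) * energy \<psi> \<le> s powr (1 - p) * s powr p"
      using Es by (intro mult_left_mono) auto
    also have "s powr (1 - p) * s powr p = s" using s powr_add[of s "1 - p" p] by simp
    finally have "(\<integral>x. \<psi> x \<partial>\<sigma>) \<le> C * s" using p by (simp add: C_def field_simps)
    then show "(\<integral>x. \<psi> x \<partial>\<sigma>) \<le> C * energy \<psi> powr (1 / p) + e * C" by (simp add: s_def algebra_simps)
  qed
  show ?thesis
    unfolding in_dual_W01p_def
  proof (intro exI ballI)
    fix \<phi> assume \<phi>: "\<phi> \<in> test_functions \<Omega>"
    have "\<bar>\<integral>x. \<phi> x \<partial>\<sigma>\<bar> \<le> (\<integral>x. \<bar>\<phi> x\<bar> \<partial>\<sigma>)" by (rule integral_abs_bound)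
    also have "\<dots> \<le> C * energy \<phi> powr (1 / p)" by (rule dual_bound_abs[OF pos C \<phi>])
    finally show "\<bar>\<integral>x. \<phi> x \<partial>\<sigma>\<bar> \<le> C * (\<integral>x. norm (grad \<phi> x) powr p \<partial>\<mu>) powr (1 / p)"
      by (simp add: energy_def)
  qed
qed

text \<open>The test function \<open>\<psi> = A powr p - e powr p\<close> is a smooth stand-in for
  \<open>\<bar>\<phi>\<bar> powr p\<close>. Its flux term is bounded by that of
  \<open>A x *\<^sub>R g x\<close> against \<open>grad \<phi> x\<close>, so Young's inequality
  produces \<open>A x powr p * norm (g x) powr p\<close>, which the gradient term of the equation
  cancels.\<close>

lemma necessary_ineq:
  assumes "solves_P p \<Omega> \<sigma> u"
  shows "ineq_I p \<Omega> \<sigma> ((p - 1) powr (p - 1))"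
proof -
  obtain g where W: "W01p_grad p \<Omega> u g" and eq: "\<And>\<phi>. \<phi> \<in> test_functions \<Omega> \<Longrightarrow>
      (\<integral>x. norm (g x) powr (p - 2) * (g x \<bullet> grad \<phi> x) \<partial>\<mu>) =
      (\<integral>x. norm (g x) powr p * \<phi> x \<partial>\<mu>) + (\<integral>x. \<phi> x \<partial>\<sigma>)"
    using assms unfolding solves_P_def by blast
  note g = W01p_grad_integrable[OF W]
  define I where "I = (\<integral>x. norm (g x) powr p \<partial>\<mu>)"
  have "(\<integral>x. \<bar>\<phi> x\<bar> powr p \<partial>\<sigma>) \<le> (p - 1) powr (p - 1) * energy \<phi>" if \<phi>: "\<phi> \<in> test_functions \<Omega>" for \<phi>
  proof (rule le_if_le_add_small)
    let ?m = "measure \<sigma> (closure {x. \<phi> x \<noteq> 0})"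
    fix \<epsilon> :: real assume \<epsilon>: "0 < \<epsilon>"
    define e where "e = \<epsilon> powr (1 / p)"
    have e: "0 < e" "e powr p = \<epsilon>" using \<epsilon> p by (auto simp: e_def powr_powr)
    have sm: "smooth \<phi>" using \<phi> by (rule test_functions_smooth)
    define A where "A x = sqrt ((\<phi> x)\<^sup>2 + e\<^sup>2)" for x
    have q: "0 < (\<phi> x)\<^sup>2 + e\<^sup>2" for x using e by (simp add: add_nonneg_pos)
    have A: "0 < A x" "\<bar>\<phi> x\<bar> \<le> A x" for x
    proof -
      show "0 < A x" using q by (simp add: A_def)
      have "sqrt ((\<phi> x)\<^sup>2) \<le> A x" unfolding A_def by (rule real_sqrt_le_mono) simp
      then show "\<bar>\<phi> x\<bar> \<le> A x" by simp
    qed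
    have Aq: "A x powr a = ((\<phi> x)\<^sup>2 + e\<^sup>2) powr (a / 2)" for x a
      using q[of x] by (simp add: A_def powr_half_sqrt[symmetric] powr_powr less_imp_le)
    define \<psi> where "\<psi> x = A x powr p - e powr p" for x
    have \<psi>_eq: "\<psi> x = A x powr p - \<epsilon>" for x using e by (simp add: \<psi>_def)
    have "smooth (\<lambda>x. (\<phi> x * \<phi> x + e\<^sup>2) powr (p / 2) - e powr p)"
      using sm q by (intro smooth_diff smooth_powr smooth_add smooth_mult smooth_const)
        (auto simp: power2_eq_square)
    then have sm\<psi>: "smooth \<psi>" unfolding \<psi>_def Aq by (simp add: power2_eq_square)
    have \<psi>0: "\<phi> x = 0 \<Longrightarrow> \<psi> x = 0" for x using e by (simp add: \<psi>_def A_def)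
    have \<psi>: "\<psi> \<in> test_functions \<Omega>" by (rule test_functionsI[OF \<phi> sm\<psi> \<psi>0])
    have grad\<psi>: "grad \<psi> x = (p * A x powr (p - 2) * \<phi> x) *\<^sub>R grad \<phi> x" for x
      unfolding \<psi>_def Aq
    proof (rule grad_compose[OF sm, where F = "\<lambda>s. (s\<^sup>2 + e\<^sup>2) powr (p / 2) - e powr p"])
      show "((\<lambda>s. (s\<^sup>2 + e\<^sup>2) powr (p / 2) - e powr p) has_real_derivative
          p * ((\<phi> x)\<^sup>2 + e\<^sup>2) powr ((p - 2) / 2) * \<phi> x) (at (\<phi> x))"
        using q[of x] by (auto intro!: derivative_eq_intros simp: diff_divide_distrib)
    qed
    have ptw: "norm (g x) powr (p - 2) * (g x \<bullet> grad \<psi> x) - norm (g x) powr p * \<psi> x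
      \<le> (p - 1) powr (p - 1) * norm (grad \<phi> x) powr p + \<epsilon> * norm (g x) powr p" for x
    proof -
      \<comment> \<open>This value makes the coefficient \<open>(p - 1) * s\<close> equal to 1, as
        the cancellation demands; the sharp constant is then \<open>s powr (1 - p)\<close>. The
        leftover \<open>\<epsilon> * norm (g x) powr p\<close> stems from the subtracted
        \<open>e powr p\<close> in \<open>\<psi>\<close>.\<close>
      define s where "s = 1 / (p - 1)"
      have s: "0 < s" using p by (simp add: s_def)
      let ?v = "A x *\<^sub>R g x"
      have "norm (g x) powr (p - 2) * (g x \<bullet> grad \<psi> x)
          = p * (norm (g x) powr (p - 2) * A x powr (p - 2) * (\<phi> x * (g x \<bullet> grad \<phi> x)))"
        by (simp add: grad\<psi> mult_ac)
      also have "\<dots> \<le> p * (norm (g x) powr (p - 2) * A x powr (p - 2) * (A x * \<bar>g x \<bullet> grad \<phi> x\<bar>))"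
      proof (intro mult_left_mono)
        have "\<phi> x * (g x \<bullet> grad \<phi> x) \<le> \<bar>\<phi> x\<bar> * \<bar>g x \<bullet> grad \<phi> x\<bar>" by (metis abs_ge_self abs_mult)
        also have "\<dots> \<le> A x * \<bar>g x \<bullet> grad \<phi> x\<bar>" using A by (intro mult_right_mono) auto
        finally show "\<phi> x * (g x \<bullet> grad \<phi> x) \<le> A x * \<bar>g x \<bullet> grad \<phi> x\<bar>" .
      qed (use p in auto)
      also have "\<dots> = p * (norm ?v powr (p - 2) * \<bar>?v \<bullet> grad \<phi> x\<bar>)"
        using A(1)[of x] by (simp add: powr_mult abs_mult mult_ac)
      also have "\<dots> \<le> (p - 1) * s * norm ?v powr p + s powr (1 - p) * norm (grad \<phi> x) powr p"
        by (rule flux_bound[OF s])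
      also have "(p - 1) * s = 1" using p by (simp add: s_def)
      also have "s powr (1 - p) = (p - 1) powr (p - 1)"
        using p by (simp add: s_def powr_divide powr_minus_divide[symmetric])
      also have "norm ?v powr p = A x powr p * norm (g x) powr p" using A(1)[of x] by (simp add: powr_mult)
      finally show ?thesis unfolding \<psi>_eq by (simp add: algebra_simps)
    qed
    have "(\<integral>x. \<bar>\<phi> x\<bar> powr p \<partial>\<sigma>) \<le> (\<integral>x. \<psi> x \<partial>\<sigma>) + \<epsilon> * ?m"
    proof (rule integral_\<sigma>_le_add[OF \<phi>])
      show "continuous_on UNIV (\<lambda>x. \<bar>\<phi> x\<bar> powr p)"
        using p smooth_imp_continuous[OF sm] by (intro continuous_on_powr' continuous_intros) auto
      show "continuous_on UNIV \<psi>" by (rule smooth_imp_continuous[OF sm\<psi>])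
      show "\<bar>\<phi> x\<bar> powr p \<le> \<psi> x + \<epsilon>" for x
        using A[of x] p e powr_mono2[of p "\<bar>\<phi> x\<bar>" "A x"] by (simp add: \<psi>_def)
    qed (use \<psi>0 p in auto)
    also have "(\<integral>x. \<psi> x \<partial>\<sigma>) = (\<integral>x. norm (g x) powr (p - 2) * (g x \<bullet> grad \<psi> x) - norm (g x) powr p * \<psi> x \<partial>\<mu>)"
      using eq[OF \<psi>] flux_integrable[OF g \<psi>] by simp
    also have "\<dots> \<le> (\<integral>x. (p - 1) powr (p - 1) * norm (grad \<phi> x) powr p + \<epsilon> * norm (g x) powr p \<partial>\<mu>)"
      by (intro integral_mono ptw) (use flux_integrable[OF g \<psi>] integrable_energy[OF \<phi>] g(2) in auto)
    also have "\<dots> = (p - 1) powr (p - 1) * energy \<phi> + \<epsilon> * I"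
      using integrable_energy[OF \<phi>] g(2) unfolding I_def energy_def
      by (subst Bochner_Integration.integral_add) auto
    finally show "(\<integral>x. \<bar>\<phi> x\<bar> powr p \<partial>\<sigma>) \<le> (p - 1) powr (p - 1) * energy \<phi> + \<epsilon> * (I + ?m)"
      by (simp add: algebra_simps)
  qed
  then show ?thesis unfolding ineq_I_def energy_def by blast
qed

end

section \<open>The functional \<open>J\<close>\<close>

text \<open>Young's inequality with tuned weights: \<open>s\<close> makes the p-th power equal to
  \<open>p * a * X\<close>, and \<open>\<alpha>\<close> restores the factor \<open>b\<close>. It
  absorbs the dual bound on \<open>\<sigma>\<close>, of order \<open>X powr (1 / p)\<close>, into a
  coercive term.\<close>

lemma powr_root_absorb:
  fixes a b p :: real
  assumes "1 < p" "0 < a" "0 \<le> b"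
  shows "\<exists>M\<ge>0. \<forall>X\<ge>0. b * X powr (1 / p) \<le> a * X + M"
proof -
  define s where "s = (p * a) powr (1 / p)"
  define \<alpha> where "\<alpha> = (b / s) powr (1 / (p - 1))"
  have s: "0 < s" "s powr p = p * a" using assms by (auto simp: s_def powr_powr)
  have \<alpha>: "\<alpha> powr (p - 1) = b / s" using assms s by (simp add: \<alpha>_def powr_powr)
  have "b * X powr (1 / p) \<le> a * X + (p - 1) / p * \<alpha> powr p" if X: "0 \<le> X" for X
  proof -
    have "p * \<alpha> powr (p - 1) * (s * X powr (1 / p)) \<le> (p - 1) * \<alpha> powr p + (s * X powr (1 / p)) powr p"
      using assms s by (intro Young_powr) (auto simp: \<alpha>_def)
    also have "(s * X powr (1 / p)) powr p = p * a * X"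
      using assms s X by (simp add: powr_mult powr_powr)
    also have "p * \<alpha> powr (p - 1) * (s * X powr (1 / p)) = p * (b * X powr (1 / p))"
      using s by (simp add: \<alpha>)
    finally have "p * (b * X powr (1 / p)) \<le> p * (a * X + (p - 1) / p * \<alpha> powr p)"
      using assms by (simp add: distrib_left)
    then show ?thesis using assms by simp
  qed
  moreover have "0 \<le> (p - 1) / p * \<alpha> powr p" using assms by simp
  ultimately show ?thesis by blast
qed

lemma powr_diff_le:
  fixes v w p :: real
  assumes "1 < p" "0 \<le> v" "0 \<le> w"
  shows "v powr p - w powr p \<le> p * v powr (p - 1) * (v - w)"
proof -
  have "p * v powr (p - 1) * w \<le> (p - 1) * v powr p + w powr p" using assms by (intro Young_powr)
  moreover have "v powr p = v powr (p - 1) * v"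
    using assms powr_add[of v "p - 1" 1] by (cases "v = 0") auto
  ultimately show ?thesis by (simp add: algebra_simps)
qed

text \<open>Convexity of \<open>(\<rho>, \<xi>) \<mapsto> \<rho>\<^sup>1\<^sup>-\<^sup>p\<bar>\<xi>\<bar>\<^sup>p\<close> at the midpoint, with
  \<open>\<xi> = \<rho> a\<close> and a quantitative gain.\<close>

lemma weighted_powr_defect:
  fixes a b :: "'b::real_normed_vector"
  assumes p: "1 < p" and pos: "0 < m" "m \<le> r" "m \<le> s"
  shows "(r + s) / 2 * norm ((1 / (r + s)) *\<^sub>R (r *\<^sub>R a + s *\<^sub>R b)) powr p
    \<le> (r * norm a powr p + s * norm b powr p) / 2 - m * powr_defect p a b"
proof -
  have main: "(r + s) / 2 * norm ((1 / (r + s)) *\<^sub>R (r *\<^sub>R a + s *\<^sub>R b)) powr p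
    \<le> (r * norm a powr p + s * norm b powr p) / 2 - r * powr_defect p a b"
    if rs: "0 < r" "r \<le> s" for r s :: real and a b :: 'b
  proof -
    \<comment> \<open>The weighted mean of \<open>a\<close> and \<open>b\<close> is rewritten as a
      convex combination of the midpoint \<open>c\<close> and the endpoint \<open>b\<close> of
      larger weight; the share \<open>2 * r\<close> falling to \<open>c\<close> produces the gain
      \<open>r * powr_defect p a b\<close>.\<close>
    define t where "t = (s - r) / (r + s)"
    define c where "c = (1/2) *\<^sub>R (a + b)"
    have t: "0 \<le> t" "t \<le> 1" using rs by (auto simp: t_def)
    have t': "(r + s) * (1 - t) = 2 * r" "(r + s) * t = s - r" using rs by (auto simp: t_def field_simps)
    have "(r + s) *\<^sub>R ((1 - t) *\<^sub>R c + t *\<^sub>R b) = (2 * r) *\<^sub>R c + (s - r) *\<^sub>R b"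
      unfolding scaleR_add_right scaleR_scaleR t' ..
    also have "\<dots> = r *\<^sub>R a + s *\<^sub>R b" by (simp add: c_def algebra_simps)
    finally have eq: "(r + s) *\<^sub>R ((1 - t) *\<^sub>R c + t *\<^sub>R b) = r *\<^sub>R a + s *\<^sub>R b" .
    have "(1 / (r + s)) *\<^sub>R (r *\<^sub>R a + s *\<^sub>R b) = (1 - t) *\<^sub>R c + t *\<^sub>R b"
      unfolding eq[symmetric] scaleR_scaleR using rs by simp
    moreover have "(r + s) / 2 * norm ((1 - t) *\<^sub>R c + t *\<^sub>R b) powr p
        \<le> (r + s) / 2 * ((1 - t) * norm c powr p + t * norm b powr p)"
      using rs t p by (intro mult_left_mono norm_powr_convex) auto
    moreover have "(r + s) / 2 * ((1 - t) * norm c powr p + t * norm b powr p)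
        = ((r + s) * (1 - t) * norm c powr p + (r + s) * t * norm b powr p) / 2"
    proof -
      have "q / 2 * (u * C + v * B) = (q * u * C + q * v * B) / 2" for q u v C B :: real
        by (simp add: field_simps)
      then show ?thesis .
    qed
    moreover have "\<dots> = (2 * r * norm c powr p + (s - r) * norm b powr p) / 2" unfolding t' ..
    moreover have "\<dots> = (r * norm a powr p + s * norm b powr p) / 2 - r * powr_defect p a b"
      by (simp add: powr_defect_def c_def field_simps)
    ultimately show ?thesis by simp
  qed
  have D: "0 \<le> powr_defect p a b" by (rule powr_defect_nonneg[OF p])
  show ?thesis
  proof (cases "r \<le> s")
    case True
    have "m * powr_defect p a b \<le> r * powr_defect p a b" using D pos by (intro mult_right_mono)
    then show ?thesis using main[of r s a b] pos True by simp
  next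
    case False
    have "m * powr_defect p a b \<le> s * powr_defect p b a"
      using D pos by (simp add: powr_defect_def add.commute mult_right_mono)
    then show ?thesis using main[of s r b a] pos False by (simp add: add.commute)
  qed
qed

locale p_laplace_subcritical = p_laplace_problem +
  fixes l :: real
  assumes l: "0 < l" "l < (p - 1) powr (p - 1)"
    and dual: "in_dual_W01p p \<Omega> \<sigma>" and ineq: "ineq_I p \<Omega> \<sigma> l"
begin

definition c :: real where "c = (p - 1) powr (1 - p)"

lemma c_pos: "0 < c" using p by (simp add: c_def)

lemma c_inv: "(p - 1) powr (p - 1) * c = 1"
  using p powr_add[of "p - 1" "p - 1" "1 - p"] by (simp add: c_def)

text \<open>The strict bound on \<open>l\<close>, normalised so that 1 is the critical value;
  \<open>1 - c * l\<close> is the margin that pays for coercivity.\<close>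

lemma cl: "0 < c * l" "c * l < 1"
proof -
  show "0 < c * l" using c_pos l by simp
  have "c * l < c * (p - 1) powr (p - 1)" using c_pos l by (intro mult_strict_left_mono)
  then show "c * l < 1" using c_inv by (simp add: mult.commute)
qed

lemma test_integrable':
  fixes f :: "'a \<Rightarrow> real"
  assumes \<phi>: "\<phi> \<in> test_functions \<Omega>" and f: "continuous_on UNIV f"
    and 0: "\<And>x. \<phi> x = 0 \<Longrightarrow> f x = 0"
  shows "integrable \<sigma> f"
  by (rule test_integrable(1)[OF \<phi> f]) (rule 0, rule test_zero_off_support(1))

lemma dual_abs:
  obtains C where "0 \<le> C" "\<And>\<phi>. \<phi> \<in> test_functions \<Omega> \<Longrightarrow> (\<integral>x. \<bar>\<phi> x\<bar> \<partial>\<sigma>) \<le> C * energy \<phi> powr (1 / p)"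
proof -
  obtain C where C: "\<And>\<phi>. \<phi> \<in> test_functions \<Omega> \<Longrightarrow> \<bar>\<integral>x. \<phi> x \<partial>\<sigma>\<bar> \<le> C * energy \<phi> powr (1 / p)"
    using dual unfolding in_dual_W01p_def energy_def by blast
  have "(\<integral>x. \<psi> x \<partial>\<sigma>) \<le> \<bar>C\<bar> * energy \<psi> powr (1 / p)" if "\<psi> \<in> test_functions \<Omega>" for \<psi>
  proof -
    have "(\<integral>x. \<psi> x \<partial>\<sigma>) \<le> C * energy \<psi> powr (1 / p)" using C[OF that] by linarith
    also have "\<dots> \<le> \<bar>C\<bar> * energy \<psi> powr (1 / p)" by (intro mult_right_mono) auto
    finally show ?thesis .
  qed
  then have "(\<integral>x. \<bar>\<phi> x\<bar> \<partial>\<sigma>) \<le> \<bar>C\<bar> * energy \<phi> powr (1 / p)" if "\<phi> \<in> test_functions \<Omega>" for \<phi>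
    using that by (intro dual_bound_abs) auto
  then show ?thesis using that[of "\<bar>C\<bar>"] by simp
qed

text \<open>The two terms of \<open>powr_shift_le\<close> are integrated separately: (I) bounds the
  critical part, duality the linear one. The number \<open>a\<close> is the value off the support: 1
  for \<open>exp z\<close>, and \<open>profile \<delta> K 0\<close> in the estimate of
  exponentials.\<close>

lemma \<sigma>_growth_bound:
  assumes \<eta>: "0 < \<eta>"
  obtains B where "0 \<le> B" "\<And>H a. H \<in> test_functions \<Omega> \<Longrightarrow> 0 \<le> a \<Longrightarrow> a \<le> 1 \<Longrightarrow> (\<And>x. 0 \<le> a + H x) \<Longrightarrow>
      (\<integral>x. (a + H x) powr p - a powr p \<partial>\<sigma>) \<le> (1 + \<eta>) * l * energy H + B * energy H powr (1 / p)"
proof -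
  obtain C where C: "0 \<le> C" "\<And>\<phi>. \<phi> \<in> test_functions \<Omega> \<Longrightarrow> (\<integral>x. \<bar>\<phi> x\<bar> \<partial>\<sigma>) \<le> C * energy \<phi> powr (1 / p)"
    by (rule dual_abs) blast
  obtain B where B: "B > 0" "\<And>a x. 0 \<le> a \<Longrightarrow> a \<le> 1 \<Longrightarrow> 0 \<le> a + x \<Longrightarrow>
       (a + x) powr p - a powr p \<le> (1 + \<eta>) * \<bar>x\<bar> powr p + B * \<bar>x\<bar>"
    by (rule powr_shift_le[OF p \<eta>]) blast
  have "(\<integral>x. (a + H x) powr p - a powr p \<partial>\<sigma>) \<le> (1 + \<eta>) * l * energy H + B * C * energy H powr (1 / p)"
    if H: "H \<in> test_functions \<Omega>" and a: "0 \<le> a" "a \<le> 1" "\<And>x. 0 \<le> a + H x" for H a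
  proof -
    note cont = smooth_imp_continuous[OF test_functions_smooth[OF H]]
    have i: "integrable \<sigma> (\<lambda>x. (a + H x) powr p - a powr p)"
      "integrable \<sigma> (\<lambda>x. \<bar>H x\<bar> powr p)" "integrable \<sigma> (\<lambda>x. \<bar>H x\<bar>)"
      using p a by (intro test_integrable'[OF H] continuous_intros continuous_on_powr' cont ballI; simp)+
    have "(\<integral>x. (a + H x) powr p - a powr p \<partial>\<sigma>) \<le> (\<integral>x. (1 + \<eta>) * \<bar>H x\<bar> powr p + B * \<bar>H x\<bar> \<partial>\<sigma>)"
      using i a by (intro integral_mono B) auto
    also have "\<dots> = (1 + \<eta>) * (\<integral>x. \<bar>H x\<bar> powr p \<partial>\<sigma>) + B * (\<integral>x. \<bar>H x\<bar> \<partial>\<sigma>)"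
      using i by (subst Bochner_Integration.integral_add) auto
    also have "\<dots> \<le> (1 + \<eta>) * (l * energy H) + B * (C * energy H powr (1 / p))"
      using ineq H \<eta> B(1) C(2)[OF H] unfolding ineq_I_def energy_def
      by (intro add_mono mult_left_mono) auto
    finally show ?thesis by (simp add: mult.assoc)
  qed
  then show ?thesis using that[of "B * C"] B(1) C(1) by simp
qed

text \<open>With \<open>v = exp z\<close>, the gradient part is the energy of the test function
  \<open>v - 1\<close>. In the other part \<open>v\<^sup>p\<close> is diminished by 1 to keep the
  integral finite, since \<open>\<sigma>\<close> may have infinite mass near the boundary.\<close>

definition J :: "('a \<Rightarrow> real) \<Rightarrow> real" where
  "J z = energy (\<lambda>x. exp (z x) - 1) - c * (\<integral>x. exp (p * z x) - 1 \<partial>\<sigma>)"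

lemma exp_test:
  assumes "z \<in> test_functions \<Omega>"
  shows "(\<lambda>x. exp (z x) - 1) \<in> test_functions \<Omega>"
  using test_functions_smooth[OF assms] by (intro test_functionsI[OF assms]) auto

lemma norm_grad_exp:
  assumes "z \<in> test_functions \<Omega>"
  shows "norm (grad (\<lambda>x. exp (z x) - 1) x) powr p = exp (p * z x) * norm (grad z x) powr p"
proof -
  have "grad (\<lambda>x. exp (z x) - 1) x = exp (z x) *\<^sub>R grad z x"
    by (rule grad_compose[OF test_functions_smooth[OF assms], where F = "\<lambda>s. exp s - 1"])
      (auto intro!: derivative_eq_intros)
  then show ?thesis by (simp add: powr_mult exp_powr_real mult.commute)
qed

lemma integrable_exp_\<sigma>:
  assumes z: "z \<in> test_functions \<Omega>"
  shows "integrable \<sigma> (\<lambda>x. exp (p * z x) - 1)"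
  by (intro test_integrable'[OF z] continuous_intros smooth_imp_continuous[OF test_functions_smooth[OF z]])
    simp

lemma integrable_weighted:
  assumes "z \<in> test_functions \<Omega>"
  shows "integrable \<mu> (\<lambda>x. exp (p * z x) * norm (grad z x) powr p)"
  using integrable_energy[OF exp_test[OF assms]] by (simp add: norm_grad_exp[OF assms])

lemma J_eq:
  assumes "z \<in> test_functions \<Omega>"
  shows "J z = (\<integral>x. exp (p * z x) * norm (grad z x) powr p \<partial>\<mu>)
    - c * (\<integral>x. exp (p * z x) - 1 \<partial>\<sigma>)"
  unfolding J_def energy_def by (simp add: norm_grad_exp[OF assms])

lemma J_coercive:
  obtains a M where "0 < a" "\<And>z. z \<in> test_functions \<Omega> \<Longrightarrow> a * energy (\<lambda>x. exp (z x) - 1) - M \<le> J z"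
proof -
  \<comment> \<open>The factor \<open>1 + \<eta>\<close> uses up half of the margin, which leaves
    \<open>a = (1 - c * l) / 2\<close>; half of \<open>a\<close> then absorbs the root term.\<close>
  define \<eta> where "\<eta> = (1 - c * l) / (2 * (c * l))"
  have \<eta>: "0 < \<eta>" using cl by (auto simp: \<eta>_def intro!: divide_pos_pos)
  define a where "a = 1 - (1 + \<eta>) * (c * l)"
  have "\<eta> * (c * l) = (1 - c * l) / 2" using c_pos l by (simp add: \<eta>_def)
  then have "a = (1 - c * l) / 2" by (simp add: a_def distrib_right)
  then have a: "0 < a" using cl by simp
  obtain B where B: "0 \<le> B" "\<And>H a. H \<in> test_functions \<Omega> \<Longrightarrow> 0 \<le> a \<Longrightarrow> a \<le> 1 \<Longrightarrow> (\<And>x. 0 \<le> a + H x) \<Longrightarrow>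
      (\<integral>x. (a + H x) powr p - a powr p \<partial>\<sigma>) \<le> (1 + \<eta>) * l * energy H + B * energy H powr (1 / p)"
    by (rule \<sigma>_growth_bound[OF \<eta>]) blast
  obtain M where M: "\<And>X. 0 \<le> X \<Longrightarrow> c * B * X powr (1 / p) \<le> a / 2 * X + M"
    using powr_root_absorb[OF p, of "a / 2" "c * B"] a B(1) c_pos by auto
  have "a / 2 * energy (\<lambda>x. exp (z x) - 1) - M \<le> J z" if z: "z \<in> test_functions \<Omega>" for z
  proof -
    let ?w = "\<lambda>x. exp (z x) - 1"
    have "(\<integral>x. exp (p * z x) - 1 \<partial>\<sigma>) = (\<integral>x. (1 + ?w x) powr p - 1 powr p \<partial>\<sigma>)"
      by (simp add: exp_powr_real mult.commute)
    also have "\<dots> \<le> (1 + \<eta>) * l * energy ?w + B * energy ?w powr (1 / p)"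
      by (rule B(2)[OF exp_test[OF z]]) auto
    finally have "c * (\<integral>x. exp (p * z x) - 1 \<partial>\<sigma>) \<le> c * ((1 + \<eta>) * l * energy ?w + B * energy ?w powr (1 / p))"
      using c_pos by (intro mult_left_mono) auto
    also have "\<dots> = (1 + \<eta>) * (c * l) * energy ?w + c * B * energy ?w powr (1 / p)" by (simp add: algebra_simps)
    also have "\<dots> \<le> (1 + \<eta>) * (c * l) * energy ?w + (a / 2 * energy ?w + M)"
      using M[OF energy_nonneg] by (intro add_left_mono)
    finally have "c * (\<integral>x. exp (p * z x) - 1 \<partial>\<sigma>) \<le> (1 + \<eta>) * (c * l) * energy ?w + (a / 2 * energy ?w + M)" .
    moreover have "(1 + \<eta>) * (c * l) * energy ?w = energy ?w - a * energy ?w"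
      by (simp add: a_def left_diff_distrib)
    ultimately show ?thesis by (simp add: J_def)
  qed
  then show ?thesis using that[of "a / 2" M] a by simp
qed

section \<open>Perturbations linear in the density \<open>exp (p * z x)\<close>\<close>

definition J_inf :: real where "J_inf = Inf (J ` test_functions \<Omega>)"

lemma J_bdd_below: "bdd_below (J ` test_functions \<Omega>)"
proof -
  obtain a M where aM: "0 < a" "\<And>z. z \<in> test_functions \<Omega> \<Longrightarrow> a * energy (\<lambda>x. exp (z x) - 1) - M \<le> J z"
    by (rule J_coercive) blast
  have "- M \<le> J z" if "z \<in> test_functions \<Omega>" for z
    using aM(2)[OF that] mult_nonneg_nonneg[OF less_imp_le[OF aM(1)] energy_nonneg] by (smt (verit))
  then show ?thesis by (intro bdd_belowI2)
qed

lemma J_inf_le: "z \<in> test_functions \<Omega> \<Longrightarrow> J_inf \<le> J z"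
  unfolding J_inf_def by (intro cINF_lower J_bdd_below)

text \<open>A perturbation of the density is carried back to the exponent. The logarithm vanishes
  wherever \<open>z\<close> and \<open>\<phi>\<close> both do, so the result is again a test
  function and hence an admissible competitor for \<open>J\<close>.\<close>

lemma ln_perturb_test:
  assumes z: "z \<in> test_functions \<Omega>" and \<phi>: "\<phi> \<in> test_functions \<Omega>"
    and pos: "\<And>x. 0 < exp (p * z x) + \<phi> x"
  defines "y \<equiv> \<lambda>x. ln (exp (p * z x) + \<phi> x) / p"
  shows "y \<in> test_functions \<Omega>" "exp (p * y x) = exp (p * z x) + \<phi> x"
    "grad y x = (1 / (exp (p * z x) + \<phi> x)) *\<^sub>R (exp (p * z x) *\<^sub>R grad z x + (1 / p) *\<^sub>R grad \<phi> x)"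
proof -
  note sz = test_functions_smooth[OF z] and s\<phi> = test_functions_smooth[OF \<phi>]
  have "smooth (\<lambda>x. (1 / p) * ln (exp (p * z x) + \<phi> x))"
    using sz s\<phi> pos by (intro smooth_mult smooth_ln smooth_add smooth_exp smooth_const)
  then have "smooth y" by (simp add: y_def)
  then show "y \<in> test_functions \<Omega>"
    by (rule test_functionsI2[OF z \<phi>]) (simp add: y_def)
  show "exp (p * y x) = exp (p * z x) + \<phi> x" using pos p by (simp add: y_def)
  have "GDERIV (\<lambda>x. exp (p * z x)) x :> (p * exp (p * z x)) *\<^sub>R grad z x"
    by (rule GDERIV_DERIV_compose[OF smooth_GDERIV[OF sz], where g = "\<lambda>s. exp (p * s)"])
      (auto intro!: derivative_eq_intros)
  from GDERIV_add[OF this smooth_GDERIV[OF s\<phi>]]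
  have "GDERIV (\<lambda>x. exp (p * z x) + \<phi> x) x :> (p * exp (p * z x)) *\<^sub>R grad z x + grad \<phi> x" .
  moreover have "((\<lambda>s. ln s / p) has_real_derivative 1 / (p * S)) (at S)" if "0 < S" for S
    using that p by (auto intro!: derivative_eq_intros simp: field_simps)
  ultimately have "GDERIV y x :> (1 / (p * (exp (p * z x) + \<phi> x))) *\<^sub>R ((p * exp (p * z x)) *\<^sub>R grad z x + grad \<phi> x)"
    unfolding y_def using pos[of x] by (intro GDERIV_DERIV_compose[where g = "\<lambda>s. ln s / p"])
  then have "grad y x = (1 / (p * (exp (p * z x) + \<phi> x))) *\<^sub>R ((p * exp (p * z x)) *\<^sub>R grad z x + grad \<phi> x)"
    by (rule grad_eqI)
  also have "\<dots> = (1 / (exp (p * z x) + \<phi> x)) *\<^sub>R (exp (p * z x) *\<^sub>R grad z x + (1 / p) *\<^sub>R grad \<phi> x)"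
    using p by (simp add: scaleR_add_right mult.commute)
  finally show "grad y x = (1 / (exp (p * z x) + \<phi> x)) *\<^sub>R (exp (p * z x) *\<^sub>R grad z x + (1 / p) *\<^sub>R grad \<phi> x)" .
qed

text \<open>\<open>J\<close> is convex in \<open>\<rho> = exp (p z)\<close>; the right-hand side is its derivative at \<open>\<rho> + \<phi>\<close>
  in direction \<open>\<phi>\<close>, with \<open>\<zeta> = \<nabla>(\<rho> + \<phi>) / (p (\<rho> + \<phi>))\<close>.\<close>

lemma almost_Euler_Lagrange:
  assumes z: "z \<in> test_functions \<Omega>" and \<phi>: "\<phi> \<in> test_functions \<Omega>"
    and pos: "\<And>x. 0 < exp (p * z x) + \<phi> x"
  defines "\<zeta> \<equiv> \<lambda>x. (1 / (exp (p * z x) + \<phi> x)) *\<^sub>R (exp (p * z x) *\<^sub>R grad z x + (1 / p) *\<^sub>R grad \<phi> x)"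
  shows "J_inf - J z \<le> (\<integral>x. norm (\<zeta> x) powr (p - 2) * (\<zeta> x \<bullet> grad \<phi> x)
      - (p - 1) * (norm (\<zeta> x) powr p * \<phi> x) \<partial>\<mu>) - c * (\<integral>x. \<phi> x \<partial>\<sigma>)"
proof -
  define y where "y x = ln (exp (p * z x) + \<phi> x) / p" for x
  note y = ln_perturb_test[OF z \<phi> pos, folded y_def]
  have \<zeta>: "grad y x = \<zeta> x" for x unfolding \<zeta>_def by (rule y(3))
  have gy: "grad y = \<zeta>" using \<zeta> by auto
  have \<zeta>m: "\<zeta> \<in> borel_measurable \<mu>" using grad_measurable[OF y(1)] gy by simp
  have \<zeta>i: "integrable \<mu> (\<lambda>x. norm (\<zeta> x) powr p)"
    using integrable_energy[OF y(1)] unfolding gy .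
  note fl = flux_integrable[OF \<zeta>m \<zeta>i \<phi>]
  have i\<phi>: "integrable \<sigma> \<phi>"
    by (intro test_integrable'[OF \<phi>] smooth_imp_continuous[OF test_functions_smooth[OF \<phi>]])
  \<comment> \<open>Tangent line of \<open>norm \<xi> powr p\<close> at \<open>\<zeta> x\<close>,
    evaluated at \<open>grad z x\<close> and multiplied by \<open>exp (p * z x)\<close>. Since the
    slope is taken at the perturbed point and not at \<open>z\<close>, it bounds the increment from
    above without a remainder.\<close>
  have ptw: "exp (p * y x) * norm (grad y x) powr p - exp (p * z x) * norm (grad z x) powr p
      \<le> norm (\<zeta> x) powr (p - 2) * (\<zeta> x \<bullet> grad \<phi> x) - (p - 1) * (norm (\<zeta> x) powr p * \<phi> x)" for x
  proof -
    let ?\<rho> = "exp (p * z x)" and ?N = "norm (\<zeta> x) powr (p - 2)"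
    have "(?\<rho> + \<phi> x) *\<^sub>R \<zeta> x = ?\<rho> *\<^sub>R grad z x + (1 / p) *\<^sub>R grad \<phi> x"
      using pos[of x] by (simp add: \<zeta>_def)
    then have "?\<rho> *\<^sub>R grad z x = (?\<rho> + \<phi> x) *\<^sub>R \<zeta> x - (1 / p) *\<^sub>R grad \<phi> x" by (simp add: algebra_simps)
    then have "?\<rho> * (\<zeta> x \<bullet> grad z x) = (?\<rho> + \<phi> x) * (\<zeta> x \<bullet> \<zeta> x) - (1 / p) * (\<zeta> x \<bullet> grad \<phi> x)"
      by (metis inner_diff_right inner_scaleR_right)
    moreover have NN: "?N * (\<zeta> x \<bullet> \<zeta> x) = norm (\<zeta> x) powr p"
      using powr_add[of "norm (\<zeta> x)" "p - 2" 2]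
      by (cases "\<zeta> x = 0") (auto simp: power2_norm_eq_inner[symmetric])
    ultimately have eq: "?\<rho> * (p * (?N * (\<zeta> x \<bullet> grad z x)))
        = p * (?\<rho> + \<phi> x) * norm (\<zeta> x) powr p - ?N * (\<zeta> x \<bullet> grad \<phi> x)"
    proof -
      assume a: "?\<rho> * (\<zeta> x \<bullet> grad z x) = (?\<rho> + \<phi> x) * (\<zeta> x \<bullet> \<zeta> x) - (1 / p) * (\<zeta> x \<bullet> grad \<phi> x)"
      have "?\<rho> * (p * (?N * (\<zeta> x \<bullet> grad z x))) = p * ?N * (?\<rho> * (\<zeta> x \<bullet> grad z x))" by simp
      also have "\<dots> = p * (?\<rho> + \<phi> x) * (?N * (\<zeta> x \<bullet> \<zeta> x)) - ?N * (\<zeta> x \<bullet> grad \<phi> x)"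
        unfolding a using p by (simp add: field_simps)
      finally show ?thesis unfolding NN .
    qed
    have "p * (?N * (\<zeta> x \<bullet> grad z x)) \<le> p * (?N * \<bar>\<zeta> x \<bullet> grad z x\<bar>)"
      using p by (intro mult_left_mono) auto
    also have "\<dots> \<le> (p - 1) * norm (\<zeta> x) powr p + norm (grad z x) powr p"
      using flux_bound[of 1 "\<zeta> x" "grad z x"] by simp
    finally have "?\<rho> * (p * (?N * (\<zeta> x \<bullet> grad z x))) \<le> ?\<rho> * ((p - 1) * norm (\<zeta> x) powr p + norm (grad z x) powr p)"
      by (intro mult_left_mono) auto
    then show ?thesis unfolding eq y(2) \<zeta> by (simp add: algebra_simps)
  qed
  have "J_inf - J z \<le> J y - J z" using J_inf_le[OF y(1)] by simp
  also have "\<dots> = (\<integral>x. exp (p * y x) * norm (grad y x) powr p - exp (p * z x) * norm (grad z x) powr p \<partial>\<mu>)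
      - c * (\<integral>x. (exp (p * y x) - 1) - (exp (p * z x) - 1) \<partial>\<sigma>)"
    using integrable_weighted[OF z] integrable_weighted[OF y(1)] integrable_exp_\<sigma>[OF z] integrable_exp_\<sigma>[OF y(1)]
    unfolding J_eq[OF y(1)] J_eq[OF z]
    by (subst (1 2) Bochner_Integration.integral_diff) (auto simp: algebra_simps)
  also have "(\<integral>x. (exp (p * y x) - 1) - (exp (p * z x) - 1) \<partial>\<sigma>) = (\<integral>x. \<phi> x \<partial>\<sigma>)"
    unfolding y(2) by simp
  also have "(\<integral>x. exp (p * y x) * norm (grad y x) powr p - exp (p * z x) * norm (grad z x) powr p \<partial>\<mu>)
      \<le> (\<integral>x. norm (\<zeta> x) powr (p - 2) * (\<zeta> x \<bullet> grad \<phi> x) - (p - 1) * (norm (\<zeta> x) powr p * \<phi> x) \<partial>\<mu>)"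
    by (intro integral_mono ptw) (use integrable_weighted[OF z] integrable_weighted[OF y(1)] fl in auto)
  finally show ?thesis by simp
qed

text \<open>The competitor has as its density the average of the densities of \<open>z\<close> and
  \<open>w\<close>. The \<open>\<sigma>\<close> part is affine in the density and contributes no
  error; the gradient part gains the defect with weight at least \<open>exp (- p)\<close>, which is
  where the lower bound \<open>- 1\<close> enters.\<close>

lemma J_midpoint:
  assumes z: "z \<in> test_functions \<Omega>" "\<And>x. -1 \<le> z x" and w: "w \<in> test_functions \<Omega>" "\<And>x. -1 \<le> w x"
  shows "integrable \<mu> (\<lambda>x. powr_defect p (grad z x) (grad w x))"
    and "exp (- p) * (\<integral>x. powr_defect p (grad z x) (grad w x) \<partial>\<mu>) \<le> (J z + J w) / 2 - J_inf"
proof -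
  define \<phi> where "\<phi> x = (exp (p * w x) - exp (p * z x)) / 2" for x
  have sm: "smooth (\<lambda>x. (1/2) * (exp (p * w x) - exp (p * z x)))"
    using test_functions_smooth[OF z(1)] test_functions_smooth[OF w(1)]
    by (intro smooth_mult smooth_const smooth_diff smooth_exp)
  moreover have "(\<lambda>x. (1/2) * (exp (p * w x) - exp (p * z x))) = \<phi>" by (auto simp: \<phi>_def)
  ultimately have "smooth \<phi>" by (simp only:)
  then have \<phi>: "\<phi> \<in> test_functions \<Omega>"
    by (intro test_functionsI2[OF z(1) w(1)]) (auto simp: \<phi>_def)
  have s: "exp (p * z x) + \<phi> x = (exp (p * z x) + exp (p * w x)) / 2" for x
    by (simp add: \<phi>_def field_simps)
  have pos: "0 < exp (p * z x) + \<phi> x" for x unfolding s by (simp add: add_pos_pos)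
  define y where "y x = ln (exp (p * z x) + \<phi> x) / p" for x
  note y = ln_perturb_test[OF z(1) \<phi> pos, folded y_def]
  have g\<phi>: "grad \<phi> x = (p / 2) *\<^sub>R (exp (p * w x) *\<^sub>R grad w x - exp (p * z x) *\<^sub>R grad z x)" for x
  proof -
    have e: "GDERIV (\<lambda>x. exp (p * v x)) x :> (p * exp (p * v x)) *\<^sub>R grad v x" if "v \<in> test_functions \<Omega>" for v
      by (rule GDERIV_DERIV_compose[OF smooth_GDERIV[OF test_functions_smooth[OF that]], where g = "\<lambda>s. exp (p * s)"])
        (auto intro!: derivative_eq_intros)
    have "GDERIV \<phi> x :> (1/2) *\<^sub>R ((p * exp (p * w x)) *\<^sub>R grad w x - (p * exp (p * z x)) *\<^sub>R grad z x)"
      unfolding \<phi>_def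
      by (rule GDERIV_DERIV_compose[OF GDERIV_diff[OF e[OF w(1)] e[OF z(1)]], where g = "\<lambda>s. s / 2"])
        (auto intro!: derivative_eq_intros)
    from grad_eqI[OF this] show ?thesis by (simp add: algebra_simps)
  qed
  have gy: "grad y x = (1 / (exp (p * z x) + exp (p * w x))) *\<^sub>R (exp (p * z x) *\<^sub>R grad z x + exp (p * w x) *\<^sub>R grad w x)" for x
  proof -
    have *: "exp (p * z x) *\<^sub>R grad z x + (1 / p) *\<^sub>R grad \<phi> x = (1/2) *\<^sub>R (exp (p * z x) *\<^sub>R grad z x + exp (p * w x) *\<^sub>R grad w x)"
    proof -
      have "(1 / p) *\<^sub>R grad \<phi> x = (1/2) *\<^sub>R (exp (p * w x) *\<^sub>R grad w x - exp (p * z x) *\<^sub>R grad z x)"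
        unfolding g\<phi> using p by simp
      moreover have "u + (1/2) *\<^sub>R (v - u) = (1/2) *\<^sub>R (u + v)" for u v :: 'a
      proof -
        have "u + (1/2) *\<^sub>R (v - u) = ((1/2) *\<^sub>R u + (1/2) *\<^sub>R u) + (1/2) *\<^sub>R (v - u)"
          by (simp flip: scaleR_left_distrib)
        also have "\<dots> = (1/2) *\<^sub>R (u + v)"
          by (simp only: scaleR_right_diff_distrib scaleR_right_distrib) simp
        finally show ?thesis .
      qed
      ultimately show ?thesis by simp
    qed
    have "(1 / (S / 2)) *\<^sub>R ((1/2) *\<^sub>R v) = (1 / S) *\<^sub>R v" for S and v :: 'a by simp
    then show ?thesis unfolding y(3) * s .
  qed
  define D where "D x = powr_defect p (grad z x) (grad w x)" for x
  have cont: "continuous_on UNIV (grad z)" "continuous_on UNIV (grad w)"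
    using z(1) w(1) by (auto intro: continuous_on_grad test_functions_smooth)
  have "integrable \<mu> (\<lambda>x. norm ((1/2) *\<^sub>R (grad z x + grad w x)) powr p)"
  proof -
    let ?v = "\<lambda>x. (1/2) * (z x + w x)"
    have v: "?v \<in> test_functions \<Omega>"
      by (intro test_functions_cmult test_functions_add z w)
    have "grad ?v x = (1/2) *\<^sub>R (grad z x + grad w x)" for x
      using z(1) w(1) by (intro grad_eqI GDERIV_DERIV_compose[OF GDERIV_add, where g = "\<lambda>s. (1/2) * s"])
        (auto intro!: derivative_eq_intros smooth_GDERIV test_functions_smooth)
    then show ?thesis using integrable_energy[OF v] by simp
  qed
  then show iD: "integrable \<mu> (\<lambda>x. powr_defect p (grad z x) (grad w x))"
    unfolding powr_defect_def using integrable_energy[OF z(1)] integrable_energy[OF w(1)] by auto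
  have ptw: "exp (p * y x) * norm (grad y x) powr p
    \<le> (exp (p * z x) * norm (grad z x) powr p + exp (p * w x) * norm (grad w x) powr p) / 2 - exp (- p) * D x" for x
  proof -
    have "p * (- 1) \<le> p * z x" "p * (- 1) \<le> p * w x"
      using p by (intro mult_left_mono z(2) w(2); simp)+
    then have "exp (- p) \<le> exp (p * z x)" "exp (- p) \<le> exp (p * w x)" by simp_all
    from weighted_powr_defect[OF p exp_gt_zero this, of "grad z x" "grad w x"]
    show ?thesis unfolding y(2) gy s D_def .
  qed
  note iz = integrable_weighted[OF z(1)] and iw = integrable_weighted[OF w(1)] and iy = integrable_weighted[OF y(1)]
  have "J_inf \<le> J y" by (rule J_inf_le[OF y(1)])
  also have "J y \<le> (\<integral>x. (exp (p * z x) * norm (grad z x) powr p + exp (p * w x) * norm (grad w x) powr p) / 2 - exp (- p) * D x \<partial>\<mu>)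
     - c * (\<integral>x. exp (p * y x) - 1 \<partial>\<sigma>)"
    unfolding J_eq[OF y(1)]
    by (intro diff_right_mono integral_mono ptw) (use iz iw iy iD in \<open>auto simp: D_def\<close>)
  also have "(\<integral>x. exp (p * y x) - 1 \<partial>\<sigma>) = (\<integral>x. ((exp (p * z x) - 1) + (exp (p * w x) - 1)) / 2 \<partial>\<sigma>)"
    unfolding y(2) s by (intro Bochner_Integration.integral_cong) (auto simp: field_simps)
  also have "\<dots> = ((\<integral>x. exp (p * z x) - 1 \<partial>\<sigma>) + (\<integral>x. exp (p * w x) - 1 \<partial>\<sigma>)) / 2"
    using integrable_exp_\<sigma>[OF z(1)] integrable_exp_\<sigma>[OF w(1)]
    by (subst Bochner_Integration.integral_add[symmetric]) auto
  also have "(\<integral>x. (exp (p * z x) * norm (grad z x) powr p + exp (p * w x) * norm (grad w x) powr p) / 2 - exp (- p) * D x \<partial>\<mu>)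
    = ((\<integral>x. exp (p * z x) * norm (grad z x) powr p \<partial>\<mu>) + (\<integral>x. exp (p * w x) * norm (grad w x) powr p \<partial>\<mu>)) / 2
      - exp (- p) * (\<integral>x. D x \<partial>\<mu>)"
    using iz iw iD by (simp add: D_def)
  finally show "exp (- p) * (\<integral>x. powr_defect p (grad z x) (grad w x) \<partial>\<mu>) \<le> (J z + J w) / 2 - J_inf"
    unfolding J_eq[OF z(1)] J_eq[OF w(1)] D_def by (simp add: field_simps)
qed

text \<open>Replacing \<open>exp z\<close> by a smooth version of \<open>max (exp z) 1\<close> does not increase the gradient term.\<close>

lemma J_truncate:
  assumes z: "z \<in> test_functions \<Omega>" and d: "0 < d"
  obtains y where "y \<in> test_functions \<Omega>" "\<And>x. - d \<le> y x" "J y \<le> J z + d"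
proof -
  obtain V where V: "0 < V" "\<And>x. \<bar>z x\<bar> \<le> V" using test_bounded[OF z] by blast
  define P where "P = p * exp V powr (p - 1)"
  have P: "0 < P" using p by (simp add: P_def)
  define m where "m = measure \<sigma> (closure {x. z x \<noteq> 0})"
  \<comment> \<open>The first entry gives \<open>1 - e / 2 \<ge> exp (- d)\<close>, hence the lower
    bound on \<open>y\<close>. The last one limits the loss in the \<open>\<sigma>\<close> term:
    \<open>P\<close> is a Lipschitz constant of \<open>s powr p\<close> on
    \<open>[0, exp V]\<close>, and \<open>m + 1\<close> is a positive substitute for
    \<open>m\<close>.\<close>
  define e where "e = min (2 * (1 - exp (- d))) (min 1 (d / (c * P * (m + 1))))"
  have m: "0 \<le> m" by (simp add: m_def)
  have e: "0 < e" "e \<le> 1" "e / 2 \<le> 1 - exp (- d)" "c * P * (m + 1) * e \<le> d"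
  proof -
    have cp: "0 < c * P * (m + 1)" using c_pos P m by simp
    show "0 < e" using d cp by (simp add: e_def)
    show "e \<le> 1" "e / 2 \<le> 1 - exp (- d)" by (auto simp: e_def)
    have "e \<le> d / (c * P * (m + 1))" by (simp add: e_def)
    then show "c * P * (m + 1) * e \<le> d" using cp by (simp add: pos_le_divide_eq mult.commute)
  qed
  \<comment> \<open>A smooth positive part: it stays within \<open>e / 2\<close> of
    \<open>max s 0\<close>, and its slope lies in \<open>[0, 1]\<close>, so gradients do not
    grow.\<close>
  define h where "h s = (s + soft_abs e s) / 2" for s
  have h: "s - e / 2 \<le> h s" "- e / 2 \<le> h s" "h 0 = 0" for s
    using soft_abs_bounds(1-3)[OF e(1), of s] soft_abs_bounds(4)[OF e(1)] by (auto simp: h_def)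
  define v where "v x = exp (z x) - 1" for x
  have v: "v \<in> test_functions \<Omega>" unfolding v_def by (rule exp_test[OF z])
  have sv: "smooth v" by (rule test_functions_smooth[OF v])
  have pos: "0 < 1 + h (v x)" for x using h(2)[of "v x"] e by linarith
  have "smooth (\<lambda>x. 1 + (1/2) * (v x + soft_abs e (v x)))"
    by (intro smooth_add smooth_mult smooth_const sv smooth_soft_abs e)
  then have sh: "smooth (\<lambda>x. 1 + h (v x))" by (simp add: h_def)
  define y where "y x = ln (1 + h (v x))" for x
  have y: "y \<in> test_functions \<Omega>"
  proof (rule test_functionsI[OF v])
    show "smooth y" unfolding y_def using sh pos by (rule smooth_ln)
    show "y x = 0" if "v x = 0" for x unfolding y_def that h(3) by simp
  qed
  have ey: "exp (y x) = 1 + h (v x)" for x using pos by (simp add: y_def)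
  have y_ge: "- d \<le> y x" for x
  proof -
    have "exp (- d) \<le> exp (y x)" unfolding ey using h(2)[of "v x"] e by linarith
    then show ?thesis by simp
  qed
  have "energy (\<lambda>x. exp (y x) - 1) \<le> energy v"
  proof (rule energy_mono[OF exp_test[OF y] v])
    fix x
    obtain q where q: "(soft_abs e has_real_derivative q) (at (v x))" "\<bar>q\<bar> \<le> 1"
      using soft_abs_deriv[OF e(1)] by blast
    have "grad (\<lambda>x. h (v x)) x = ((1 + q) / 2) *\<^sub>R grad v x"
      unfolding h_def
      by (rule grad_compose[OF sv, where F = "\<lambda>s. (s + soft_abs e s) / 2"])
        (auto intro!: derivative_eq_intros q)
    moreover have "(\<lambda>x. exp (y x) - 1) = (\<lambda>x. h (v x))" using ey by auto
    ultimately have "norm (grad (\<lambda>x. exp (y x) - 1) x) = \<bar>(1 + q) / 2\<bar> * norm (grad v x)" by simp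
    also have "\<dots> \<le> norm (grad v x)" using q(2) by (intro mult_left_le_one_le) auto
    finally show "norm (grad (\<lambda>x. exp (y x) - 1) x) \<le> norm (grad v x)" .
  qed
  moreover have "(\<integral>x. exp (p * z x) - 1 \<partial>\<sigma>) \<le> (\<integral>x. exp (p * y x) - 1 \<partial>\<sigma>) + (P * e) * m"
    unfolding m_def
  proof (rule integral_\<sigma>_le_add[OF z])
    note cz = smooth_imp_continuous[OF test_functions_smooth[OF z]] smooth_imp_continuous[OF test_functions_smooth[OF y]]
    show "continuous_on UNIV (\<lambda>x. exp (p * z x) - 1)" "continuous_on UNIV (\<lambda>x. exp (p * y x) - 1)"
      by (intro continuous_intros cz)+
    fix x
    show "exp (p * z x) - 1 = 0" if "z x = 0" using that by simp
    show "exp (p * y x) - 1 = 0" if "z x = 0" using that h(3) by (simp add: y_def v_def)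
    have "exp (p * z x) - exp (p * y x) = exp (z x) powr p - exp (y x) powr p"
      by (simp add: exp_powr_real mult.commute)
    also have "\<dots> \<le> p * exp (z x) powr (p - 1) * (exp (z x) - exp (y x))"
      using p by (intro powr_diff_le) auto
    also have "\<dots> \<le> p * exp (z x) powr (p - 1) * e"
      using h(1)[of "v x"] e p by (intro mult_left_mono) (auto simp: ey v_def)
    also have "\<dots> \<le> P * e"
      unfolding P_def using V(2)[of x] p e by (intro mult_right_mono mult_left_mono powr_mono2) auto
    finally show "exp (p * z x) - 1 \<le> exp (p * y x) - 1 + P * e" by simp
  qed
  then have "c * (\<integral>x. exp (p * z x) - 1 \<partial>\<sigma>) \<le> c * ((\<integral>x. exp (p * y x) - 1 \<partial>\<sigma>) + (P * e) * m)"
    using c_pos by (intro mult_left_mono) auto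
  ultimately have "J y \<le> J z + c * (P * e * m)"
    unfolding J_def v_def by (simp add: distrib_left)
  also have "c * (P * e * m) \<le> c * P * (m + 1) * e"
    using c_pos P e m by (simp add: algebra_simps)
  finally have "J y \<le> J z + d" using e by simp
  with y y_ge that show ?thesis by blast
qed

end

section \<open>Minimizing sequences\<close>

context p_laplace_problem
begin

lemma Poincare_energy:
  obtains C where "0 < C"
    "\<And>\<phi>. \<phi> \<in> test_functions \<Omega> \<Longrightarrow> integrable \<mu> (\<lambda>x. \<bar>\<phi> x\<bar> powr p)"
    "\<And>\<phi>. \<phi> \<in> test_functions \<Omega> \<Longrightarrow> (\<integral>x. \<bar>\<phi> x\<bar> powr p \<partial>\<mu>) \<le> C * energy \<phi>"
proof -
  obtain C where C: "0 < C" "\<And>\<phi>. \<phi> \<in> test_functions \<Omega> \<Longrightarrow>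
    (\<integral>\<^sup>+x. ennreal (\<bar>\<phi> x\<bar> powr p) \<partial>lborel) \<le> ennreal C * (\<integral>\<^sup>+x. ennreal (norm (grad \<phi> x) powr p) \<partial>lborel)"
    by (rule Poincare[OF bounded_\<Omega> p]) blast
  have main: "integrable \<mu> (\<lambda>x. \<bar>\<phi> x\<bar> powr p) \<and>
      (\<integral>x. \<bar>\<phi> x\<bar> powr p \<partial>\<mu>) \<le> C * energy \<phi>" if \<phi>: "\<phi> \<in> test_functions \<Omega>" for \<phi>
  proof -
    have sm: "smooth \<phi>" using \<phi> by (rule test_functions_smooth)
    have sub: "closure {x. \<phi> x \<noteq> 0} \<subseteq> \<Omega>" using \<phi> by (simp add: test_functions_def)
    have c1: "continuous_on UNIV (\<lambda>x. \<bar>\<phi> x\<bar> powr p)"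
      using p by (intro continuous_on_powr' continuous_intros smooth_imp_continuous[OF sm]) auto
    have c2: "continuous_on UNIV (\<lambda>x. norm (grad \<phi> x) powr p)"
      using p by (intro continuous_on_powr' continuous_on_norm continuous_on_grad[OF sm] continuous_on_const) auto
    have z1: "\<bar>\<phi> x\<bar> powr p = 0" if "x \<notin> closure {x. \<phi> x \<noteq> 0}" for x
      unfolding test_zero_off_support(1)[OF that] by simp
    have z2: "norm (grad \<phi> x) powr p = 0" if "x \<notin> closure {x. \<phi> x \<noteq> 0}" for x
      unfolding test_zero_off_support(2)[OF that] by simp
    note i1 = test_integrable(2)[OF \<phi> c1 z1] and i2 = test_integrable(2)[OF \<phi> c2 z2]
    note m1 = borel_measurable_continuous_onI[OF c1] and m2 = borel_measurable_continuous_onI[OF c2]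
    have o1: "\<bar>\<phi> x\<bar> powr p = 0" if "x \<notin> \<Omega>" for x using z1 sub that by blast
    have o2: "norm (grad \<phi> x) powr p = 0" if "x \<notin> \<Omega>" for x using z2 sub that by blast
    have e1: "(\<integral>x. \<bar>\<phi> x\<bar> powr p \<partial>\<mu>) = (\<integral>x. \<bar>\<phi> x\<bar> powr p \<partial>lborel)"
      "integrable lborel (\<lambda>x. \<bar>\<phi> x\<bar> powr p)"
      using integral_lebesgue_on_eq_lborel[OF open_\<Omega> m1 o1] i1 by blast+
    have e2: "energy \<phi> = (\<integral>x. norm (grad \<phi> x) powr p \<partial>lborel)"
      "integrable lborel (\<lambda>x. norm (grad \<phi> x) powr p)"
      using integral_lebesgue_on_eq_lborel[OF open_\<Omega> m2 o2] i2 unfolding energy_def by blast+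
    have "ennreal (\<integral>x. \<bar>\<phi> x\<bar> powr p \<partial>\<mu>) \<le> ennreal C * ennreal (energy \<phi>)"
      using C(2)[OF \<phi>] unfolding e1(1) e2(1)
      by (simp only: nn_integral_eq_integral[OF e1(2)] nn_integral_eq_integral[OF e2(2)] AE_I2 powr_ge_zero)
    also have "\<dots> = ennreal (C * energy \<phi>)"
      using C(1) energy_nonneg by (simp add: ennreal_mult)
    finally show ?thesis using i1 C(1) energy_nonneg[of \<phi>] by (simp add: ennreal_le_iff)
  qed
  then show ?thesis using that[of C] C(1) by blast
qed

end

context p_laplace_subcritical
begin

text \<open>The lower bound has two uses: \<open>exp (p * z k x) \<ge> exp (- p)\<close> turns the
  coercivity in \<open>exp z - 1\<close> into a bound on the energy of \<open>z k\<close> itself,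
  and its decay makes the limit nonnegative.\<close>

lemma minimizing_sequence:
  obtains z M where "\<And>k::nat. z k \<in> test_functions \<Omega>" "\<And>k x. - (1 / (real k + 1)) \<le> z k x"
    "\<And>k. J (z k) \<le> J_inf + 1 / (real k + 1)" "0 < M" "\<And>k. energy (z k) \<le> M"
proof -
  have "\<exists>y. y \<in> test_functions \<Omega> \<and> (\<forall>x. - (1 / (real k + 1)) \<le> y x) \<and> J y \<le> J_inf + 1 / (real k + 1)" for k
  proof -
    \<comment> \<open>Half of the tolerance goes into the choice of an almost minimizer, the other
      half into its truncation.\<close>
    define d where "d = 1 / (2 * (real k + 1))"
    have d: "0 < d" "d + d = 1 / (real k + 1)" by (auto simp: d_def field_simps)
    have "J_inf < J_inf + d" using d by simp
    then obtain z where z: "z \<in> test_functions \<Omega>" "J z < J_inf + d"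
      unfolding J_inf_def using cINF_less_iff[OF _ J_bdd_below] test_functions_zero by blast
    obtain y where y: "y \<in> test_functions \<Omega>" "\<And>x. - d \<le> y x" "J y \<le> J z + d"
      by (rule J_truncate[OF z(1) d(1)]) blast
    have "- (1 / (real k + 1)) \<le> y x" for x using y(2)[of x] d by linarith
    moreover have "J y \<le> J_inf + 1 / (real k + 1)" using y(3) z(2) d by linarith
    ultimately show ?thesis using y(1) by blast
  qed
  then obtain z where z: "\<And>k::nat. z k \<in> test_functions \<Omega>" "\<And>k x. - (1 / (real k + 1)) \<le> z k x"
    "\<And>k. J (z k) \<le> J_inf + 1 / (real k + 1)" by metis
  have z1: "- 1 \<le> z k x" for k x
  proof -
    have "1 / (real k + 1) \<le> 1" by simp
    then show ?thesis using z(2)[of k x] by linarith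
  qed
  obtain a M where aM: "0 < a" "\<And>z. z \<in> test_functions \<Omega> \<Longrightarrow> a * energy (\<lambda>x. exp (z x) - 1) - M \<le> J z"
    by (rule J_coercive) blast
  define M0 where "M0 = (J_inf + 1 + M) / a"
  have E: "energy (\<lambda>x. exp (z k x) - 1) \<le> M0" for k
  proof -
    have "1 / (real k + 1) \<le> 1" by simp
    then have "a * energy (\<lambda>x. exp (z k x) - 1) \<le> J_inf + 1 + M"
      using aM(2)[OF z(1), of k] z(3)[of k] by linarith
    then show ?thesis using aM(1) by (simp add: M0_def pos_le_divide_eq mult.commute)
  qed
  have E2: "energy (z k) \<le> exp p * M0" for k
  proof -
    have "energy (z k) \<le> (\<integral>x. exp p * (exp (p * z k x) * norm (grad (z k) x) powr p) \<partial>\<mu>)"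
      unfolding energy_def
    proof (rule integral_mono)
      fix x
      have "0 \<le> p * (1 + z k x)" using z1[of k x] p by simp
      then have "1 \<le> exp (p + p * z k x)" by (simp add: distrib_left)
      then have "1 * norm (grad (z k) x) powr p \<le> exp (p + p * z k x) * norm (grad (z k) x) powr p"
        by (intro mult_right_mono) auto
      then show "norm (grad (z k) x) powr p \<le> exp p * (exp (p * z k x) * norm (grad (z k) x) powr p)"
        by (simp add: exp_add)
    qed (use integrable_energy[OF z(1)] integrable_weighted[OF z(1)] in auto)
    also have "\<dots> = exp p * energy (\<lambda>x. exp (z k x) - 1)"
      unfolding energy_def by (simp add: norm_grad_exp[OF z(1)])
    also have "\<dots> \<le> exp p * M0" using E by (intro mult_left_mono) auto
    finally show ?thesis .
  qed
  have "exp p * M0 < \<bar>exp p * M0\<bar> + 1" by linarith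
  then have "energy (z k) \<le> \<bar>exp p * M0\<bar> + 1" for k using E2[of k] by linarith
  then show ?thesis
    using z by (intro that[of z "\<bar>exp p * M0\<bar> + 1"]) auto
qed

text \<open>Two almost minimizers have a small integrated defect by \<open>J_midpoint\<close>, which
  \<open>powr_defect_uniform\<close> converts into closeness of their gradients; the energy bound
  \<open>M\<close> controls the extra term there.\<close>

lemma minimizing_sequence_Cauchy:
  assumes z: "\<And>k::nat. z k \<in> test_functions \<Omega>" "\<And>k x. - 1 \<le> z k x"
    "\<And>k. J (z k) \<le> J_inf + 1 / (real k + 1)" and M: "0 < M" "\<And>k. energy (z k) \<le> M"
    and e: "0 < e"
  shows "\<exists>N. \<forall>k\<ge>N. \<forall>l\<ge>N. energy (\<lambda>x. z k x - z l x) \<le> e"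
proof -
  \<comment> \<open>Makes \<open>e' * (M + M)\<close> equal to \<open>e / 2\<close>; the index
    \<open>N\<close> is chosen so that the defect term fits into the other half.\<close>
  define e' where "e' = e / (4 * M)"
  have e': "0 < e'" using e M by (simp add: e'_def)
  obtain C where C: "C > 0" and
    Cle: "\<And>a b :: 'a. norm (a - b) powr p \<le> e' * (norm a powr p + norm b powr p) + C * powr_defect p a b"
    by (rule powr_defect_uniform[OF p e', where 'b = 'a]) blast
  obtain N where N: "2 * C * exp p / e < real N" using reals_Archimedean2 by blast
  have "energy (\<lambda>x. z k x - z l x) \<le> e" if kl: "k \<ge> N" "l \<ge> N" for k l
  proof -
    let ?D = "\<lambda>x. powr_defect p (grad (z k) x) (grad (z l) x)"
    have d: "(\<lambda>x. z k x - z l x) \<in> test_functions \<Omega>" by (intro test_functions_diff z)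
    have gd: "grad (\<lambda>x. z k x - z l x) x = grad (z k) x - grad (z l) x" for x
      by (rule grad_diff[OF test_functions_smooth[OF z(1)] test_functions_smooth[OF z(1)]])
    note iD = J_midpoint(1)[OF z(1,2) z(1,2), of k l]
    note ik = integrable_energy[OF z(1)]
    have "energy (\<lambda>x. z k x - z l x) \<le>
      (\<integral>x. e' * (norm (grad (z k) x) powr p + norm (grad (z l) x) powr p) + C * ?D x \<partial>\<mu>)"
      unfolding energy_def using integrable_energy[OF d] ik iD Cle gd
      by (intro integral_mono) auto
    also have "\<dots> = e' * (energy (z k) + energy (z l)) + C * (\<integral>x. ?D x \<partial>\<mu>)"
      unfolding energy_def using ik iD by simp
    also have "\<dots> \<le> e' * (M + M) + C * (exp p / (real N + 1))"
    proof (intro add_mono mult_left_mono M)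
      have "exp (- p) * (\<integral>x. ?D x \<partial>\<mu>) \<le> (J (z k) + J (z l)) / 2 - J_inf"
        by (rule J_midpoint(2)[OF z(1,2) z(1,2)])
      also have "\<dots> \<le> (1 / (real k + 1) + 1 / (real l + 1)) / 2" using z(3)[of k] z(3)[of l] by argo
      also have "\<dots> \<le> (1 / (real N + 1) + 1 / (real N + 1)) / 2"
        using kl by (intro divide_right_mono add_mono divide_left_mono) auto
      also have "\<dots> = 1 / (real N + 1)" by (simp only: add_divide_distrib field_sum_of_halves)
      finally have "exp p * (exp (- p) * (\<integral>x. ?D x \<partial>\<mu>)) \<le> exp p * (1 / (real N + 1))"
        by (intro mult_left_mono) auto
      then show "(\<integral>x. ?D x \<partial>\<mu>) \<le> exp p / (real N + 1)"
        by (simp flip: mult.assoc exp_add)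
    qed (use e' C in auto)
    also have "\<dots> \<le> e / 2 + e / 2"
    proof (intro add_mono)
      show "e' * (M + M) \<le> e / 2" using M by (simp add: e'_def field_simps)
      have "2 * C * exp p < e * real N" using N e by (simp add: pos_divide_less_eq mult.commute)
      then have "2 * C * exp p \<le> e * (real N + 1)" using e by (simp add: distrib_left)
      then show "C * (exp p / (real N + 1)) \<le> e / 2" by (simp add: field_simps)
    qed
    finally show ?thesis by simp
  qed
  then show ?thesis by blast
qed

lemma limit_exists:
  obtains z e u g G where
    "\<And>j::nat. z j \<in> test_functions \<Omega>" "\<And>j x. - 1 \<le> z j x"
    "\<And>j. J (z j) \<le> J_inf + e j" "\<And>j. 0 < e j" "e \<longlonglongrightarrow> 0"
    "u \<in> borel_measurable \<mu>" "g \<in> borel_measurable \<mu>"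
    "integrable \<mu> G"
    "AE x in \<mu>. (\<lambda>j. z j x) \<longlonglongrightarrow> u x"
    "AE x in \<mu>. (\<lambda>j. grad (z j) x) \<longlonglongrightarrow> g x"
    "\<And>j. AE x in \<mu>. \<bar>z j x\<bar> powr p \<le> G x"
    "\<And>j. AE x in \<mu>. norm (grad (z j) x) powr p \<le> G x"
    "AE x in \<mu>. 0 \<le> u x"
proof -
  obtain z M where z: "\<And>k::nat. z k \<in> test_functions \<Omega>" "\<And>k x. - (1 / (real k + 1)) \<le> z k x"
    "\<And>k. J (z k) \<le> J_inf + 1 / (real k + 1)" and M: "0 < M" "\<And>k. energy (z k) \<le> M"
    by (rule minimizing_sequence) blast
  have z1: "- 1 \<le> z k x" for k x
  proof -
    have "1 / (real k + 1) \<le> 1" by simp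
    then show ?thesis using z(2)[of k x] by linarith
  qed
  obtain C where C: "0 < C"
    "\<And>\<phi>. \<phi> \<in> test_functions \<Omega> \<Longrightarrow> integrable \<mu> (\<lambda>x. \<bar>\<phi> x\<bar> powr p)"
    "\<And>\<phi>. \<phi> \<in> test_functions \<Omega> \<Longrightarrow> (\<integral>x. \<bar>\<phi> x\<bar> powr p \<partial>\<mu>) \<le> C * energy \<phi>"
    by (rule Poincare_energy) blast
  \<comment> \<open>Pairing values with gradients yields one subsequence and one majorant
    \<open>G\<close> for both. The values are Cauchy by Poincare's inequality.\<close>
  define f where "f k x = (z k x, grad (z k) x)" for k x
  have fm: "f k \<in> borel_measurable \<mu>" for k
    unfolding f_def using test_measurable[OF z(1)] grad_measurable[OF z(1)]
    by (intro borel_measurable_Pair) auto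
  have pair: "norm (a, b) powr p \<le> 2 powr p * (\<bar>a\<bar> powr p + norm b powr p)" for a :: real and b :: 'a
  proof -
    have "norm (a, b) powr p \<le> (norm a + norm b) powr p"
      using p norm_Pair_le[of a b] by (intro powr_mono2) auto
    also have "\<dots> \<le> 2 powr p * (\<bar>a\<bar> powr p + norm b powr p)" using p powr_add_le[of "\<bar>a\<bar>" "norm b" p] by simp
    finally show ?thesis .
  qed
  have pair_int: "integrable \<mu> (\<lambda>x. norm (\<phi> x, grad \<phi> x) powr p) \<and>
      (\<integral>x. norm (\<phi> x, grad \<phi> x) powr p \<partial>\<mu>) \<le> 2 powr p * (C + 1) * energy \<phi>"
    if \<phi>: "\<phi> \<in> test_functions \<Omega>" for \<phi>
  proof -
    have [measurable]: "(\<lambda>x. (\<phi> x, grad \<phi> x)) \<in> borel_measurable \<mu>"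
      using test_measurable[OF \<phi>] grad_measurable[OF \<phi>] by (intro borel_measurable_Pair) auto
    have i: "integrable \<mu> (\<lambda>x. 2 powr p * (\<bar>\<phi> x\<bar> powr p + norm (grad \<phi> x) powr p))"
      using C(2)[OF \<phi>] integrable_energy[OF \<phi>] by auto
    have int: "integrable \<mu> (\<lambda>x. norm (\<phi> x, grad \<phi> x) powr p)"
    proof (rule Bochner_Integration.integrable_bound[OF i])
      show "AE x in \<mu>. norm (norm (\<phi> x, grad \<phi> x) powr p)
        \<le> norm (2 powr p * (\<bar>\<phi> x\<bar> powr p + norm (grad \<phi> x) powr p))"
        using pair by (intro AE_I2) (auto simp: abs_of_nonneg)
    qed measurable
    have "(\<integral>x. norm (\<phi> x, grad \<phi> x) powr p \<partial>\<mu>)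
        \<le> (\<integral>x. 2 powr p * (\<bar>\<phi> x\<bar> powr p + norm (grad \<phi> x) powr p) \<partial>\<mu>)"
      by (intro integral_mono int i pair)
    also have "\<dots> = 2 powr p * ((\<integral>x. \<bar>\<phi> x\<bar> powr p \<partial>\<mu>) + energy \<phi>)"
      unfolding energy_def using C(2)[OF \<phi>] integrable_energy[OF \<phi>] by simp
    also have "\<dots> \<le> 2 powr p * (C * energy \<phi> + energy \<phi>)"
      using C(3)[OF \<phi>] by (intro mult_left_mono add_right_mono) auto
    finally show ?thesis using int by (simp add: algebra_simps)
  qed
  have fi: "integrable \<mu> (\<lambda>x. norm (f k x) powr p)" for k
    using pair_int[OF z(1)[of k]] by (simp add: f_def)
  have fC: "\<exists>N. \<forall>k\<ge>N. \<forall>l\<ge>N. (\<integral>x. norm (f k x - f l x) powr p \<partial>\<mu>) \<le> e" if e: "0 < e" for e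
  proof -
    have q: "0 < e / (2 powr p * (C + 1))" using e C(1) by simp
    obtain N where N: "\<And>k l. k \<ge> N \<Longrightarrow> l \<ge> N \<Longrightarrow> energy (\<lambda>x. z k x - z l x) \<le> e / (2 powr p * (C + 1))"
      using minimizing_sequence_Cauchy[OF z(1) z1 z(3) M q] by blast
    have "(\<integral>x. norm (f k x - f l x) powr p \<partial>\<mu>) \<le> e" if "k \<ge> N" "l \<ge> N" for k l
    proof -
      let ?d = "\<lambda>x. z k x - z l x"
      have d: "?d \<in> test_functions \<Omega>" by (intro test_functions_diff z)
      have "f k x - f l x = (?d x, grad ?d x)" for x
        using grad_diff[OF test_functions_smooth[OF z(1)] test_functions_smooth[OF z(1)]] by (simp add: f_def)
      then have "(\<integral>x. norm (f k x - f l x) powr p \<partial>\<mu>) \<le> 2 powr p * (C + 1) * energy ?d"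
        using pair_int[OF d] by simp
      also have "\<dots> \<le> 2 powr p * (C + 1) * (e / (2 powr p * (C + 1)))"
        using N that C(1) by (intro mult_left_mono) auto
      also have "\<dots> = e" using C(1) by simp
      finally show ?thesis .
    qed
    then show ?thesis by blast
  qed
  obtain r h G where r: "strict_mono (r :: nat \<Rightarrow> nat)" and hG: "h \<in> borel_measurable \<mu>"
    "integrable \<mu> G"
    "AE x in \<mu>. (\<lambda>j. f (r j) x) \<longlonglongrightarrow> h x"
    "AE x in \<mu>. \<forall>j. norm (f (r j) x) powr p \<le> G x"
    by (rule Lp_Cauchy_subsequence[OF p fm fi fC]) blast
  define e where "e j = 1 / (real (r j) + 1)" for j
  have e0: "e \<longlonglongrightarrow> 0"
  proof -
    have "(\<lambda>n. 1 / (real n + 1)) \<longlonglongrightarrow> 0"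
      using LIMSEQ_inverse_real_of_nat by (simp add: inverse_eq_divide add.commute)
    from LIMSEQ_subseq_LIMSEQ[OF this r] show ?thesis by (simp add: e_def[abs_def] o_def)
  qed
  have le: "\<bar>z (r j) x\<bar> powr p \<le> norm (f (r j) x) powr p" "norm (grad (z (r j)) x) powr p \<le> norm (f (r j) x) powr p" for j x
    using p norm_fst_le[of "z (r j) x" "grad (z (r j)) x"] norm_snd_le[of "grad (z (r j)) x" "z (r j) x"]
    by (auto intro!: powr_mono2 simp: f_def)
  have lim: "AE x in \<mu>. (\<lambda>j. z (r j) x) \<longlonglongrightarrow> fst (h x)"
    using hG(3) by eventually_elim (drule tendsto_fst, simp add: f_def)
  show ?thesis
  proof (rule that[of "\<lambda>j. z (r j)" e "\<lambda>x. fst (h x)" "\<lambda>x. snd (h x)" G])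
    show "AE x in \<mu>. (\<lambda>j. z (r j) x) \<longlonglongrightarrow> fst (h x)" by (rule lim)
    show "AE x in \<mu>. (\<lambda>j. grad (z (r j)) x) \<longlonglongrightarrow> snd (h x)"
      using hG(3) by eventually_elim (drule tendsto_snd, simp add: f_def)
    show "AE x in \<mu>. \<bar>z (r j) x\<bar> powr p \<le> G x" for j
      using hG(4) by eventually_elim (use le(1) in \<open>blast intro: order_trans\<close>)
    show "AE x in \<mu>. norm (grad (z (r j)) x) powr p \<le> G x" for j
      using hG(4) by eventually_elim (use le(2) in \<open>blast intro: order_trans\<close>)
    show "(\<lambda>x. fst (h x)) \<in> borel_measurable \<mu>" "(\<lambda>x. snd (h x)) \<in> borel_measurable \<mu>"
      using hG(1) by (auto simp: borel_prod[symmetric])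
    show "AE x in \<mu>. 0 \<le> fst (h x)"
      using lim
    proof eventually_elim
      case (elim x)
      have "(\<lambda>j. - e j) \<longlonglongrightarrow> 0" using tendsto_minus[OF e0] by simp
      moreover have "- e j \<le> z (r j) x" for j using z(2)[of "r j" x] by (simp add: e_def)
      ultimately show ?case using elim by (intro LIMSEQ_le[of "\<lambda>j. - e j" 0 "\<lambda>j. z (r j) x"]) auto
    qed
  qed (use z z1 e0 hG(2) in \<open>auto simp: e_def\<close>)
qed

end

section \<open>The limit equation\<close>

locale p_laplace_minimizer = p_laplace_subcritical +
  fixes z :: "nat \<Rightarrow> 'a \<Rightarrow> real" and e :: "nat \<Rightarrow> real"
    and u :: "'a \<Rightarrow> real" and g :: "'a \<Rightarrow> 'a" and G :: "'a \<Rightarrow> real"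
  assumes z_test: "\<And>j. z j \<in> test_functions \<Omega>" and z_ge: "\<And>j x. - 1 \<le> z j x"
    and J_z: "\<And>j. J (z j) \<le> J_inf + e j" and e_pos: "\<And>j. 0 < e j" and e_tendsto: "e \<longlonglongrightarrow> 0"
    and u_meas [measurable]: "u \<in> borel_measurable \<mu>"
    and g_meas [measurable]: "g \<in> borel_measurable \<mu>"
    and G_int: "integrable \<mu> G"
    and z_lim: "AE x in \<mu>. (\<lambda>j. z j x) \<longlonglongrightarrow> u x"
    and grad_lim: "AE x in \<mu>. (\<lambda>j. grad (z j) x) \<longlonglongrightarrow> g x"
    and z_dom: "\<And>j. AE x in \<mu>. \<bar>z j x\<bar> powr p \<le> G x"
    and grad_dom: "\<And>j. AE x in \<mu>. norm (grad (z j) x) powr p \<le> G x"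
    and u_nonneg: "AE x in \<mu>. 0 \<le> u x"
begin

lemma g_int: "integrable \<mu> (\<lambda>x. norm (g x) powr p)"
  by (rule Lp_dominated_convergence(1)[OF p grad_measurable[OF z_test] g_meas G_int grad_lim grad_dom])

text \<open>In \<open>almost_Euler_Lagrange\<close> for the perturbation \<open>t * \<phi>\<close>,
  division by \<open>t\<close> leaves the error \<open>e j / t\<close>, while the gradient is
  disturbed to order \<open>t\<close>. The choice \<open>t = sqrt (e j)\<close> sends both to
  0.\<close>

lemma Euler_Lagrange_ge:
  assumes \<phi>: "\<phi> \<in> test_functions \<Omega>"
  shows "0 \<le> (\<integral>x. norm (g x) powr (p - 2) * (g x \<bullet> grad \<phi> x)
      - (p - 1) * (norm (g x) powr p * \<phi> x) \<partial>\<mu>) - c * (\<integral>x. \<phi> x \<partial>\<sigma>)"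
proof -
  obtain B where B: "0 < B" "\<And>x. \<bar>\<phi> x\<bar> \<le> B" "\<And>x. norm (grad \<phi> x) \<le> B"
    using test_bounded[OF \<phi>] by blast
  have sq0: "(\<lambda>j. sqrt (e j)) \<longlonglongrightarrow> 0" using tendsto_real_sqrt[OF e_tendsto] by simp
  have "eventually (\<lambda>j. sqrt (e j) < exp (- p) / (2 * B)) sequentially"
    using B by (intro order_tendstoD(2)[OF sq0]) auto
  then obtain N where N: "\<And>j. j \<ge> N \<Longrightarrow> sqrt (e j) < exp (- p) / (2 * B)"
    by (auto simp: eventually_sequentially)
  \<comment> \<open>After the shift by \<open>N\<close>, \<open>t j * B\<close> is at most half the
    lower bound \<open>exp (- p)\<close> of the density, so the perturbed density is at least half
    the original one.\<close>
  define t where "t j = sqrt (e (j + N))" for j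
  define y where "y j = z (j + N)" for j
  have t0: "t \<longlonglongrightarrow> 0" unfolding t_def by (rule LIMSEQ_ignore_initial_segment[OF sq0])
  have t: "0 < t j" "t j * B \<le> exp (- p) / 2" for j
    using N[of "j + N"] B(1) e_pos[of "j + N"] by (auto simp: t_def field_simps)
  have y: "y j \<in> test_functions \<Omega>" for j unfolding y_def by (rule z_test)
  have \<rho>: "exp (- p) \<le> exp (p * y j x)" for j x
  proof -
    have "p * (- 1) \<le> p * y j x" unfolding y_def using p by (intro mult_left_mono z_ge) simp
    then show ?thesis by simp
  qed
  have half: "exp (p * y j x) / 2 \<le> exp (p * y j x) + t j * \<phi> x" for j x
  proof -
    have "\<bar>t j * \<phi> x\<bar> \<le> t j * B" using t(1)[of j] B(2)[of x] by (simp add: abs_mult mult_left_mono)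
    then show ?thesis using t(2)[of j] \<rho>[of j x] by linarith
  qed
  then have pos: "0 < exp (p * y j x) + t j * \<phi> x" for j x
    by (rule less_le_trans[rotated]) simp
  define \<zeta> where "\<zeta> j x = (1 / (exp (p * y j x) + t j * \<phi> x)) *\<^sub>R
      (exp (p * y j x) *\<^sub>R grad (y j) x + (1 / p) *\<^sub>R (t j *\<^sub>R grad \<phi> x))" for j x
  define F where "F \<xi> x = norm \<xi> powr (p - 2) * (\<xi> \<bullet> grad \<phi> x) - (p - 1) * (norm \<xi> powr p * \<phi> x)" for \<xi> x
  define A where "A j = (\<integral>x. F (\<zeta> j x) x \<partial>\<mu>) - c * (\<integral>x. \<phi> x \<partial>\<sigma>)" for j
  have A: "- t j \<le> A j" for j
  proof -
    have gt: "grad (\<lambda>x. t j * \<phi> x) x = t j *\<^sub>R grad \<phi> x" for x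
      by (rule grad_cmult[OF test_functions_smooth[OF \<phi>]])
    have "- (t j * t j) = - e (j + N)" using e_pos[of "j + N"] by (simp add: t_def)
    also have "\<dots> \<le> J_inf - J (y j)" using J_z[of "j + N"] by (simp add: y_def)
    also have "\<dots> \<le> (\<integral>x. t j * F (\<zeta> j x) x \<partial>\<mu>) - c * (\<integral>x. t j * \<phi> x \<partial>\<sigma>)"
      using almost_Euler_Lagrange[OF y test_functions_cmult[OF \<phi>] pos, of j]
      unfolding gt \<zeta>_def[symmetric] F_def by (simp add: algebra_simps)
    also have "\<dots> = t j * A j" by (simp add: A_def right_diff_distrib)
    finally have "t j * (- t j) \<le> t j * A j" by simp
    then show ?thesis using t(1)[of j] by (simp only: mult_le_cancel_left_pos)
  qed
  have cont: "continuous_on UNIV (grad \<phi>)" "continuous_on UNIV \<phi>"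
    using \<phi> by (auto intro: continuous_on_grad smooth_imp_continuous test_functions_smooth)
  have [measurable]: "\<zeta> j \<in> borel_measurable \<mu>" for j
    unfolding \<zeta>_def using test_measurable[OF y] test_measurable[OF \<phi>] grad_measurable[OF y] grad_measurable[OF \<phi>]
    by measurable
  have Fm: "(\<lambda>x. F (h x) x) \<in> borel_measurable \<mu>" if [measurable]: "h \<in> borel_measurable \<mu>" for h
    unfolding F_def using test_measurable[OF \<phi>] grad_measurable[OF \<phi>] by measurable
  have F_bound: "\<bar>F \<xi> x\<bar> \<le> B + p * B * norm \<xi> powr p" for \<xi> x
  proof -
    have "\<bar>norm \<xi> powr (p - 2) * (\<xi> \<bullet> grad \<phi> x)\<bar> \<le> norm (norm \<xi> powr (p - 2) *\<^sub>R \<xi>) * norm (grad \<phi> x)"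
      using Cauchy_Schwarz_ineq2[of "norm \<xi> powr (p - 2) *\<^sub>R \<xi>" "grad \<phi> x"] by simp
    also have "\<dots> \<le> (1 + norm \<xi> powr p) * B"
      unfolding norm_norm_powr_scaleR by (intro mult_mono powr_pred_le p B) auto
    finally have 1: "\<bar>norm \<xi> powr (p - 2) * (\<xi> \<bullet> grad \<phi> x)\<bar> \<le> (1 + norm \<xi> powr p) * B" .
    have "\<bar>(p - 1) * (norm \<xi> powr p * \<phi> x)\<bar> = (p - 1) * (norm \<xi> powr p * \<bar>\<phi> x\<bar>)"
      using p by (simp add: abs_mult)
    also have "\<dots> \<le> (p - 1) * (norm \<xi> powr p * B)" using p B by (intro mult_left_mono) auto
    finally have 2: "\<bar>(p - 1) * (norm \<xi> powr p * \<phi> x)\<bar> \<le> (p - 1) * (norm \<xi> powr p * B)" .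
    have "(1 + norm \<xi> powr p) * B + (p - 1) * (norm \<xi> powr p * B) = B + p * B * norm \<xi> powr p"
      by (simp add: algebra_simps)
    then show ?thesis unfolding F_def using 1 2 by linarith
  qed
  \<comment> \<open>As the density at most halves and \<open>t j * B\<close> is at most half of it,
    \<open>\<zeta> j\<close> is bounded in terms of \<open>grad (y j)\<close> alone, whose powers
    have the majorant \<open>G\<close>.\<close>
  have \<zeta>_bound: "norm (\<zeta> j x) powr p \<le> 2 powr p * (2 powr p * norm (grad (y j) x) powr p + 1)" for j x
  proof -
    let ?\<rho> = "exp (p * y j x)"
    have "norm (?\<rho> *\<^sub>R grad (y j) x + (1 / p) *\<^sub>R (t j *\<^sub>R grad \<phi> x))
        \<le> norm (?\<rho> *\<^sub>R grad (y j) x) + norm ((1 / p) *\<^sub>R (t j *\<^sub>R grad \<phi> x))"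
      by (rule norm_triangle_ineq)
    also have "norm ((1 / p) *\<^sub>R (t j *\<^sub>R grad \<phi> x)) \<le> t j * B"
    proof -
      have "norm ((1 / p) *\<^sub>R (t j *\<^sub>R grad \<phi> x)) = (1 / p) * (t j * norm (grad \<phi> x))"
        using p t(1)[of j] by simp
      also have "\<dots> \<le> 1 * (t j * B)" using p t(1)[of j] B by (intro mult_mono) auto
      finally show ?thesis by simp
    qed
    also have "\<dots> \<le> ?\<rho> / 2" using t(2)[of j] \<rho>[of j x] by linarith
    finally have "norm (?\<rho> *\<^sub>R grad (y j) x + (1 / p) *\<^sub>R (t j *\<^sub>R grad \<phi> x)) \<le> ?\<rho> / 2 * (2 * norm (grad (y j) x) + 1)"
      by (simp add: algebra_simps)
    also have "\<dots> \<le> (?\<rho> + t j * \<phi> x) * (2 * norm (grad (y j) x) + 1)"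
      by (intro mult_right_mono half) simp
    finally have "norm (\<zeta> j x) \<le> 2 * norm (grad (y j) x) + 1"
      using pos[of j x] by (simp add: \<zeta>_def pos_divide_le_eq mult.commute)
    then have "norm (\<zeta> j x) powr p \<le> (2 * norm (grad (y j) x) + 1) powr p" using p by (intro powr_mono2) auto
    also have "\<dots> \<le> 2 powr p * ((2 * norm (grad (y j) x)) powr p + 1 powr p)"
      using p by (intro powr_add_le) auto
    finally show ?thesis by (simp add: powr_mult)
  qed
  have lim: "(\<lambda>j. \<integral>x. F (\<zeta> j x) x \<partial>\<mu>) \<longlonglongrightarrow> (\<integral>x. F (g x) x \<partial>\<mu>)"
  proof (rule integral_dominated_convergence)
    show "integrable \<mu> (\<lambda>x. B + p * B * (2 powr p * (2 powr p * G x + 1)))"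
      using G_int by auto
    show "AE x in \<mu>. norm (F (\<zeta> j x) x) \<le> B + p * B * (2 powr p * (2 powr p * G x + 1))" for j
      using grad_dom[of "j + N"]
    proof eventually_elim
      case (elim x)
      have "norm (F (\<zeta> j x) x) \<le> B + p * B * norm (\<zeta> j x) powr p" using F_bound by simp
      also have "\<dots> \<le> B + p * B * (2 powr p * (2 powr p * norm (grad (y j) x) powr p + 1))"
        using B p \<zeta>_bound by (intro add_left_mono mult_left_mono) auto
      also have "\<dots> \<le> B + p * B * (2 powr p * (2 powr p * G x + 1))"
        using B p elim by (intro add_left_mono mult_left_mono add_right_mono) (auto simp: y_def)
      finally show ?case .
    qed
    show "AE x in \<mu>. (\<lambda>j. F (\<zeta> j x) x) \<longlonglongrightarrow> F (g x) x"
      using z_lim grad_lim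
    proof eventually_elim
      case (elim x)
      have yl: "(\<lambda>j. y j x) \<longlonglongrightarrow> u x" "(\<lambda>j. grad (y j) x) \<longlonglongrightarrow> g x"
        unfolding y_def using elim by (auto intro: LIMSEQ_ignore_initial_segment)
      have "(\<lambda>j. \<zeta> j x) \<longlonglongrightarrow> (1 / (exp (p * u x) + 0 * \<phi> x)) *\<^sub>R
          (exp (p * u x) *\<^sub>R g x + (1 / p) *\<^sub>R (0 *\<^sub>R grad \<phi> x))"
        unfolding \<zeta>_def by (intro tendsto_intros yl t0) simp
      then have \<zeta>l: "(\<lambda>j. \<zeta> j x) \<longlonglongrightarrow> g x" by simp
      have "(\<lambda>j. norm (\<zeta> j x) powr (p - 2) *\<^sub>R \<zeta> j x) \<longlonglongrightarrow> norm (g x) powr (p - 2) *\<^sub>R g x"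
        using isCont_tendsto_compose[OF isCont_norm_powr_scaleR[OF p] \<zeta>l] .
      from tendsto_inner[OF this tendsto_const]
      have 1: "(\<lambda>j. norm (\<zeta> j x) powr (p - 2) * (\<zeta> j x \<bullet> grad \<phi> x)) \<longlonglongrightarrow> norm (g x) powr (p - 2) * (g x \<bullet> grad \<phi> x)"
        by simp
      have 2: "(\<lambda>j. norm (\<zeta> j x) powr p) \<longlonglongrightarrow> norm (g x) powr p"
        using p by (intro tendsto_powr' tendsto_norm \<zeta>l tendsto_const) auto
      show ?case unfolding F_def by (intro tendsto_diff 1 tendsto_mult 2 tendsto_const)
    qed
  qed (rule Fm; measurable)+
  have "(\<lambda>j. - t j) \<longlonglongrightarrow> - 0" by (intro tendsto_minus t0)
  moreover have "A \<longlonglongrightarrow> (\<integral>x. F (g x) x \<partial>\<mu>) - c * (\<integral>x. \<phi> x \<partial>\<sigma>)"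
    unfolding A_def by (intro tendsto_diff lim tendsto_const)
  ultimately have "- 0 \<le> (\<integral>x. F (g x) x \<partial>\<mu>) - c * (\<integral>x. \<phi> x \<partial>\<sigma>)"
    using A by (intro LIMSEQ_le) auto
  then show ?thesis by (simp add: F_def)
qed

text \<open>The one-sided inequality for \<open>\<phi>\<close> and for
  \<open>- \<phi>\<close>.\<close>

lemma Euler_Lagrange:
  assumes \<phi>: "\<phi> \<in> test_functions \<Omega>"
  shows "(\<integral>x. norm (g x) powr (p - 2) * (g x \<bullet> grad \<phi> x) \<partial>\<mu>)
    = (p - 1) * (\<integral>x. norm (g x) powr p * \<phi> x \<partial>\<mu>) + c * (\<integral>x. \<phi> x \<partial>\<sigma>)"
proof -
  define P where "P = (\<integral>x. norm (g x) powr (p - 2) * (g x \<bullet> grad \<phi> x) \<partial>\<mu>)"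
  define Q where "Q = (\<integral>x. norm (g x) powr p * \<phi> x \<partial>\<mu>)"
  note fl = flux_integrable[OF g_meas g_int \<phi>]
  have gm: "grad (\<lambda>x. - \<phi> x) x = - grad \<phi> x" for x
    using grad_cmult[OF test_functions_smooth[OF \<phi>], of "-1"] by simp
  have m: "(\<lambda>x. - \<phi> x) \<in> test_functions \<Omega>" using test_functions_cmult[OF \<phi>, of "-1"] by simp
  have "0 \<le> P - (p - 1) * Q - c * (\<integral>x. \<phi> x \<partial>\<sigma>)"
    using Euler_Lagrange_ge[OF \<phi>] fl by (simp add: P_def Q_def)
  moreover have "0 \<le> - P + (p - 1) * Q + c * (\<integral>x. \<phi> x \<partial>\<sigma>)"
    using Euler_Lagrange_ge[OF m] fl by (simp add: P_def Q_def gm)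
  ultimately show ?thesis unfolding P_def[symmetric] Q_def[symmetric] by linarith
qed

lemma W01p_u: "W01p_grad p \<Omega> (\<lambda>x. (p - 1) * u x) (\<lambda>x. (p - 1) *\<^sub>R g x)"
  unfolding W01p_grad_def
proof (intro conjI exI allI)
  let ?\<phi> = "\<lambda>k x. (p - 1) * z k x"
  show "?\<phi> k \<in> test_functions \<Omega>" for k by (rule test_functions_cmult[OF z_test])
  have g\<phi>: "grad (?\<phi> k) x = (p - 1) *\<^sub>R grad (z k) x" for k x
    by (rule grad_cmult[OF test_functions_smooth[OF z_test]])
  have G': "integrable \<mu> (\<lambda>x. (p - 1) powr p * G x)" using G_int by simp
  have "(\<lambda>k. Lp_err p \<mu> (\<lambda>x. (p - 1) *\<^sub>R grad (z k) x) (\<lambda>x. (p - 1) *\<^sub>R g x)) \<longlonglongrightarrow> 0"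
  proof (rule Lp_dominated_convergence(3)[OF p _ _ G'])
    show "AE x in \<mu>. (\<lambda>j. (p - 1) *\<^sub>R grad (z j) x) \<longlonglongrightarrow> (p - 1) *\<^sub>R g x"
      using grad_lim by eventually_elim (intro tendsto_intros)
    show "AE x in \<mu>. norm ((p - 1) *\<^sub>R grad (z j) x) powr p \<le> (p - 1) powr p * G x" for j
      using grad_dom[of j] by eventually_elim (use p in \<open>simp add: powr_mult\<close>)
  qed (use grad_measurable[OF z_test] in measurable)
  then show "(\<lambda>k. \<integral>\<^sup>+x. ennreal (norm (grad (?\<phi> k) x - (p - 1) *\<^sub>R g x) powr p) \<partial>\<mu>) \<longlonglongrightarrow> 0"
    by (simp only: g\<phi> Lp_err_def)
  have "(\<lambda>k. Lp_err p \<mu> (\<lambda>x. (p - 1) * z k x) (\<lambda>x. (p - 1) * u x)) \<longlonglongrightarrow> 0"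
  proof (rule Lp_dominated_convergence(3)[OF p _ _ G'])
    show "AE x in \<mu>. (\<lambda>j. (p - 1) * z j x) \<longlonglongrightarrow> (p - 1) * u x"
      using z_lim by eventually_elim (intro tendsto_intros)
    show "AE x in \<mu>. norm ((p - 1) * z j x) powr p \<le> (p - 1) powr p * G x" for j
      using z_dom[of j] by eventually_elim (use p in \<open>simp add: powr_mult abs_mult\<close>)
  qed (use test_measurable[OF z_test] in measurable)
  then show "(\<lambda>k. \<integral>\<^sup>+x. ennreal (\<bar>?\<phi> k x - (p - 1) * u x\<bar> powr p) \<partial>\<mu>) \<longlonglongrightarrow> 0"
    by (simp only: Lp_err_def real_norm_def)
qed measurable

text \<open>Passing from \<open>u\<close> to \<open>(p - 1) * u\<close> multiplies the equation by
  \<open>(p - 1) powr (p - 1)\<close>. The remaining factor \<open>p - 1\<close> of the gradient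
  term is the one already present in \<open>Euler_Lagrange\<close>, and \<open>c\<close> is
  cancelled.\<close>

lemma solves: "solves_P p \<Omega> \<sigma> (\<lambda>x. (p - 1) * u x)"
  unfolding solves_P_def
proof (intro exI conjI ballI)
  show "W01p_grad p \<Omega> (\<lambda>x. (p - 1) * u x) (\<lambda>x. (p - 1) *\<^sub>R g x)" by (rule W01p_u)
  fix \<phi> assume \<phi>: "\<phi> \<in> test_functions \<Omega>"
  let ?k = "(p - 1) powr (p - 1)"
  have n: "norm ((p - 1) *\<^sub>R v) powr a = (p - 1) powr a * norm v powr a" for v :: 'a and a
    using p by (simp add: powr_mult)
  have k: "(p - 1) powr (p - 2) * (p - 1) = ?k" "(p - 1) powr p = ?k * (p - 1)"
    using p powr_add[of "p - 1" "p - 2" 1] powr_add[of "p - 1" "p - 1" 1] by auto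
  have "(\<integral>x. norm ((p - 1) *\<^sub>R g x) powr (p - 2) * ((p - 1) *\<^sub>R g x \<bullet> grad \<phi> x) \<partial>\<mu>)
      = (\<integral>x. ?k * (norm (g x) powr (p - 2) * (g x \<bullet> grad \<phi> x)) \<partial>\<mu>)"
    unfolding n k(1)[symmetric] by (simp add: mult_ac)
  also have "\<dots> = ?k * (p - 1) * (\<integral>x. norm (g x) powr p * \<phi> x \<partial>\<mu>) + (?k * c) * (\<integral>x. \<phi> x \<partial>\<sigma>)"
    unfolding Bochner_Integration.integral_mult_right_zero Euler_Lagrange[OF \<phi>]
    by (simp only: distrib_left mult.assoc)
  also have "?k * (p - 1) * (\<integral>x. norm (g x) powr p * \<phi> x \<partial>\<mu>)
      = (\<integral>x. norm ((p - 1) *\<^sub>R g x) powr p * \<phi> x \<partial>\<mu>)"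
    unfolding n k(2) by (simp add: mult_ac flip: Bochner_Integration.integral_mult_right_zero)
  finally show "(\<integral>x. norm ((p - 1) *\<^sub>R g x) powr (p - 2) * ((p - 1) *\<^sub>R g x \<bullet> grad \<phi> x) \<partial>\<mu>)
      = (\<integral>x. norm ((p - 1) *\<^sub>R g x) powr p * \<phi> x \<partial>\<mu>) + (\<integral>x. \<phi> x \<partial>\<sigma>)"
    by (simp add: c_inv)
qed

end

section \<open>Exponential integrability\<close>

text \<open>A profile growing like \<open>exp (\<delta> s)\<close> for moderate \<open>s\<close> and like \<open>exp s\<close> for large \<open>s\<close>,
  so that its \<open>p\<close>-th power is an admissible perturbation of \<open>\<rho> = exp (p s)\<close>;
  its logarithmic derivative stays in \<open>[1, \<delta>]\<close>.\<close>

definition profile :: "real \<Rightarrow> real \<Rightarrow> real \<Rightarrow> real" where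
  "profile \<delta> K s = exp (\<delta> * s) / (1 + exp ((\<delta> - 1) * s) / K)"

definition profile_rate :: "real \<Rightarrow> real \<Rightarrow> real \<Rightarrow> real" where
  "profile_rate \<delta> K s = \<delta> - (\<delta> - 1) * (exp ((\<delta> - 1) * s) / K) / (1 + exp ((\<delta> - 1) * s) / K)"

lemma profile_bounds:
  assumes "1 \<le> \<delta>" "1 \<le> K"
  shows "0 < profile \<delta> K s" "profile \<delta> K s \<le> K * exp s"
    "0 < profile \<delta> K 0" "profile \<delta> K 0 \<le> 1"
    "1 \<le> profile_rate \<delta> K s" "profile_rate \<delta> K s \<le> \<delta>"
    "(profile \<delta> K has_real_derivative profile_rate \<delta> K s * profile \<delta> K s) (at s)"
proof -
  define q where "q = exp ((\<delta> - 1) * s) / K"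
  have q: "0 < q" using assms by (simp add: q_def)
  have prof: "profile \<delta> K s = exp (\<delta> * s) / (1 + q)" by (simp add: profile_def q_def)
  have rate: "profile_rate \<delta> K s = \<delta> - (\<delta> - 1) * q / (1 + q)" by (simp add: profile_rate_def q_def)
  show "0 < profile \<delta> K s" unfolding prof using q by simp
  have "exp (\<delta> * s) / (1 + q) \<le> exp (\<delta> * s) / q"
    using q by (intro divide_left_mono) auto
  also have "exp (\<delta> * s) / q = K * exp s"
    using assms by (simp add: q_def field_simps flip: exp_add)
  finally show "profile \<delta> K s \<le> K * exp s" unfolding prof .
  show "0 < profile \<delta> K 0" "profile \<delta> K 0 \<le> 1"
    using assms by (auto simp: profile_def field_simps add_pos_pos)
  have "(\<delta> - 1) * (q / (1 + q)) \<le> (\<delta> - 1) * 1"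
    using q assms by (intro mult_left_mono) auto
  moreover have "0 \<le> (\<delta> - 1) * (q / (1 + q))" using q assms by (intro mult_nonneg_nonneg) auto
  ultimately show "1 \<le> profile_rate \<delta> K s" "profile_rate \<delta> K s \<le> \<delta>" unfolding rate by auto
  have "(profile \<delta> K has_real_derivative
      (\<delta> * exp (\<delta> * s) * (1 + q) - exp (\<delta> * s) * ((\<delta> - 1) * q)) / ((1 + q) * (1 + q))) (at s)"
    unfolding profile_def q_def
    using q assms unfolding q_def
    by (auto intro!: derivative_eq_intros simp: add_nonneg_eq_0_iff mult_ac)
  moreover have "(\<delta> * E * (1 + q) - E * ((\<delta> - 1) * q)) / ((1 + q) * (1 + q))
      = (\<delta> - (\<delta> - 1) * q / (1 + q)) * (E / (1 + q))" for E
    using q by (simp add: field_simps)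
  ultimately show "(profile \<delta> K has_real_derivative profile_rate \<delta> K s * profile \<delta> K s) (at s)"
    unfolding prof rate by simp
qed

lemma smooth_profile:
  assumes "smooth f" "1 \<le> K"
  shows "smooth (\<lambda>x. profile \<delta> K (f x))"
proof -
  have pos: "0 < 1 + 1 / K * exp ((\<delta> - 1) * f x)" for x
    using assms by (intro add_pos_nonneg) auto
  have "smooth (\<lambda>x. exp (\<delta> * f x) / (1 + 1 / K * exp ((\<delta> - 1) * f x)))"
    using assms pos by (intro smooth_divide smooth_add smooth_mult smooth_exp smooth_const)
  then show ?thesis by (simp add: profile_def)
qed

text \<open>At \<open>\<kappa> = 1\<close> the right-hand side is
  \<open>r + (p - 1) * (r - 1) \<ge> r\<close>, whereas \<open>\<theta> * r powr p \<le> \<theta> *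
  \<delta> powr (p - 1) * r < r\<close>. The gap leaves room for \<open>\<eta>\<close>, for
  \<open>a\<close> and for a deviation of \<open>\<kappa>\<close> from 1. In the application
  \<open>\<theta>\<close> is \<open>c * l\<close>, \<open>r\<close> the logarithmic derivative of
  the profile, and \<open>\<kappa>\<close> the factor by which a perturbation rescales the
  gradient.\<close>

lemma rate_inequality:
  fixes p \<theta> \<delta> :: real
  assumes p: "1 < p" and \<theta>: "0 < \<theta>" and \<delta>: "1 \<le> \<delta>" "\<theta> * \<delta> powr (p - 1) < 1"
  obtains \<eta> a d where "0 < \<eta>" "0 < a" "0 < d" "d < 1"
    "\<And>\<kappa> r. \<bar>\<kappa> - 1\<bar> \<le> d \<Longrightarrow> 1 \<le> r \<Longrightarrow> r \<le> \<delta> \<Longrightarrow>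
      ((1 + \<eta>) * \<theta> + a) * r powr p \<le> p * \<kappa> powr (p - 1) * r - (p - 1) * \<kappa> powr p"
proof -
  define \<beta> where "\<beta> = \<theta> * \<delta> powr (p - 1)"
  have \<beta>: "0 < \<beta>" "\<beta> < 1" using \<theta> \<delta> by (auto simp: \<beta>_def)
  \<comment> \<open>The terms with \<open>\<eta>\<close> and \<open>a\<close> take a quarter of
    \<open>1 - \<beta>\<close> each, which gives \<open>key\<close>. The remaining half equals
    \<open>\<epsilon> * (p * (\<delta> + 1))\<close>, enough to cover errors below
    \<open>\<epsilon>\<close> in the two powers of \<open>\<kappa>\<close>.\<close>
  define \<eta> where "\<eta> = (1 - \<beta>) / (4 * \<beta>)"
  define a where "a = (1 - \<beta>) / (4 * \<delta> powr (p - 1))"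
  define \<epsilon> where "\<epsilon> = (1 - \<beta>) / (2 * (p * (\<delta> + 1)))"
  have pos: "0 < \<eta>" "0 < a" "0 < \<epsilon>" using \<beta> \<delta> p by (auto simp: \<eta>_def a_def \<epsilon>_def)
  have key: "((1 + \<eta>) * \<theta> + a) * \<delta> powr (p - 1) = (1 + \<beta>) / 2"
  proof -
    have "\<eta> * \<beta> = (1 - \<beta>) / 4" using \<beta> by (simp add: \<eta>_def)
    moreover have "a * \<delta> powr (p - 1) = (1 - \<beta>) / 4" using \<delta> by (simp add: a_def)
    ultimately have "\<beta> + \<eta> * \<beta> + a * \<delta> powr (p - 1) = (1 + \<beta>) / 2" by argo
    then show ?thesis by (simp add: \<beta>_def algebra_simps)
  qed
  have cont: "\<exists>d>0. \<forall>\<kappa>. \<bar>\<kappa> - 1\<bar> < d \<longrightarrow> \<bar>\<kappa> powr b - 1\<bar> < \<epsilon>" for b :: real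
  proof -
    have "isCont (\<lambda>\<kappa>. \<kappa> powr b) (1::real)" by (intro continuous_intros) auto
    from LIM_D[OF this[unfolded isCont_def] pos(3)] obtain d where
      "0 < d" "\<And>\<kappa>. \<kappa> \<noteq> 1 \<Longrightarrow> \<bar>\<kappa> - 1\<bar> < d \<Longrightarrow> \<bar>\<kappa> powr b - 1\<bar> < \<epsilon>" by auto
    then show ?thesis using pos(3) by (metis diff_self abs_zero powr_one_eq_one)
  qed
  obtain d1 where d1: "0 < d1" "\<And>\<kappa>. \<bar>\<kappa> - 1\<bar> < d1 \<Longrightarrow> \<bar>\<kappa> powr (p - 1) - 1\<bar> < \<epsilon>" using cont by blast
  obtain d2 where d2: "0 < d2" "\<And>\<kappa>. \<bar>\<kappa> - 1\<bar> < d2 \<Longrightarrow> \<bar>\<kappa> powr p - 1\<bar> < \<epsilon>" using cont by blast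
  define d where "d = min (1 / 2) (min d1 d2 / 2)"
  have d: "0 < d" "d < 1" "d < d1" "d < d2" using d1 d2 by (auto simp: d_def min_def)
  show ?thesis
  proof (rule that[OF pos(1,2) d(1,2)])
    fix \<kappa> r :: real assume \<kappa>: "\<bar>\<kappa> - 1\<bar> \<le> d" and r: "1 \<le> r" "r \<le> \<delta>"
    have "r powr p = r powr (p - 1) * r" using r powr_add[of r "p - 1" 1] by simp
    also have "\<dots> \<le> \<delta> powr (p - 1) * r" using r p by (intro mult_right_mono powr_mono2) auto
    finally have "((1 + \<eta>) * \<theta> + a) * r powr p \<le> ((1 + \<eta>) * \<theta> + a) * (\<delta> powr (p - 1) * r)"
      using pos \<theta> by (intro mult_left_mono) auto
    also have "\<dots> = (1 + \<beta>) / 2 * r" unfolding mult.assoc[symmetric] key ..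
    also have "\<dots> = r - (1 - \<beta>) / 2 * r" by (simp add: field_simps)
    also have "\<dots> \<le> r - (1 - \<beta>) / 2" using \<beta> r mult_left_mono[of 1 r "(1 - \<beta>) / 2"] by simp
    also have "(1 - \<beta>) / 2 = \<epsilon> * (p * (\<delta> + 1))" using p \<delta> by (simp add: \<epsilon>_def)
    also have "r - \<epsilon> * (p * (\<delta> + 1)) \<le> p * \<kappa> powr (p - 1) * r - (p - 1) * \<kappa> powr p"
    proof -
      have k: "1 - \<epsilon> \<le> \<kappa> powr (p - 1)" "\<kappa> powr p \<le> 1 + \<epsilon>"
        using d1(2)[of \<kappa>] d2(2)[of \<kappa>] \<kappa> d by auto
      have "p * r * (1 - \<epsilon>) \<le> p * r * \<kappa> powr (p - 1)" using p r k by (intro mult_left_mono) auto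
      then have 1: "p * r - p * r * \<epsilon> \<le> p * \<kappa> powr (p - 1) * r" by (simp add: right_diff_distrib mult_ac)
      have "(p - 1) * \<kappa> powr p \<le> (p - 1) * (1 + \<epsilon>)" using p k by (intro mult_left_mono) auto
      also have "(p - 1) * (1 + \<epsilon>) = p - 1 + p * \<epsilon> - \<epsilon>" by (simp add: algebra_simps)
      finally have 2: "(p - 1) * \<kappa> powr p \<le> p - 1 + p * \<epsilon> - \<epsilon>" .
      have 3: "p * r * \<epsilon> \<le> p * \<delta> * \<epsilon>" using p r pos by (intro mult_right_mono mult_left_mono) auto
      have 4: "p - 1 \<le> p * r - r"
        using p r mult_left_mono[of 1 r "p - 1"] by (simp add: left_diff_distrib)
      have 5: "\<epsilon> * (p * (\<delta> + 1)) = p * \<delta> * \<epsilon> + p * \<epsilon>" by (simp add: algebra_simps)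
      have "R - E1 \<le> S \<Longrightarrow> W \<le> p - 1 + E3 - \<epsilon> \<Longrightarrow> E1 \<le> E2 \<Longrightarrow> p - 1 \<le> R - r \<Longrightarrow> r - (E2 + E3) \<le> S - W"
        for R E1 S W E2 E3 using pos(3) by linarith
      from this[OF 1 2 3 4] show ?thesis unfolding 5 .
    qed
    finally show "((1 + \<eta>) * \<theta> + a) * r powr p \<le> p * \<kappa> powr (p - 1) * r - (p - 1) * \<kappa> powr p" .
  qed
qed

context p_laplace_minimizer
begin

text \<open>The density is lowered by a multiple of \<open>h powr p\<close>, up to a constant, where
  \<open>h\<close> is the profile of \<open>z j\<close>. Almost minimality then bounds
  \<open>(1 + \<eta>) * (c * l) + a\<close> times the energy of \<open>H\<close> by \<open>c\<close>
  times a \<open>\<sigma>\<close> integral, and \<open>\<sigma>_growth_bound\<close> gives back only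
  \<open>(1 + \<eta>) * (c * l)\<close> times this energy plus a lower order term; the surplus
  \<open>a\<close> yields the bound. Only the index \<open>N\<close> depends on \<open>K\<close>,
  not \<open>X\<close>.\<close>

lemma profile_energy_bound:
  assumes \<delta>: "1 \<le> \<delta>" "c * l * \<delta> powr (p - 1) < 1"
  obtains X where "\<And>K. 1 \<le> K \<Longrightarrow> \<exists>N. \<forall>j\<ge>N.
    energy (\<lambda>x. profile \<delta> K (z j x) - profile \<delta> K 0) \<le> X"
proof -
  obtain \<eta> a d where \<eta>: "0 < \<eta>" and a: "0 < a" and d: "0 < d" "d < 1" and
    rate: "\<And>\<kappa> r. \<bar>\<kappa> - 1\<bar> \<le> d \<Longrightarrow> 1 \<le> r \<Longrightarrow> r \<le> \<delta> \<Longrightarrow>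
      ((1 + \<eta>) * (c * l) + a) * r powr p \<le> p * \<kappa> powr (p - 1) * r - (p - 1) * \<kappa> powr p"
    by (rule rate_inequality[OF p cl(1) \<delta>]) blast
  obtain B where B: "0 \<le> B" "\<And>H a. H \<in> test_functions \<Omega> \<Longrightarrow> 0 \<le> a \<Longrightarrow> a \<le> 1 \<Longrightarrow> (\<And>x. 0 \<le> a + H x) \<Longrightarrow>
      (\<integral>x. (a + H x) powr p - a powr p \<partial>\<sigma>) \<le> (1 + \<eta>) * l * energy H + B * energy H powr (1 / p)"
    by (rule \<sigma>_growth_bound[OF \<eta>]) blast
  obtain M' where M': "\<And>X. 0 \<le> X \<Longrightarrow> c * B * X powr (1 / p) \<le> a / 2 * X + M'"
    using powr_root_absorb[OF p, of "a / 2" "c * B"] a B(1) c_pos by auto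
  have "\<exists>N. \<forall>j\<ge>N. energy (\<lambda>x. profile \<delta> K (z j x) - profile \<delta> K 0) \<le> 2 / a * (M' + 1)"
    if K: "1 \<le> K" for K
  proof -
    define h where "h = profile \<delta> K"
    define r where "r = profile_rate \<delta> K"
    note hr = profile_bounds[OF \<delta>(1) K, folded h_def r_def]
    \<comment> \<open>Small enough for the perturbed density to keep at least half its value and for
      \<open>\<kappa>\<close> below to stay within \<open>d\<close> of 1. The summand
      \<open>exp p\<close> pays for the constant \<open>h 0 powr p \<le> 1\<close>, as the density
      may be as small as \<open>exp (- p)\<close>.\<close>
    define t where "t = d / (2 * (\<delta> * K powr p + exp p))"
    have den: "0 < \<delta> * K powr p + exp p" using \<delta>(1) by (intro add_nonneg_pos) auto
    have t: "0 < t" "2 * t * (\<delta> * K powr p + exp p) = d"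
    proof -
      have "2 * (d / (2 * S)) * S = d" if "0 < S" for S using that by simp
      from this[OF den] show "2 * t * (\<delta> * K powr p + exp p) = d" unfolding t_def .
      show "0 < t" using den d by (simp add: t_def)
    qed
    have tK: "t * K powr p \<le> 1 / 2"
    proof -
      have "1 * K powr p \<le> \<delta> * K powr p + exp p" using \<delta>(1) by (intro add_increasing2 mult_right_mono) auto
      then have "t * (1 * K powr p) \<le> t * (\<delta> * K powr p + exp p)" using t(1) by (intro mult_left_mono) auto
      then show ?thesis using t(2) d by simp
    qed
    \<comment> \<open>From \<open>N\<close> on, the error of minimality is below \<open>t\<close>,
      so it becomes at most 1 after division by \<open>t\<close>.\<close>
    have "eventually (\<lambda>j. e j < t) sequentially" using t(1) by (rule order_tendstoD(2)[OF e_tendsto])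
    then obtain N where N: "\<And>j. j \<ge> N \<Longrightarrow> e j < t" by (auto simp: eventually_sequentially)
    have "energy (\<lambda>x. h (z j x) - h 0) \<le> 2 / a * (M' + 1)" if j: "j \<ge> N" for j
    proof -
      let ?z = "z j"
      have zt: "?z \<in> test_functions \<Omega>" by (rule z_test)
      have sz: "smooth ?z" by (rule test_functions_smooth[OF zt])
      define H where "H x = h (?z x) - h 0" for x
      have sh: "smooth (\<lambda>x. h (?z x))" unfolding h_def by (rule smooth_profile[OF sz K])
      have H: "H \<in> test_functions \<Omega>"
        unfolding H_def by (rule test_functionsI[OF zt]) (use sh in auto)
      define \<phi> where "\<phi> x = (- t) * (h (?z x) powr p - h 0 powr p)" for x
      have \<phi>: "\<phi> \<in> test_functions \<Omega>"
        unfolding \<phi>_def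
      proof (rule test_functionsI[OF zt])
        show "smooth (\<lambda>x. (- t) * (h (?z x) powr p - h 0 powr p))"
          by (intro smooth_mult smooth_diff smooth_const smooth_powr sh hr(1))
      qed simp
      have hp: "h s powr p \<le> K powr p * exp (p * s)" for s
      proof -
        have "h s powr p \<le> (K * exp s) powr p" using hr(1)[of s] hr(2)[of s] p by (intro powr_mono2) auto
        also have "\<dots> = K powr p * exp (p * s)" using K by (simp add: powr_mult exp_powr_real mult.commute)
        finally show ?thesis .
      qed
      have den2: "exp (p * ?z x) / 2 \<le> exp (p * ?z x) + \<phi> x" for x
      proof -
        have "t * h (?z x) powr p \<le> t * (K powr p * exp (p * ?z x))"
          using t(1) hp by (intro mult_left_mono) auto
        also have "\<dots> = t * K powr p * exp (p * ?z x)" by simp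
        also have "\<dots> \<le> 1 / 2 * exp (p * ?z x)" using tK by (intro mult_right_mono) auto
        finally have "t * h (?z x) powr p \<le> exp (p * ?z x) / 2" by simp
        moreover have "0 \<le> t * h 0 powr p" using t(1) by simp
        ultimately show ?thesis by (simp add: \<phi>_def algebra_simps)
      qed
      have pos: "0 < exp (p * ?z x) + \<phi> x" for x
        by (rule less_le_trans[OF _ den2]) simp
      have gH: "grad H x = (r (?z x) * h (?z x)) *\<^sub>R grad ?z x" for x
        unfolding H_def
        by (rule grad_compose[OF sz, where F = "\<lambda>s. h s - h 0"]) (auto intro!: derivative_eq_intros hr(7))
      have g\<phi>: "grad \<phi> x = (- (t * p * r (?z x) * h (?z x) powr p)) *\<^sub>R grad ?z x" for x
      proof -
        have hpp: "h s powr (p - 1) * h s = h s powr p" for s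
          using hr(1)[of s] powr_add[of "h s" "p - 1" 1] by simp
        have "((\<lambda>s. h s powr p) has_real_derivative p * h s powr (p - 1) * (r s * h s)) (at s)" for s
          by (rule has_real_derivative_powr[THEN DERIV_chain2, OF hr(1) hr(7)])
        then have "((\<lambda>s. (- t) * (h s powr p - h 0 powr p)) has_real_derivative
            (- t) * (p * h s powr (p - 1) * (r s * h s) - 0)) (at s)" for s
          by (intro DERIV_cmult DERIV_diff DERIV_const)
        from grad_compose[OF sz this] have "grad \<phi> x = ((- t) * (p * h (?z x) powr (p - 1) * (r (?z x) * h (?z x)) - 0)) *\<^sub>R grad ?z x"
          unfolding \<phi>_def .
        also have "(- t) * (p * h (?z x) powr (p - 1) * (r (?z x) * h (?z x)) - 0)
            = - (t * p * r (?z x) * (h (?z x) powr (p - 1) * h (?z x)))" by simp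
        finally show ?thesis unfolding hpp .
      qed
      \<comment> \<open>As \<open>\<phi>\<close> is a function of \<open>z j\<close> alone, the
        perturbed gradient is a scalar multiple of \<open>grad (z j)\<close>, and
        \<open>\<kappa>\<close> is this scalar.\<close>
      define \<kappa> where "\<kappa> x = (exp (p * ?z x) - t * r (?z x) * h (?z x) powr p) / (exp (p * ?z x) + \<phi> x)" for x
      have \<kappa>: "\<bar>\<kappa> x - 1\<bar> \<le> d" for x
      proof -
        let ?\<rho> = "exp (p * ?z x)" and ?h = "h (?z x) powr p"
        have "- t * r (?z x) * ?h - \<phi> x = t * ((1 - r (?z x)) * ?h - h 0 powr p)"
          by (simp add: \<phi>_def algebra_simps)
        moreover have "\<bar>(1 - r (?z x)) * ?h - h 0 powr p\<bar> \<le> (\<delta> * K powr p + exp p) * ?\<rho>"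
        proof -
          have "\<bar>(1 - r (?z x)) * ?h\<bar> \<le> \<delta> * ?h"
            using hr(5,6)[of "?z x"] \<delta>(1) by (simp add: abs_mult mult_right_mono)
          also have "\<dots> \<le> \<delta> * (K powr p * ?\<rho>)" using hp \<delta>(1) by (intro mult_left_mono) auto
          finally have 1: "\<bar>(1 - r (?z x)) * ?h\<bar> \<le> \<delta> * (K powr p * ?\<rho>)" .
          have "h 0 powr p \<le> 1" using hr(3,4) p by (intro powr_le1) auto
          moreover have "0 \<le> p * (1 + ?z x)" using z_ge[of j x] p by simp
          then have "1 \<le> exp p * ?\<rho>" by (simp add: distrib_left flip: exp_add)
          ultimately have "\<bar>h 0 powr p\<bar> \<le> exp p * ?\<rho>" by simp
          with 1 show ?thesis unfolding distrib_right mult.assoc by linarith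
        qed
        ultimately have "\<bar>- t * r (?z x) * ?h - \<phi> x\<bar> \<le> t * ((\<delta> * K powr p + exp p) * ?\<rho>)"
          using t(1) by (simp only: abs_mult abs_of_pos mult_left_mono less_imp_le)
        also have "\<dots> = d * (?\<rho> / 2)" unfolding t(2)[symmetric] by simp
        also have "\<dots> \<le> d * (?\<rho> + \<phi> x)" using d by (intro mult_left_mono den2) auto
        finally have "\<bar>- t * r (?z x) * ?h - \<phi> x\<bar> / (?\<rho> + \<phi> x) \<le> d"
          using pos[of x] by (simp add: pos_divide_le_eq)
        moreover have "\<kappa> x - 1 = (- t * r (?z x) * ?h - \<phi> x) / (?\<rho> + \<phi> x)"
          using pos[of x] by (simp add: \<kappa>_def field_simps)
        ultimately show ?thesis using pos[of x] by (simp only: abs_divide abs_of_pos)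
      qed
      have \<kappa>0: "0 < \<kappa> x" for x using \<kappa>[of x] d(2) by linarith
      define \<zeta> where "\<zeta> x = (1 / (exp (p * ?z x) + \<phi> x)) *\<^sub>R (exp (p * ?z x) *\<^sub>R grad ?z x + (1 / p) *\<^sub>R grad \<phi> x)" for x
      have \<zeta>: "\<zeta> x = \<kappa> x *\<^sub>R grad ?z x" for x
      proof -
        have "(1 / p) *\<^sub>R grad \<phi> x = (- (t * r (?z x) * h (?z x) powr p)) *\<^sub>R grad ?z x"
          unfolding g\<phi> using p by simp
        then have "exp (p * ?z x) *\<^sub>R grad ?z x + (1 / p) *\<^sub>R grad \<phi> x
            = (exp (p * ?z x) - t * r (?z x) * h (?z x) powr p) *\<^sub>R grad ?z x"
          by (simp add: scaleR_diff_left)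
        then show ?thesis unfolding \<zeta>_def \<kappa>_def by (simp only: scaleR_scaleR times_divide_eq_left mult_1)
      qed
      define Q where "Q x = norm (\<zeta> x) powr (p - 2) * (\<zeta> x \<bullet> grad \<phi> x) - (p - 1) * (norm (\<zeta> x) powr p * \<phi> x)" for x
      have \<zeta>i: "\<zeta> \<in> borel_measurable \<mu>" "integrable \<mu> (\<lambda>x. norm (\<zeta> x) powr p)"
      proof -
        note lp = ln_perturb_test[OF zt \<phi> pos]
        have "grad (\<lambda>x. ln (exp (p * ?z x) + \<phi> x) / p) = \<zeta>" unfolding \<zeta>_def using lp(3) by auto
        then show "\<zeta> \<in> borel_measurable \<mu>" "integrable \<mu> (\<lambda>x. norm (\<zeta> x) powr p)"
          using grad_measurable[OF lp(1)] integrable_energy[OF lp(1)] by auto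
      qed
      have Qi: "integrable \<mu> Q"
        unfolding Q_def using flux_integrable[OF \<zeta>i \<phi>] by auto
      have "- t \<le> - e j" using N[OF j] by simp
      also have "\<dots> \<le> J_inf - J ?z" using J_z[of j] by simp
      also have "\<dots> \<le> (\<integral>x. Q x \<partial>\<mu>) - c * (\<integral>x. \<phi> x \<partial>\<sigma>)"
        using almost_Euler_Lagrange[OF zt \<phi> pos] unfolding \<zeta>_def[symmetric] Q_def .
      also have "(\<integral>x. Q x \<partial>\<mu>) \<le>
          (\<integral>x. (- t * ((1 + \<eta>) * (c * l) + a)) * norm (grad H x) powr p \<partial>\<mu>)"
      proof (rule integral_mono[OF Qi])
        show "integrable \<mu> (\<lambda>x. (- t * ((1 + \<eta>) * (c * l) + a)) * norm (grad H x) powr p)"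
          using integrable_energy[OF H] by auto
        fix x
        let ?n = "norm (grad ?z x)" and ?h = "h (?z x) powr p" and ?r = "r (?z x)"
        have n1: "norm (\<zeta> x) powr b = \<kappa> x powr b * ?n powr b" for b
          unfolding \<zeta> using \<kappa>0[of x] by (simp add: powr_mult)
        have nn: "?n powr (p - 2) * (grad ?z x \<bullet> grad ?z x) = ?n powr p"
          using powr_add[of ?n "p - 2" 2]
          by (cases "grad ?z x = 0") (auto simp: power2_norm_eq_inner[symmetric])
        have kk: "\<kappa> x powr (p - 2) * \<kappa> x = \<kappa> x powr (p - 1)"
          using \<kappa>0[of x] powr_add[of "\<kappa> x" "p - 2" 1] by simp
        have "norm (\<zeta> x) powr (p - 2) * (\<zeta> x \<bullet> grad \<phi> x)
            = - (t * p * ?r * ?h) * ((\<kappa> x powr (p - 2) * \<kappa> x) * (?n powr (p - 2) * (grad ?z x \<bullet> grad ?z x)))"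
          unfolding n1 unfolding \<zeta> g\<phi> by simp
        also have "\<dots> = - t * (?n powr p * ?h * (p * \<kappa> x powr (p - 1) * ?r))" unfolding nn kk by simp
        finally have 1: "norm (\<zeta> x) powr (p - 2) * (\<zeta> x \<bullet> grad \<phi> x) = - t * (?n powr p * ?h * (p * \<kappa> x powr (p - 1) * ?r))" .
        have "(p - 1) * (norm (\<zeta> x) powr p * \<phi> x)
            = - t * ((p - 1) * (\<kappa> x powr p * ?n powr p * (?h - h 0 powr p)))"
          unfolding n1 by (simp add: \<phi>_def)
        \<comment> \<open>Omitting \<open>h 0 powr p\<close> lowers this expression, which is the
          useful direction because \<open>Q\<close> subtracts it.\<close>
        also have "\<dots> \<ge> - t * ((p - 1) * (\<kappa> x powr p * ?n powr p * ?h))"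
          using t(1) p by (intro mult_left_mono_neg mult_left_mono) auto
        finally have 2: "- t * ((p - 1) * (\<kappa> x powr p * ?n powr p * ?h)) \<le> (p - 1) * (norm (\<zeta> x) powr p * \<phi> x)" .
        have "Q x \<le> - t * (?n powr p * ?h * (p * \<kappa> x powr (p - 1) * ?r))
            - (- t * ((p - 1) * (\<kappa> x powr p * ?n powr p * ?h)))"
          unfolding Q_def 1 using 2 by linarith
        also have "\<dots> = - t * (?n powr p * ?h * (p * \<kappa> x powr (p - 1) * ?r - (p - 1) * \<kappa> x powr p))"
          by (simp add: algebra_simps)
        also have "\<dots> \<le> - t * (?n powr p * ?h * (((1 + \<eta>) * (c * l) + a) * ?r powr p))"
          using t(1) rate[OF \<kappa>[of x] hr(5)[of "?z x"] hr(6)[of "?z x"]] by (intro mult_left_mono_neg mult_left_mono) auto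
        also have "\<dots> = (- t * ((1 + \<eta>) * (c * l) + a)) * norm (grad H x) powr p"
        proof -
          have "norm (grad H x) = ?r * h (?z x) * ?n"
            unfolding gH using hr(1)[of "?z x"] hr(5)[of "?z x"] by (simp add: abs_mult)
          then have "norm (grad H x) powr p = ?r powr p * ?h * ?n powr p"
            using hr(1)[of "?z x"] hr(5)[of "?z x"] by (simp add: powr_mult)
          then show ?thesis by (simp only: mult_ac)
        qed
        finally show "Q x \<le> (- t * ((1 + \<eta>) * (c * l) + a)) * norm (grad H x) powr p" .
      qed
      also have "\<dots> = - t * (((1 + \<eta>) * (c * l) + a) * energy H)"
        by (simp add: energy_def)
      also have "(\<integral>x. \<phi> x \<partial>\<sigma>) = - t * (\<integral>x. (h 0 + H x) powr p - h 0 powr p \<partial>\<sigma>)"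
        unfolding \<phi>_def H_def by simp
      finally have "- t \<le> t * (c * (\<integral>x. (h 0 + H x) powr p - h 0 powr p \<partial>\<sigma>) - ((1 + \<eta>) * (c * l) + a) * energy H)"
        by (simp add: algebra_simps)
      then have "t * (- 1) \<le> t * (c * (\<integral>x. (h 0 + H x) powr p - h 0 powr p \<partial>\<sigma>) - ((1 + \<eta>) * (c * l) + a) * energy H)"
        by simp
      then have "- 1 \<le> c * (\<integral>x. (h 0 + H x) powr p - h 0 powr p \<partial>\<sigma>) - ((1 + \<eta>) * (c * l) + a) * energy H"
        using t(1) by (simp only: mult_le_cancel_left_pos)
      moreover have "c * (\<integral>x. (h 0 + H x) powr p - h 0 powr p \<partial>\<sigma>)
          \<le> c * ((1 + \<eta>) * l * energy H + B * energy H powr (1 / p))"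
        using c_pos hr by (intro mult_left_mono B(2) H) (auto simp: H_def less_imp_le)
      moreover have "c * B * energy H powr (1 / p) \<le> a / 2 * energy H + M'"
        by (rule M'[OF energy_nonneg])
      ultimately have "a / 2 * energy H \<le> M' + 1" by (simp add: algebra_simps)
      then have "energy H \<le> 2 / a * (M' + 1)" using a by (simp add: field_simps)
      then show ?thesis unfolding H_def[abs_def] .
    qed
    then show ?thesis unfolding h_def by blast
  qed
  then show ?thesis by (rule that)
qed

end

section \<open>Limits of exponentials and membership in the Sobolev space\<close>

lemma tendsto_divide_Suc_0: "(\<lambda>k. E / (real k + 1)) \<longlonglongrightarrow> 0"
proof -
  have "(\<lambda>k. E * inverse (real (Suc k))) \<longlonglongrightarrow> E * 0"
    by (intro tendsto_mult tendsto_const LIMSEQ_inverse_real_of_nat)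
  then show ?thesis by (simp add: divide_inverse add.commute)
qed

lemma Fatou_bound:
  fixes f :: "nat \<Rightarrow> 'a \<Rightarrow> ennreal"
  assumes [measurable]: "\<And>j. f j \<in> borel_measurable M"
    and lim: "AE x in M. (\<lambda>j. f j x) \<longlonglongrightarrow> h x"
    and bound: "\<And>j. j \<ge> N \<Longrightarrow> (\<integral>\<^sup>+x. f j x \<partial>M) \<le> X"
  shows "(\<integral>\<^sup>+x. h x \<partial>M) \<le> X"
proof -
  have "(\<integral>\<^sup>+x. h x \<partial>M) = (\<integral>\<^sup>+x. liminf (\<lambda>j. f (j + N) x) \<partial>M)"
  proof (rule nn_integral_cong_AE)
    show "AE x in M. h x = liminf (\<lambda>j. f (j + N) x)"
      using lim
    proof eventually_elim
      case (elim x)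
      from LIMSEQ_ignore_initial_segment[OF this, of N] show ?case
        by (rule lim_imp_Liminf[OF sequentially_bot, symmetric])
    qed
  qed
  also have "\<dots> \<le> liminf (\<lambda>j. \<integral>\<^sup>+x. f (j + N) x \<partial>M)" by (rule nn_integral_liminf) measurable
  also have "\<dots> \<le> liminf (\<lambda>j. X)" by (intro Liminf_mono always_eventually allI bound) simp
  also have "\<dots> = X" by (rule Liminf_const) simp
  finally show ?thesis .
qed

text \<open>A triangle inequality for p-th powers; the constant \<open>2 powr p\<close> is harmless,
  as it serves only to prove finiteness and convergence to 0.\<close>

lemma Lp_err_triangle:
  fixes a b d :: "'a \<Rightarrow> 'b::euclidean_space"
  assumes [measurable]: "a \<in> borel_measurable M" "b \<in> borel_measurable M" "d \<in> borel_measurable M"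
    and p: "0 \<le> p"
  shows "Lp_err p M a d \<le> ennreal (2 powr p) * (Lp_err p M a b + Lp_err p M b d)"
proof -
  have "Lp_err p M a d \<le>
     (\<integral>\<^sup>+x. ennreal (2 powr p) * (ennreal (norm (a x - b x) powr p) + ennreal (norm (b x - d x) powr p)) \<partial>M)"
    unfolding Lp_err_def
  proof (rule nn_integral_mono)
    fix x
    have "norm (a x - d x) powr p \<le> (norm (a x - b x) + norm (b x - d x)) powr p"
      using p norm_triangle_ineq[of "a x - b x" "b x - d x"] by (intro powr_mono2) auto
    also have "\<dots> \<le> 2 powr p * (norm (a x - b x) powr p + norm (b x - d x) powr p)"
      using p by (intro powr_add_le) auto
    finally have "ennreal (norm (a x - d x) powr p)
        \<le> ennreal (2 powr p * (norm (a x - b x) powr p + norm (b x - d x) powr p))" by (rule ennreal_leI)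
    then show "ennreal (norm (a x - d x) powr p) \<le>
        ennreal (2 powr p) * (ennreal (norm (a x - b x) powr p) + ennreal (norm (b x - d x) powr p))"
      by (simp add: ennreal_mult)
  qed
  also have "\<dots> = ennreal (2 powr p) * (Lp_err p M a b + Lp_err p M b d)"
    by (simp add: Lp_err_def nn_integral_cmult nn_integral_add)
  finally show ?thesis .
qed

lemma Lp_err_trans_tendsto:
  fixes a b :: "nat \<Rightarrow> 'a \<Rightarrow> 'b::euclidean_space"
  assumes "\<And>k. a k \<in> borel_measurable M" "\<And>k. b k \<in> borel_measurable M" "d \<in> borel_measurable M"
    and p: "0 \<le> p"
    and ab: "(\<lambda>k. Lp_err p M (a k) (b k)) \<longlonglongrightarrow> 0" and bd: "(\<lambda>k. Lp_err p M (b k) d) \<longlonglongrightarrow> 0"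
  shows "(\<lambda>k. Lp_err p M (a k) d) \<longlonglongrightarrow> 0"
proof (rule tendsto_sandwich[OF _ _ tendsto_const])
  show "(\<lambda>k. ennreal (2 powr p) * (Lp_err p M (a k) (b k) + Lp_err p M (b k) d)) \<longlonglongrightarrow> 0"
    using ennreal_tendsto_cmult[OF _ tendsto_add[OF ab bd], of "ennreal (2 powr p)"] by simp
  show "eventually (\<lambda>k. Lp_err p M (a k) d
      \<le> ennreal (2 powr p) * (Lp_err p M (a k) (b k) + Lp_err p M (b k) d)) sequentially"
    using assms by (intro always_eventually allI Lp_err_triangle)
qed auto

text \<open>A bounded smooth replacement of \<open>exp (\<delta> * s) - 1\<close> with bounded
  derivative, tending to it as \<open>n\<close> grows. The subtracted constant makes it vanish at 0,
  so it maps test functions to test functions.\<close>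

definition exp_cutoff :: "real \<Rightarrow> real \<Rightarrow> real \<Rightarrow> real" where
  "exp_cutoff \<delta> n s = exp (\<delta> * s) / (1 + exp (\<delta> * s) / n) - 1 / (1 + 1 / n)"

lemma exp_cutoff_bounds:
  assumes "0 \<le> \<delta>" "1 \<le> n"
  defines "d \<equiv> \<lambda>s. \<delta> * exp (\<delta> * s) / (1 + exp (\<delta> * s) / n)\<^sup>2"
  shows "exp_cutoff \<delta> n 0 = 0" "\<bar>exp_cutoff \<delta> n s\<bar> \<le> n"
    "0 \<le> s \<Longrightarrow> \<bar>exp_cutoff \<delta> n s\<bar> \<le> exp (\<delta> * s) - 1"
    "(exp_cutoff \<delta> n has_real_derivative d s) (at s)"
    "0 \<le> d s" "d s \<le> \<delta> * n" "d s \<le> \<delta> * exp (\<delta> * s)"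
proof -
  define E where "E = exp (\<delta> * s)"
  have E: "0 < E" by (simp add: E_def)
  have n: "0 < 1 + E / n" "0 < 1 + 1 / n" "0 < n + E" "0 < n + 1" using E assms by (auto intro: add_pos_pos)
  have nE: "1 + E / n = (n + E) / n" "1 + 1 / n = (n + 1) / n" using assms by (auto simp: field_simps)
  have cut: "exp_cutoff \<delta> n s = n * E / (n + E) - n / (n + 1)"
    unfolding exp_cutoff_def E_def[symmetric] nE using assms by simp
  show "exp_cutoff \<delta> n 0 = 0" by (simp add: exp_cutoff_def)
  have "n * E / (n + E) \<le> n" "0 \<le> n * E / (n + E)" "n / (n + 1) \<le> n" "0 \<le> n / (n + 1)"
    using E assms n by (auto simp: pos_divide_le_eq intro!: mult_left_mono)
  then show "\<bar>exp_cutoff \<delta> n s\<bar> \<le> n" unfolding cut by linarith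
  show "\<bar>exp_cutoff \<delta> n s\<bar> \<le> exp (\<delta> * s) - 1" if "0 \<le> s"
  proof -
    have E1: "1 \<le> E" unfolding E_def using that assms by simp
    \<comment> \<open>Combining the fractions shows the cutoff as \<open>E - 1\<close> times a
      factor between 0 and 1, hence the bound by the uncut exponential.\<close>
    have "exp_cutoff \<delta> n s = (E - 1) * (n * n / ((n + E) * (n + 1)))"
      unfolding cut using n by (simp add: field_simps)
    moreover have "n * n \<le> (n + E) * (n + 1)" using E assms by (intro mult_mono) auto
    then have "0 \<le> n * n / ((n + E) * (n + 1))" "n * n / ((n + E) * (n + 1)) \<le> 1"
      using n assms by auto
    ultimately show ?thesis unfolding E_def[symmetric] using E1
      by (simp only: abs_mult abs_of_nonneg diff_ge_0_iff_ge mult_right_le_one_le)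
  qed
  have "(exp_cutoff \<delta> n has_real_derivative
      (\<delta> * E * (1 + E / n) - E * (\<delta> * E / n)) / ((1 + E / n) * (1 + E / n))) (at s)"
    unfolding exp_cutoff_def E_def
    using n(1) assms(2) unfolding E_def by (auto intro!: derivative_eq_intros simp: mult_ac)
  moreover have "(\<delta> * E * (1 + E / n) - E * (\<delta> * E / n)) / ((1 + E / n) * (1 + E / n)) = d s"
    unfolding d_def E_def[symmetric] by (simp add: algebra_simps power2_eq_square)
  ultimately show "(exp_cutoff \<delta> n has_real_derivative d s) (at s)" by simp
  show "0 \<le> d s" using assms by (simp add: d_def)
  have sq1: "1 \<le> (1 + E / n)\<^sup>2" using E assms by (intro one_le_power) auto
  have "\<delta> * E / (1 + E / n)\<^sup>2 \<le> \<delta> * E / 1"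
    using sq1 n(1) E assms by (intro divide_left_mono) auto
  then show "d s \<le> \<delta> * exp (\<delta> * s)" by (simp add: d_def E_def)
  have "E / n \<le> (1 + E / n)\<^sup>2"
  proof -
    have "0 \<le> (E / n)\<^sup>2 + E / n + 1" using E assms by simp
    then show ?thesis by (simp add: power2_sum)
  qed
  moreover have "0 < (1 + E / n)\<^sup>2" using sq1 by linarith
  ultimately have "E / n / (1 + E / n)\<^sup>2 \<le> 1" by (simp only: divide_le_eq_1_pos)
  then have "(\<delta> * n) * (E / n / (1 + E / n)\<^sup>2) \<le> (\<delta> * n) * 1" using assms by (intro mult_left_mono) auto
  then show "d s \<le> \<delta> * n" using assms by (simp add: d_def E_def)
qed

context p_laplace_minimizer
begin

text \<open>Fatou's lemma twice: along \<open>z j\<close> for fixed \<open>K\<close>, where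
  \<open>profile_energy_bound\<close> applies, and then as \<open>K\<close> grows and the profile
  tends to the pure exponential. The second passage rests on \<open>X\<close> being independent of
  \<open>K\<close>.\<close>

lemma exp_gradient_integrable:
  assumes \<delta>: "1 \<le> \<delta>" "c * l * \<delta> powr (p - 1) < 1"
  shows "integrable \<mu> (\<lambda>x. norm ((\<delta> * exp (\<delta> * u x)) *\<^sub>R g x) powr p)"
proof -
  obtain X where X: "\<And>K. 1 \<le> K \<Longrightarrow> \<exists>N. \<forall>j\<ge>N.
      energy (\<lambda>x. profile \<delta> K (z j x) - profile \<delta> K 0) \<le> X"
    by (rule profile_energy_bound[OF \<delta>]) blast
  have bK: "(\<integral>\<^sup>+x. ennreal (norm ((profile_rate \<delta> K (u x) * profile \<delta> K (u x)) *\<^sub>R g x) powr p) \<partial>\<mu>) \<le> ennreal X"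
    if K: "1 \<le> K" for K
  proof -
    obtain N where N: "\<And>j. j \<ge> N \<Longrightarrow> energy (\<lambda>x. profile \<delta> K (z j x) - profile \<delta> K 0) \<le> X"
      using X[OF K] by blast
    note pb = profile_bounds[OF \<delta>(1) K]
    let ?H = "\<lambda>j x. profile \<delta> K (z j x) - profile \<delta> K 0"
    have H: "?H j \<in> test_functions \<Omega>" for j
    proof (rule test_functionsI[OF z_test[of j]])
      show "smooth (?H j)"
        by (intro smooth_diff smooth_const smooth_profile K test_functions_smooth[OF z_test])
    qed simp
    have gH: "grad (?H j) x = (profile_rate \<delta> K (z j x) * profile \<delta> K (z j x)) *\<^sub>R grad (z j) x" for j x
      by (rule grad_compose[OF test_functions_smooth[OF z_test], where F = "\<lambda>s. profile \<delta> K s - profile \<delta> K 0"])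
        (auto intro!: derivative_eq_intros pb(7))
    have cont: "isCont (\<lambda>s. profile_rate \<delta> K s * profile \<delta> K s) s" for s
    proof -
      have "isCont (profile_rate \<delta> K) s"
        unfolding profile_rate_def[abs_def] using K by (intro continuous_intros) (auto simp: add_nonneg_eq_0_iff)
      moreover have "isCont (profile \<delta> K) s" by (rule DERIV_isCont[OF pb(7)])
      ultimately show ?thesis by (intro continuous_intros)
    qed
    show ?thesis
    proof (rule Fatou_bound)
      show "(\<lambda>x. ennreal (norm (grad (?H j) x) powr p)) \<in> borel_measurable \<mu>" for j
        using grad_measurable[OF H] by measurable
      show "AE x in \<mu>. (\<lambda>j. ennreal (norm (grad (?H j) x) powr p))
          \<longlonglongrightarrow> ennreal (norm ((profile_rate \<delta> K (u x) * profile \<delta> K (u x)) *\<^sub>R g x) powr p)"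
        using z_lim grad_lim
      proof eventually_elim
        case (elim x)
        show ?case
          unfolding gH using p elim
          by (intro tendsto_ennrealI tendsto_powr' tendsto_norm tendsto_scaleR tendsto_const
              isCont_tendsto_compose[OF cont]) auto
      qed
      show "(\<integral>\<^sup>+x. ennreal (norm (grad (?H j) x) powr p) \<partial>\<mu>) \<le> ennreal X" if "j \<ge> N" for j
        using N[OF that] unfolding energy_def
        by (subst nn_integral_eq_integral[OF integrable_energy[OF H]]) (auto intro: ennreal_leI)
    qed
  qed
  have "(\<integral>\<^sup>+x. ennreal (norm ((\<delta> * exp (\<delta> * u x)) *\<^sub>R g x) powr p) \<partial>\<mu>) \<le> ennreal X"
  proof (rule Fatou_bound[where N = 0])
    let ?K = "\<lambda>k. real k + 1"
    show "(\<integral>\<^sup>+x. ennreal (norm ((profile_rate \<delta> (?K k) (u x) * profile \<delta> (?K k) (u x)) *\<^sub>R g x) powr p) \<partial>\<mu>) \<le> ennreal X" for k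
      by (rule bK) simp
    show "(\<lambda>x. ennreal (norm ((profile_rate \<delta> (?K k) (u x) * profile \<delta> (?K k) (u x)) *\<^sub>R g x) powr p)) \<in> borel_measurable \<mu>" for k
      unfolding profile_rate_def profile_def by measurable
    show "AE x in \<mu>. (\<lambda>k. ennreal (norm ((profile_rate \<delta> (?K k) (u x) * profile \<delta> (?K k) (u x)) *\<^sub>R g x) powr p))
        \<longlonglongrightarrow> ennreal (norm ((\<delta> * exp (\<delta> * u x)) *\<^sub>R g x) powr p)"
    proof (rule AE_I2)
      fix x
      note q = tendsto_divide_Suc_0
      have "(\<lambda>k. profile_rate \<delta> (?K k) (u x)) \<longlonglongrightarrow> \<delta> - (\<delta> - 1) * 0 / (1 + 0)"
        unfolding profile_rate_def by (intro tendsto_intros q) simp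
      moreover have "(\<lambda>k. profile \<delta> (?K k) (u x)) \<longlonglongrightarrow> exp (\<delta> * u x) / (1 + 0)"
        unfolding profile_def by (intro tendsto_intros q) simp
      ultimately have "(\<lambda>k. profile_rate \<delta> (?K k) (u x) * profile \<delta> (?K k) (u x)) \<longlonglongrightarrow> \<delta> * exp (\<delta> * u x)"
        using tendsto_mult by fastforce
      then show "(\<lambda>k. ennreal (norm ((profile_rate \<delta> (?K k) (u x) * profile \<delta> (?K k) (u x)) *\<^sub>R g x) powr p))
        \<longlonglongrightarrow> ennreal (norm ((\<delta> * exp (\<delta> * u x)) *\<^sub>R g x) powr p)"
        using p by (intro tendsto_ennrealI tendsto_powr' tendsto_norm tendsto_scaleR tendsto_const) auto
    qed
  qed
  also have "ennreal X < \<infinity>" by simp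
  finally show ?thesis by (intro integrableI_nonneg) auto
qed

text \<open>The cutoffs are inserted because no majorant of \<open>exp (\<delta> * z j x)\<close>
  along \<open>j\<close> is at hand. For fixed \<open>k\<close> the cut-off functions are dominated
  by a constant and their gradients by means of \<open>G\<close>. As \<open>k\<close> grows, the
  gradients are dominated by the integrable \<open>w\<close>; a majorant for the values has to be
  won from Poincare's inequality.\<close>

lemma exp_in_W01p:
  assumes \<delta>: "0 \<le> \<delta>" and int: "integrable \<mu> (\<lambda>x. norm ((\<delta> * exp (\<delta> * u x)) *\<^sub>R g x) powr p)"
  shows "(\<lambda>x. exp (\<delta> * u x) - 1) \<in> W01p p \<Omega>"
proof -
  define n where "n k = real k + 1" for k :: nat
  have n1: "1 \<le> n k" for k by (simp add: n_def)
  define T where "T k = exp_cutoff \<delta> (n k)" for k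
  define d where "d k s = \<delta> * exp (\<delta> * s) / (1 + exp (\<delta> * s) / n k)\<^sup>2" for k s
  note T = exp_cutoff_bounds[OF \<delta> n1, folded T_def d_def]
  define w where "w x = (\<delta> * exp (\<delta> * u x)) *\<^sub>R g x" for x
  have [measurable]: "w \<in> borel_measurable \<mu>" unfolding w_def by measurable
  have [measurable]: "T k \<in> borel_measurable borel" "d k \<in> borel_measurable borel" for k
    unfolding T_def d_def exp_cutoff_def by measurable
  have q: "(\<lambda>k. E / n k) \<longlonglongrightarrow> 0" for E :: real
    unfolding n_def by (rule tendsto_divide_Suc_0)
  have Tlim: "(\<lambda>k. T k s) \<longlonglongrightarrow> exp (\<delta> * s) - 1" for s
  proof -
    have "(\<lambda>k. T k s) \<longlonglongrightarrow> exp (\<delta> * s) / (1 + 0) - 1 / (1 + 0)"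
      unfolding T_def exp_cutoff_def by (intro tendsto_intros q) auto
    then show ?thesis by simp
  qed
  have dlim: "(\<lambda>k. d k s) \<longlonglongrightarrow> \<delta> * exp (\<delta> * s)" for s
  proof -
    have "(\<lambda>k. d k s) \<longlonglongrightarrow> \<delta> * exp (\<delta> * s) / (1 + 0)\<^sup>2"
      unfolding d_def by (intro tendsto_intros q) auto
    then show ?thesis by simp
  qed
  have smT: "smooth (\<lambda>x. T k (z j x))" for k j
  proof -
    have pos: "0 < 1 + 1 / n k * exp (\<delta> * z j x)" for x using n1[of k] by (intro add_pos_nonneg) auto
    have "smooth (\<lambda>x. exp (\<delta> * z j x) / (1 + 1 / n k * exp (\<delta> * z j x)) - 1 / (1 + 1 / n k))"
      using pos by (intro smooth_diff smooth_divide smooth_add smooth_mult smooth_exp smooth_const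
          test_functions_smooth[OF z_test])
    then show ?thesis by (simp add: T_def exp_cutoff_def)
  qed
  have Tt: "(\<lambda>x. T k (z j x)) \<in> test_functions \<Omega>" for k j
    by (rule test_functionsI[OF z_test[of j] smT]) (simp add: T(1))
  have gT: "grad (\<lambda>x. T k (z j x)) x = d k (z j x) *\<^sub>R grad (z j) x" for k j x
    by (rule grad_compose[OF test_functions_smooth[OF z_test] T(4)])
  have contd: "isCont (d k) s" for k s
    unfolding d_def using n1[of k] by (intro continuous_intros) (auto simp: add_nonneg_eq_0_iff)
  define v where "v k x = d k (u x) *\<^sub>R g x" for k x
  define S where "S k x = T k (u x)" for k x
  have [measurable]: "v k \<in> borel_measurable \<mu>" "S k \<in> borel_measurable \<mu>" for k
    unfolding v_def S_def by measurable
  have lim1: "(\<lambda>j. Lp_err p \<mu> (\<lambda>x. d k (z j x) *\<^sub>R grad (z j) x) (v k)) \<longlonglongrightarrow> 0" for k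
  proof (rule Lp_dominated_convergence(3)[OF p])
    show "integrable \<mu> (\<lambda>x. (\<delta> * n k) powr p * G x)" using G_int by simp
    show "AE x in \<mu>. (\<lambda>j. d k (z j x) *\<^sub>R grad (z j) x) \<longlonglongrightarrow> v k x"
      unfolding v_def using z_lim grad_lim
      by eventually_elim (intro tendsto_scaleR isCont_tendsto_compose[OF contd])
    show "AE x in \<mu>. norm (d k (z j x) *\<^sub>R grad (z j) x) powr p \<le> (\<delta> * n k) powr p * G x" for j
      using grad_dom[of j]
    proof eventually_elim
      case (elim x)
      have "norm (d k (z j x) *\<^sub>R grad (z j) x) powr p = d k (z j x) powr p * norm (grad (z j) x) powr p"
        using T(5) by (simp add: powr_mult)
      also have "\<dots> \<le> (\<delta> * n k) powr p * G x"
        using T(5,6) p elim by (intro mult_mono powr_mono2) auto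
      finally show ?case .
    qed
    show "(\<lambda>x. d k (z j x) *\<^sub>R grad (z j) x) \<in> borel_measurable \<mu>" for j
      using grad_measurable[OF z_test] test_measurable[OF z_test] by measurable
  qed measurable
  have lim2: "(\<lambda>j. Lp_err p \<mu> (\<lambda>x. T k (z j x)) (S k)) \<longlonglongrightarrow> 0" for k
  proof (rule Lp_dominated_convergence(3)[OF p])
    show "integrable \<mu> (\<lambda>x. n k powr p)" by simp
    show "AE x in \<mu>. (\<lambda>j. T k (z j x)) \<longlonglongrightarrow> S k x"
      unfolding S_def
      using z_lim by eventually_elim (intro isCont_tendsto_compose[OF DERIV_isCont[OF T(4)]])
    show "AE x in \<mu>. norm (T k (z j x)) powr p \<le> n k powr p" for j
      using T(2) p by (intro AE_I2 powr_mono2) auto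
    show "(\<lambda>x. T k (z j x)) \<in> borel_measurable \<mu>" for j by (rule test_measurable[OF Tt])
  qed measurable
  \<comment> \<open>Diagonal choice: for each \<open>k\<close> an index \<open>j\<close> that brings
    both the values and the gradients of the cut-off function close to their limits.\<close>
  have "\<exists>j. Lp_err p \<mu> (\<lambda>x. d k (z j x) *\<^sub>R grad (z j) x) (v k) < ennreal (1 / n k)
      \<and> Lp_err p \<mu> (\<lambda>x. T k (z j x)) (S k) < ennreal (1 / n k)" for k
  proof -
    have pos: "0 < ennreal (1 / n k)" using n1[of k] by simp
    show ?thesis
      using eventually_conj[OF order_tendstoD(2)[OF lim1[of k] pos] order_tendstoD(2)[OF lim2[of k] pos]]
      by (auto simp: eventually_sequentially)
  qed
  then obtain j where j: "\<And>k. Lp_err p \<mu> (\<lambda>x. d k (z (j k) x) *\<^sub>R grad (z (j k)) x) (v k) < ennreal (1 / n k)"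
      "\<And>k. Lp_err p \<mu> (\<lambda>x. T k (z (j k) x)) (S k) < ennreal (1 / n k)"
    by metis
  define \<psi> where "\<psi> k x = T k (z (j k) x)" for k x
  have \<psi>: "\<psi> k \<in> test_functions \<Omega>" for k unfolding \<psi>_def by (rule Tt)
  have g\<psi>: "grad (\<psi> k) = (\<lambda>x. d k (z (j k) x) *\<^sub>R grad (z (j k)) x)" for k
    unfolding \<psi>_def by (rule ext) (rule gT)
  note [measurable] = grad_measurable[OF \<psi>] test_measurable[OF \<psi>]
  have n0: "(\<lambda>k. ennreal (1 / n k)) \<longlonglongrightarrow> 0" using tendsto_ennrealI[OF q[of 1]] by simp
  have err1: "(\<lambda>k. Lp_err p \<mu> (grad (\<psi> k)) (v k)) \<longlonglongrightarrow> 0"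
    by (rule tendsto_sandwich[OF _ _ tendsto_const n0]) (use j in \<open>auto simp: g\<psi> less_imp_le\<close>)
  have err2: "(\<lambda>k. Lp_err p \<mu> (\<psi> k) (S k)) \<longlonglongrightarrow> 0"
    by (rule tendsto_sandwich[OF _ _ tendsto_const n0]) (use j in \<open>auto simp: \<psi>_def[abs_def] less_imp_le\<close>)
  have W: "integrable \<mu> (\<lambda>x. norm (w x) powr p)" unfolding w_def by (rule int)
  have gradT: "(\<lambda>k. Lp_err p \<mu> (grad (\<psi> k)) w) \<longlonglongrightarrow> 0"
  proof (rule Lp_err_trans_tendsto[OF _ _ _ _ err1])
    show "(\<lambda>k. Lp_err p \<mu> (v k) w) \<longlonglongrightarrow> 0"
    proof (rule Lp_dominated_convergence(3)[OF p _ _ W])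
      show "AE x in \<mu>. (\<lambda>k. v k x) \<longlonglongrightarrow> w x"
        unfolding v_def w_def by (intro AE_I2 tendsto_scaleR dlim tendsto_const)
      show "AE x in \<mu>. norm (v k x) powr p \<le> norm (w x) powr p" for k
        unfolding v_def w_def using T(5,7)[of k] p \<delta>
        by (intro AE_I2 powr_mono2) (auto intro!: mult_right_mono)
    qed auto
  qed (use p in auto)
  obtain C where C: "0 < C"
    "\<And>\<phi>. \<phi> \<in> test_functions \<Omega> \<Longrightarrow> integrable \<mu> (\<lambda>x. \<bar>\<phi> x\<bar> powr p)"
    "\<And>\<phi>. \<phi> \<in> test_functions \<Omega> \<Longrightarrow> (\<integral>x. \<bar>\<phi> x\<bar> powr p \<partial>\<mu>) \<le> C * energy \<phi>"
    by (rule Poincare_energy) blast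
  have W_fin: "Lp_err p \<mu> w (\<lambda>x. 0) < \<infinity>"
    using nn_integral_eq_integral[OF W] by (simp add: Lp_err_def)
  have "eventually (\<lambda>k. Lp_err p \<mu> (grad (\<psi> k)) w < 1 \<and> Lp_err p \<mu> (\<psi> k) (S k) < 1) sequentially"
    by (intro eventually_conj order_tendstoD(2)[OF gradT] order_tendstoD(2)[OF err2]) simp_all
  then obtain N where N: "\<And>k. k \<ge> N \<Longrightarrow> Lp_err p \<mu> (grad (\<psi> k)) w < 1" "\<And>k. k \<ge> N \<Longrightarrow> Lp_err p \<mu> (\<psi> k) (S k) < 1"
    by (auto simp: eventually_sequentially)
  \<comment> \<open>Finiteness of the p-th power integral of
    \<open>exp (\<delta> * u x) - 1\<close>: Poincare bounds \<open>\<psi> k\<close> by its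
    gradient, which is close to \<open>w\<close>, while \<open>S k\<close> is close to
    \<open>\<psi> k\<close>; each link costs a factor \<open>2 powr p\<close>. Fatou's lemma then
    removes the cutoff.\<close>
  define X where "X = ennreal (2 powr p) * (1 + ennreal C * (ennreal (2 powr p) * (1 + Lp_err p \<mu> w (\<lambda>x. 0))))"
  have Xfin: "X < \<infinity>" using W_fin by (simp add: X_def ennreal_mult_less_top ennreal_add_less_top)
  have TX: "(\<integral>\<^sup>+x. ennreal (norm (S k x) powr p) \<partial>\<mu>) \<le> X" if k: "k \<ge> N" for k
  proof -
    have "Lp_err p \<mu> (S k) (\<lambda>x. 0) \<le> ennreal (2 powr p) * (Lp_err p \<mu> (S k) (\<psi> k) + Lp_err p \<mu> (\<psi> k) (\<lambda>x. 0))"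
      using p by (intro Lp_err_triangle) auto
    also have "Lp_err p \<mu> (S k) (\<psi> k) \<le> 1"
      using N(2)[OF k] by (simp add: Lp_err_def abs_minus_commute less_imp_le)
    also have "Lp_err p \<mu> (\<psi> k) (\<lambda>x. 0) \<le> ennreal C * ennreal (energy (\<psi> k))"
    proof -
      have "Lp_err p \<mu> (\<psi> k) (\<lambda>x. 0) = ennreal (\<integral>x. \<bar>\<psi> k x\<bar> powr p \<partial>\<mu>)"
        using nn_integral_eq_integral[OF C(2)[OF \<psi>]] by (simp add: Lp_err_def)
      also have "\<dots> \<le> ennreal (C * energy (\<psi> k))" by (intro ennreal_leI C(3) \<psi>)
      finally show ?thesis using C(1) energy_nonneg by (simp add: ennreal_mult)
    qed
    also have "ennreal (energy (\<psi> k)) = Lp_err p \<mu> (grad (\<psi> k)) (\<lambda>x. 0)"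
      unfolding energy_def Lp_err_def using nn_integral_eq_integral[OF integrable_energy[OF \<psi>]] by simp
    also have "\<dots> \<le> ennreal (2 powr p) * (Lp_err p \<mu> (grad (\<psi> k)) w + Lp_err p \<mu> w (\<lambda>x. 0))"
      using p by (intro Lp_err_triangle) auto
    also have "Lp_err p \<mu> (grad (\<psi> k)) w \<le> 1" using N(1)[OF k] by simp
    finally show ?thesis by (simp add: X_def Lp_err_def mult_left_mono add_mono)
  qed
  have "(\<integral>\<^sup>+x. ennreal (norm (exp (\<delta> * u x) - 1) powr p) \<partial>\<mu>) \<le> X"
  proof (rule Fatou_bound[OF _ _ TX])
    show "AE x in \<mu>. (\<lambda>k. ennreal (norm (S k x) powr p)) \<longlonglongrightarrow> ennreal (norm (exp (\<delta> * u x) - 1) powr p)"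
      unfolding S_def
      using p by (intro AE_I2 tendsto_ennrealI tendsto_powr' tendsto_norm Tlim tendsto_const) auto
  qed auto
  then have EI: "integrable \<mu> (\<lambda>x. norm (exp (\<delta> * u x) - 1) powr p)"
    using Xfin by (intro integrableI_nonneg) auto
  have valT: "(\<lambda>k. Lp_err p \<mu> (\<psi> k) (\<lambda>x. exp (\<delta> * u x) - 1)) \<longlonglongrightarrow> 0"
  proof (rule Lp_err_trans_tendsto[OF _ _ _ _ err2])
    show "(\<lambda>k. Lp_err p \<mu> (S k) (\<lambda>x. exp (\<delta> * u x) - 1)) \<longlonglongrightarrow> 0"
    proof (rule Lp_dominated_convergence(3)[OF p _ _ EI])
      show "AE x in \<mu>. norm (S k x) powr p \<le> norm (exp (\<delta> * u x) - 1) powr p" for k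
        using u_nonneg
      proof eventually_elim
        case (elim x)
        then show ?case using T(3)[of "u x" k] p unfolding S_def by (intro powr_mono2) auto
      qed
    qed (use Tlim in \<open>auto simp: S_def\<close>)
  qed (use p in auto)
  have "W01p_grad p \<Omega> (\<lambda>x. exp (\<delta> * u x) - 1) w"
    unfolding W01p_grad_def using \<psi> gradT valT by (intro conjI exI[of _ \<psi>]) (auto simp: Lp_err_def)
  then show ?thesis unfolding W01p_def by blast
qed

text \<open>Solving \<open>c * l * s powr (p - 1) < 1\<close> for \<open>s\<close> gives precisely
  the threshold in the hypothesis.\<close>

lemma exp_bounds:
  assumes \<delta>: "\<delta> \<in> {0..<(p - 1) * l powr (- 1 / (p - 1))}"
  shows "(\<lambda>x. exp (\<delta> * u x) - 1) \<in> W01p p \<Omega>"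
proof (rule exp_in_W01p)
  show "0 \<le> \<delta>" using \<delta> by simp
  \<comment> \<open>The profile estimate is available for exponents at least 1; for smaller ones the
    gradient is dominated by that of exponent 1, because \<open>u\<close> is nonnegative.\<close>
  define m where "m = max 1 \<delta>"
  have sub: "c * l * s powr (p - 1) < 1" if s: "0 \<le> s" "s < (p - 1) * l powr (- 1 / (p - 1))" for s
  proof -
    have "s powr (p - 1) < ((p - 1) * l powr (- 1 / (p - 1))) powr (p - 1)"
      using s p by (intro powr_less_mono2) auto
    also have "\<dots> = (p - 1) powr (p - 1) * l powr (- 1)"
      using p l by (simp add: powr_mult powr_powr)
    finally have "c * l * s powr (p - 1) < c * l * ((p - 1) powr (p - 1) * l powr (- 1))"
      using cl by (intro mult_strict_left_mono)
    also have "\<dots> = ((p - 1) powr (p - 1) * c) * (l * l powr (- 1))" by (simp only: mult_ac)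
    also have "\<dots> = 1" unfolding c_inv using l by (simp add: powr_minus)
    finally show ?thesis .
  qed
  have m: "1 \<le> m" "c * l * m powr (p - 1) < 1"
    using sub[of \<delta>] \<delta> cl by (auto simp: m_def max_def)
  have i: "integrable \<mu> (\<lambda>x. norm ((m * exp (m * u x)) *\<^sub>R g x) powr p)"
    by (rule exp_gradient_integrable[OF m])
  show "integrable \<mu> (\<lambda>x. norm ((\<delta> * exp (\<delta> * u x)) *\<^sub>R g x) powr p)"
  proof (rule Bochner_Integration.integrable_bound[OF i])
    show "AE x in \<mu>. norm (norm ((\<delta> * exp (\<delta> * u x)) *\<^sub>R g x) powr p)
      \<le> norm (norm ((m * exp (m * u x)) *\<^sub>R g x) powr p)"
      using u_nonneg
    proof eventually_elim
      case (elim x)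
      have "\<delta> * exp (\<delta> * u x) \<le> m * exp (m * u x)"
        using elim \<delta> by (intro mult_mono) (auto simp: m_def intro!: mult_right_mono)
      then have "norm ((\<delta> * exp (\<delta> * u x)) *\<^sub>R g x) \<le> norm ((m * exp (m * u x)) *\<^sub>R g x)"
        using \<delta> m by (auto intro!: mult_right_mono)
      then show ?case using p by (auto intro!: powr_mono2)
    qed
  qed measurable
qed

end

theorem theorem1p1:
  fixes \<Omega> :: "'a::euclidean_space set" and p :: real and \<sigma> :: "'a measure"
  assumes "open \<Omega>" and "bounded \<Omega>" and "1 < p"
    and "locally_finite_measure_in \<Omega> \<sigma>"
  shows "((\<exists>u. solves_P p \<Omega> \<sigma> u) \<longrightarrow>
            in_dual_W01p p \<Omega> \<sigma> \<and> ineq_I p \<Omega> \<sigma> ((p - 1) powr (p - 1))) \<and>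
         (\<forall>l::real. 0 < l \<and> l < (p - 1) powr (p - 1) \<and>
            in_dual_W01p p \<Omega> \<sigma> \<and> ineq_I p \<Omega> \<sigma> l \<longrightarrow>
            (\<exists>u. solves_P p \<Omega> \<sigma> u \<and> (AE x in lebesgue_on \<Omega>. 0 \<le> u x) \<and>
               (\<forall>\<delta>\<in>{0..<(p - 1) * l powr (- 1 / (p - 1))}.
                  (\<lambda>x. exp (\<delta> * u x / (p - 1)) - 1) \<in> W01p p \<Omega>)))"
proof -
  interpret p_laplace_problem \<Omega> p \<sigma> using assms by unfold_locales
  have "\<exists>u. solves_P p \<Omega> \<sigma> u \<and> (AE x in lebesgue_on \<Omega>. 0 \<le> u x) \<and>
      (\<forall>\<delta>\<in>{0..<(p - 1) * l powr (- 1 / (p - 1))}. (\<lambda>x. exp (\<delta> * u x / (p - 1)) - 1) \<in> W01p p \<Omega>)"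
    if l: "0 < l" "l < (p - 1) powr (p - 1)" "in_dual_W01p p \<Omega> \<sigma>" "ineq_I p \<Omega> \<sigma> l" for l
  proof -
    interpret p_laplace_subcritical \<Omega> p \<sigma> l using l by unfold_locales
    obtain z e u g G where "p_laplace_minimizer \<Omega> p \<sigma> l z e u g G"
    proof (rule limit_exists)
      fix z e u g G
      assume "\<And>j::nat. z j \<in> test_functions \<Omega>" "\<And>j x. - 1 \<le> z j x"
        "\<And>j. J (z j) \<le> J_inf + e j" "\<And>j. 0 < e j" "e \<longlonglongrightarrow> 0"
        "u \<in> borel_measurable (lebesgue_on \<Omega>)" "g \<in> borel_measurable (lebesgue_on \<Omega>)"
        "integrable (lebesgue_on \<Omega>) G"
        "AE x in lebesgue_on \<Omega>. (\<lambda>j. z j x) \<longlonglongrightarrow> u x"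
        "AE x in lebesgue_on \<Omega>. (\<lambda>j. grad (z j) x) \<longlonglongrightarrow> g x"
        "\<And>j. AE x in lebesgue_on \<Omega>. \<bar>z j x\<bar> powr p \<le> G x"
        "\<And>j. AE x in lebesgue_on \<Omega>. norm (grad (z j) x) powr p \<le> G x"
        "AE x in lebesgue_on \<Omega>. 0 \<le> u x"
      then have "p_laplace_minimizer \<Omega> p \<sigma> l z e u g G" by unfold_locales
      then show thesis by (rule that)
    qed
    then interpret p_laplace_minimizer \<Omega> p \<sigma> l z e u g G .
    show ?thesis
    proof (intro exI conjI ballI)
      show "solves_P p \<Omega> \<sigma> (\<lambda>x. (p - 1) * u x)" by (rule solves)
      show "AE x in lebesgue_on \<Omega>. 0 \<le> (p - 1) * u x"
        using u_nonneg by eventually_elim (use p in simp)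
      show "(\<lambda>x. exp (\<delta> * ((p - 1) * u x) / (p - 1)) - 1) \<in> W01p p \<Omega>"
        if "\<delta> \<in> {0..<(p - 1) * l powr (- 1 / (p - 1))}" for \<delta>
        using exp_bounds[OF that] p by simp
    qed
  qed
  then show ?thesis using necessary_dual necessary_ineq by blast
qed

end
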